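(* For any integer $n\ge1$, let $\Phi_n$ be the superposition of $n$ independent, finite and weakly repulsive point processes $\Phi_{n,1},\dots,\Phi_{n,n}$ on $\mathbb X$, with respective correlation functions $\rho_{n,1},\dots,\rho_{n,n}$, and let $\zeta_M$ be a Poisson point process with intensity measure $M(\mathrm dx)=m(x)\,\ell(\mathrm dx)$. Then $$\Delta_{TV}^*(\Phi_n,\zeta_M)\le R_n+2n\Big(\max_{i\in\{1,\dots,n\}}\int_{\mathbb X}\rho_{n,i}(x)\,\ell(\mathrm dx)\Big)^2,\qquad R_n:=\int_{\mathbb X}\Big|\sum_{i=1}^n\rho_{n,i}(x)-m(x)\Big|\,\ell(\mathrm dx).$$
   Context: $\mathbb X$ is a locally compact metric space with its Borel $\sigma$-algebra, and $\ell$ is a Radon measure on $\mathbb X$ (not necessarily diffuse). $N_{\mathbb X}$ is the set of configurations, i.e. nonnegative-integer-valued measures on $\mathbb X$ finite on relatively compact Borel sets, with the smallest $\sigma$-algebra making $\phi\mapsto\phi(A)$ measurable for every relatively compact Borel $A$; $\widehat N_{\mathbb X}$ is the set of finite configurations. Configurations are treated as (multi)sets of points: $\sum_{x\in\phi}f(x)=\int f\,\mathrm d\phi$, $\phi\setminus x=\phi-\delta_x$. A point process is a random element of $N_{\mathbb X}$; it is finite if a.s. in $\widehat N_{\mathbb X}$. Superposition means sum of the measures. The correlation function $\rho:\widehat N_{\mathbb X}\to\mathbb R_+$ of $\Phi$ satisfies $\mathbb E[\sum_{\alpha\subset\Phi,\ \alpha\ \mathrm{finite}}u(\alpha)]=\sum_{k\ge0}\frac1{k!}\int_{\mathbb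 X^k}u(x_1,\dots,x_k)\rho(x_1,\dots,x_k)\,\ell(\mathrm dx_1)\cdots\ell(\mathrm dx_k)$ for all measurable $u\ge0$; in particular $\rho(x)=\rho(\{x\})$ is the density of the intensity measure $A\mapsto\mathbb E[\Phi(A)]$ with respect to $\ell$. A Papangelou intensity of $\Phi$ is a measurable $c:\mathbb X\times N_{\mathbb X}\to\mathbb R_+$ such that for all measurable $u:\mathbb X\times N_{\mathbb X}\to\mathbb R_+$, $\mathbb E[\sum_{x\in\Phi}u(x,\Phi\setminus x)]=\int_{\mathbb X}\mathbb E[c(x,\Phi)u(x,\Phi)]\,\ell(\mathrm dx)$. $\Phi$ is weakly repulsive if it has a version $c$ of its Papangelou intensity with $c(x,\phi)\le c(x,\varnothing)$ for all $x\in\mathbb X$, $\phi\in N_{\mathbb X}$. For measures $\nu_1,\nu_2$ on $\mathbb X$, $\Delta_{TV}(\nu_1,\nu_2)=\sup|\nu_1(A)-\nu_2(A)|$, the supremum being over Borel $A$ with $\nu_1(A),\nu_2(A)<\infty$. For point processes $\Phi_1,\Phi_2$ with laws $\mathbb P_1,\mathbb P_2$, $\Delta_{TV}^*(\Phi_1,\Phi_2)=\inf_{\mathbf C}\int\Delta_{TV}(\omega_1,\omega_2)\,\mathbf C(\mathrm d(\omega_1,\omega_2))$, the infimum being over all couplings $\mathbf C$ of $\mathbb P_1$ and $\mathbb P_2$. *)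

theory Defs
  imports "HOL-Probability.Probability"
begin

text \<open>The underlying space is a type of class \<open>metric_space\<close>; local compactness is assumed
  where needed, and no countability assumption is made. Laws of point processes
  are measures on \<^term>\<open>config_space\<close> below.\<close>

definition radon_measure :: "'a::metric_space measure \<Rightarrow> bool" where
  "radon_measure l \<longleftrightarrow> sets l = sets borel \<and>
     (\<forall>K. compact K \<longrightarrow> emeasure l K < \<infinity>) \<and>
     (\<forall>A\<in>sets borel. emeasure l A = (SUP K\<in>{K. compact K \<and> K \<subseteq> A}. emeasure l K))"

definition rc_borel :: "'a::metric_space set set" where
  "rc_borel = {A \<in> sets borel. compact (closure A)}"

text \<open>A configuration takes values in the nonnegative integers and infinity, the latter being
  excluded on relatively compact sets.\<close>

definition configs :: "'a::metric_space measure set" where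
  "configs = {\<phi>. sets \<phi> = sets borel \<and>
     (\<forall>A\<in>sets borel. emeasure \<phi> A \<in> insert \<infinity> (range of_nat)) \<and>
     (\<forall>A\<in>rc_borel. emeasure \<phi> A < \<infinity>)}"

definition finite_configs :: "'a::metric_space measure set" where
  "finite_configs = {\<phi> \<in> configs. emeasure \<phi> UNIV < \<infinity>}"

definition config_space :: "'a::metric_space measure measure" where
  "config_space = (SUP A\<in>rc_borel. vimage_algebra configs (\<lambda>\<phi>. emeasure \<phi> A) borel)"

definition superpose :: "'i set \<Rightarrow> ('i \<Rightarrow> 'a::metric_space measure) \<Rightarrow> 'a measure" where
  "superpose I \<phi> = measure_of UNIV (sets borel) (\<lambda>A. \<Sum>i\<in>I. emeasure (\<phi> i) A)"

text \<open>The Dirac mass at \<open>x\<close> is \<^term>\<open>return borel x\<close>. The configuration \<open>\<phi>\<close> minus \<open>x\<close> is only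
  meaningful when \<open>\<phi>\<close> has an atom at \<open>x\<close>.\<close>

definition remove_point :: "'a::metric_space measure \<Rightarrow> 'a \<Rightarrow> 'a measure" where
  "remove_point \<phi> x = diff_measure \<phi> (return borel x)"

definition config_of_tuple :: "nat \<Rightarrow> (nat \<Rightarrow> 'a::metric_space) \<Rightarrow> 'a measure" where
  "config_of_tuple k x = superpose {..<k} (\<lambda>i. return borel (x i))"

text \<open>A point of multiplicity \<open>m\<close> is counted as \<open>m\<close> distinguishable points \<open>(x, 0), ..., (x, m - 1)\<close>,
  and the sum over the finite parts \<open>\<alpha>\<close> of \<open>\<phi>\<close> is over finite sets of such points. With this
  convention the one-point parts contribute the integral of \<open>x \<mapsto> u {x}\<close> with respect to \<open>\<phi>\<close>, so
  that the correlation function at one point is a density of the intensity measure.\<close>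

definition labelled_points :: "'a::metric_space measure \<Rightarrow> ('a \<times> nat) set" where
  "labelled_points \<phi> = {(x, j). of_nat j < emeasure \<phi> {x}}"

definition sum_finite_parts :: "('a::metric_space measure \<Rightarrow> real) \<Rightarrow> 'a measure \<Rightarrow> ennreal" where
  "sum_finite_parts u \<phi> =
     (\<integral>\<^sup>+S. ennreal (u (superpose S (\<lambda>p. return borel (fst p))))
        \<partial>count_space {S. finite S \<and> S \<subseteq> labelled_points \<phi>})"

definition correlation_function ::
    "'a::metric_space measure \<Rightarrow> 'a measure measure \<Rightarrow> ('a measure \<Rightarrow> real) \<Rightarrow> bool" where
  "correlation_function l P \<rho> \<longleftrightarrow>
     \<rho> \<in> borel_measurable (restrict_space config_space finite_configs) \<and>
     (\<forall>\<alpha>\<in>finite_configs. 0 \<le> \<rho> \<alpha>) \<and>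
     (\<forall>u. u \<in> borel_measurable (restrict_space config_space finite_configs) \<longrightarrow>
        (\<forall>\<alpha>\<in>finite_configs. 0 \<le> u \<alpha>) \<longrightarrow>
        (\<integral>\<^sup>+\<phi>. sum_finite_parts u \<phi> \<partial>P) =
        (\<Sum>k. ennreal (1 / fact k) *
           (\<integral>\<^sup>+x. ennreal (u (config_of_tuple k x) * \<rho> (config_of_tuple k x))
              \<partial>(\<Pi>\<^sub>M i\<in>{..<k}. l))))"

definition papangelou_intensity ::
    "'a::metric_space measure \<Rightarrow> 'a measure measure \<Rightarrow> ('a \<times> 'a measure \<Rightarrow> real) \<Rightarrow> bool" where
  "papangelou_intensity l P c \<longleftrightarrow>
     c \<in> borel_measurable (borel \<Otimes>\<^sub>M config_space) \<and>
     (\<forall>x. \<forall>\<phi>\<in>configs. 0 \<le> c (x, \<phi>)) \<and>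
     (\<forall>u. u \<in> borel_measurable (borel \<Otimes>\<^sub>M config_space) \<longrightarrow>
        (\<forall>x. \<forall>\<phi>\<in>configs. 0 \<le> u (x, \<phi>)) \<longrightarrow>
        (\<integral>\<^sup>+\<phi>. (\<integral>\<^sup>+x. ennreal (u (x, remove_point \<phi> x)) \<partial>\<phi>) \<partial>P) =
        (\<integral>\<^sup>+x. (\<integral>\<^sup>+\<phi>. ennreal (c (x, \<phi>) * u (x, \<phi>)) \<partial>P) \<partial>l))"

definition weakly_repulsive :: "'a::metric_space measure \<Rightarrow> 'a measure measure \<Rightarrow> bool" where
  "weakly_repulsive l P \<longleftrightarrow>
     (\<exists>c. papangelou_intensity l P c \<and>
        (\<forall>x. \<forall>\<phi>\<in>configs. c (x, \<phi>) \<le> c (x, null_measure borel)))"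

definition finite_process :: "'a::metric_space measure measure \<Rightarrow> bool" where
  "finite_process P \<longleftrightarrow> (AE \<phi> in P. \<phi> \<in> finite_configs)"

text \<open>The law of a point process in \<^term>\<open>config_space\<close> forces the intensity measure \<open>M\<close> to be
  finite on relatively compact sets, which is therefore part of the definition.\<close>

definition poisson_process :: "'a::metric_space measure \<Rightarrow> 'a measure measure \<Rightarrow> bool" where
  "poisson_process M P \<longleftrightarrow> sets M = sets borel \<and>
     prob_space P \<and> sets P = sets config_space \<and>
     (\<forall>A\<in>rc_borel. emeasure M A < \<infinity> \<and>
        (\<forall>k. measure P {\<phi> \<in> space P. emeasure \<phi> A = of_nat k} =
           measure M A ^ k / fact k * exp (- measure M A))) \<and>
     (\<forall>k. \<forall>A :: nat \<Rightarrow> 'a set. (\<forall>i<k. A i \<in> rc_borel) \<longrightarrow> disjoint_family_on A {..<k} \<longrightarrow>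
        prob_space.indep_vars P (\<lambda>_. borel) (\<lambda>i \<phi>. emeasure \<phi> (A i)) {..<k})"

definition Delta_TV :: "'a::metric_space measure \<Rightarrow> 'a measure \<Rightarrow> ennreal" where
  "Delta_TV \<nu>1 \<nu>2 =
     (SUP A\<in>{A \<in> sets borel. emeasure \<nu>1 A < \<infinity> \<and> emeasure \<nu>2 A < \<infinity>}.
        ennreal \<bar>measure \<nu>1 A - measure \<nu>2 A\<bar>)"

definition couplings ::
    "'a::metric_space measure measure \<Rightarrow> 'a measure measure \<Rightarrow> ('a measure \<times> 'a measure) measure set"
  where
  "couplings P1 P2 = {C. sets C = sets (config_space \<Otimes>\<^sub>M config_space) \<and>
     distr C config_space fst = P1 \<and> distr C config_space snd = P2}"

definition Delta_TV_star ::
    "'a::metric_space measure measure \<Rightarrow> 'a measure measure \<Rightarrow> ennreal" where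
  "Delta_TV_star P1 P2 = (INF C\<in>couplings P1 P2. \<integral>\<^sup>+z. Delta_TV (fst z) (snd z) \<partial>C)"

end

theory Submission
  imports Defs
begin

text \<open>Taking \<open>u\<close> to be the indicator of \<open>x \<in> A\<close>, and then of \<open>x \<in> A\<close> and \<open>\<phi> = \<emptyset>\<close>, in the equation that
  defines the Papangelou intensity, weak repulsion gives
  \<open>E[\<Phi>(A); \<bar>\<Phi>\<bar> = 1] \<ge> P(\<Phi> = \<emptyset>) E[\<Phi>(A)]\<close>. So the law of a weakly repulsive process \<open>\<Phi>\<close> with mean
  number of points \<open>I\<close> and that of a Poisson process whose intensity measure \<open>\<mu>\<close> lies below that of
  \<open>\<Phi>\<close> both dominate \<open>q (\<delta>\<^sub>\<emptyset> + \<integral> \<delta>\<^bsub>{x}\<^esub> \<mu>(dx))\<close>, where \<open>q \<ge> 1 - I\<close>. Coupling them to agree on this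
  common part makes the mean distance at most \<open>I + \<mu>(X) - 2 q \<mu>(X) \<le> I - \<mu>(X) + 2 I\<^sup>2\<close>.

  With \<open>\<rho>\<close> the sum of the \<open>\<rho>\<^sub>i\<close>, apply this to \<open>\<Phi>\<^sub>i\<close> and the density \<open>\<rho>\<^sub>i min(\<rho>, m) / \<rho>\<close>,
  independently for each \<open>i\<close>, and add an independent Poisson process of density \<open>m - min(\<rho>, m)\<close>. The
  sum on the Poisson side has intensity \<open>M\<close>, and the excess terms add up to \<open>\<integral> \<bar>\<rho> - m\<bar>\<close>.

  No separability is assumed, but a space that carries a finite point process is \<open>\<sigma>\<close>-compact: an
  event depends on countably many relatively compact sets only, and if these did not exhaust the
  space up to a compact set, an infinite configuration could be hidden outside them.\<close>

section \<open>Configurations and their \<open>\<sigma>\<close>-algebra\<close>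

text \<open>The factor 2 arises because the distance counts unshared points on both sides: of the
  mass of \<open>\<mu>\<close>, the fraction \<open>1 - q\<close> missed by the common part is paid
  once in each law. The measure \<open>\<mu>\<close> must lie below the intensity of the repulsive
  process, since the one-point inequality survives only a decrease of the measure. Hence the part of
  \<open>m\<close> above the sum of the intensities cannot be shared out among the factors and gets
  a Poisson process of its own.

  Two obstacles shape the rest. \<open>Delta_TV\<close> is a supremum over uncountably many sets and
  is treated as a possibly non-measurable integrand; it is bounded by the number of unshared points,
  which is measurable. And a Poisson process is given only by its counts in relatively compact sets,
  so the law of the constructed sum is recognised through joint generating functions of such counts:
  they multiply under independent superposition and determine the law.\<close>

lemma rc_borel_subset:
  assumes "A \<in> rc_borel" "B \<in> sets borel" "B \<subseteq> A"
  shows "B \<in> rc_borel"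
  using assms closure_mono[of B A] compact_Int_closed[of "closure A" "closure B"]
  by (auto simp: rc_borel_def Int_absorb1)

lemma rc_borel_compact: "compact K \<Longrightarrow> K \<in> rc_borel"
  by (auto simp: rc_borel_def compact_imp_closed borel_closed)

lemma rc_borel_sets: "A \<in> rc_borel \<Longrightarrow> A \<in> sets borel"
  by (simp add: rc_borel_def)

lemma empty_in_rc_borel [simp]: "{} \<in> rc_borel"
  by (simp add: rc_borel_def)

lemma sets_config: "\<phi> \<in> configs \<Longrightarrow> sets \<phi> = sets borel"
  by (simp add: configs_def)

lemma space_config: "\<phi> \<in> configs \<Longrightarrow> space \<phi> = UNIV"
  using sets_eq_imp_space_eq[OF sets_config] by simp

lemma config_cases:
  assumes "\<phi> \<in> configs"
  obtains "emeasure \<phi> A = \<infinity>" | k where "emeasure \<phi> A = of_nat k"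
proof (cases "A \<in> sets borel")
  case True
  then have "emeasure \<phi> A \<in> insert \<infinity> (range of_nat)"
    using assms by (auto simp: configs_def)
  then show ?thesis using that by auto
next
  case False
  then show ?thesis
    using emeasure_notin_sets[of A \<phi>] that(2)[of 0] sets_config[OF assms] by auto
qed

lemma config_finite_nat:
  assumes "\<phi> \<in> configs" "emeasure \<phi> A \<noteq> \<infinity>"
  shows "\<exists>k. emeasure \<phi> A = of_nat k"
  using config_cases[OF assms(1), of A] assms(2) by metis

lemma config_ge_1:
  assumes "\<phi> \<in> configs" "emeasure \<phi> A \<noteq> 0"
  shows "1 \<le> emeasure \<phi> A"
  using config_cases[OF assms(1), of A]
proof cases
  case (2 k)
  then show ?thesis using assms(2) by (cases k) auto
qed auto

lemma null_config [simp]: "null_measure borel \<in> configs"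
  by (auto simp: configs_def intro: range_eqI[of _ _ 0])

lemma config_mass_0:
  assumes "\<phi> \<in> configs" "emeasure \<phi> UNIV = 0"
  shows "\<phi> = null_measure borel"
proof (rule measure_eqI)
  fix A
  show "emeasure \<phi> A = emeasure (null_measure borel) A"
    using emeasure_space[of \<phi> A] assms by (simp add: space_config)
qed (use assms in \<open>simp add: sets_config\<close>)

lemma return_config [simp]: "return borel x \<in> configs"
proof -
  have "indicator A x \<in> range (of_nat :: nat \<Rightarrow> ennreal)" for A :: "'a set"
    by (auto simp: indicator_def intro: range_eqI[of _ _ 0] range_eqI[of _ _ 1])
  then show ?thesis
    by (auto simp: configs_def rc_borel_def indicator_def)
qed

lemma space_config_space [simp]:
  "space config_space = (configs :: 'a::metric_space measure set)"
proof -
  have "(rc_borel :: 'a set set) \<noteq> {}" using empty_in_rc_borel by blast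
  then show ?thesis by (auto simp: config_space_def space_Sup_eq_UN)
qed

lemma sets_config_space_sigma:
  "sets config_space = sigma_sets configs {(\<lambda>\<phi>. emeasure \<phi> A) -` B \<inter> configs |A B. A \<in> rc_borel \<and> B \<in> sets borel}"
    (is "_ = sigma_sets _ ?E")
proof -
  have ne: "(\<lambda>A. vimage_algebra configs (\<lambda>\<phi>. emeasure \<phi> A) borel) ` (rc_borel :: 'a set set) \<noteq> {}"
    using empty_in_rc_borel by blast
  have "sets (config_space :: 'a measure measure) = sigma_sets configs (\<Union>A\<in>rc_borel.
      sets (vimage_algebra configs (\<lambda>\<phi>. emeasure \<phi> A) borel))"
    unfolding config_space_def by (subst sets_Sup_eq[where X=configs, OF _ ne]) auto
  also have "(\<Union>A\<in>rc_borel. sets (vimage_algebra configs (\<lambda>\<phi>. emeasure \<phi> A) borel)) = ?E"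
    by (auto simp: sets_vimage_algebra2)
  finally show ?thesis .
qed

lemma measurable_emeasure_rc:
  assumes "A \<in> rc_borel"
  shows "(\<lambda>\<phi>. emeasure \<phi> A) \<in> borel_measurable config_space"
proof (rule measurableI)
  fix B :: "ennreal set" assume "B \<in> sets borel"
  then show "(\<lambda>\<phi>. emeasure \<phi> A) -` B \<inter> space config_space \<in> sets config_space"
    using assms by (auto simp: sets_config_space_sigma intro!: sigma_sets.Basic)
qed simp

lemma measurable_config_spaceI:
  fixes f :: "'b \<Rightarrow> 'a::metric_space measure"
  assumes "\<And>x. x \<in> space M \<Longrightarrow> f x \<in> configs"
    and "\<And>A. A \<in> rc_borel \<Longrightarrow> (\<lambda>x. emeasure (f x) A) \<in> borel_measurable M"
  shows "f \<in> measurable M config_space"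
proof (rule measurable_sigma_sets[OF sets_config_space_sigma])
  fix X :: "'a measure set" assume "X \<in> {(\<lambda>\<phi>. emeasure \<phi> A) -` B \<inter> configs |A B. A \<in> rc_borel \<and> B \<in> sets borel}"
  then obtain A B where X: "X = (\<lambda>\<phi>. emeasure \<phi> A) -` B \<inter> configs" "A \<in> rc_borel" "B \<in> sets borel"
    by auto
  have "f -` X \<inter> space M = (\<lambda>x. emeasure (f x) A) -` B \<inter> space M"
    using assms(1) X by auto
  then show "f -` X \<inter> space M \<in> sets M"
    using measurable_sets[OF assms(2)[OF X(2)] X(3)] by simp
qed (use assms in auto)

lemma sets_superpose [simp]: "sets (superpose I \<phi>) = sets borel"
  unfolding superpose_def using sets.sigma_sets_eq[of "borel :: 'a measure"]
  by (simp add: sets_measure_of_conv)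

lemma space_superpose [simp]: "space (superpose I \<phi>) = UNIV"
  using sets_eq_imp_space_eq[OF sets_superpose] by simp

lemma emeasure_superpose:
  fixes \<phi> :: "'i \<Rightarrow> 'a::metric_space measure"
  assumes "\<And>i. i \<in> I \<Longrightarrow> sets (\<phi> i) = sets borel"
  shows "emeasure (superpose I \<phi>) A = (\<Sum>i\<in>I. emeasure (\<phi> i) A)"
proof (cases "A \<in> sets borel")
  case True
  show ?thesis unfolding superpose_def
  proof (rule emeasure_measure_of_sigma)
    show "sigma_algebra UNIV (sets (borel :: 'a measure))"
      using sets.sigma_algebra_axioms[of borel] by simp
    show "countably_additive (sets borel) (\<lambda>A. \<Sum>i\<in>I. emeasure (\<phi> i) A)"
    proof (rule countably_additiveI)
      fix B :: "nat \<Rightarrow> 'a set"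
      assume B: "range B \<subseteq> sets borel" "disjoint_family B"
      then have "(\<Sum>k. emeasure (\<phi> i) (B k)) = emeasure (\<phi> i) (\<Union>k. B k)" if "i \<in> I" for i
        using assms[OF that] by (intro suminf_emeasure) auto
      then show "(\<Sum>k. \<Sum>i\<in>I. emeasure (\<phi> i) (B k)) = (\<Sum>i\<in>I. emeasure (\<phi> i) (\<Union>k. B k))"
        by (subst suminf_sum) auto
    qed
  qed (use True in \<open>auto simp: positive_def\<close>)
next
  case False
  then show ?thesis
    using emeasure_notin_sets[of A "superpose I \<phi>"] emeasure_notin_sets[of A] assms by simp
qed

lemma superpose_cong: "(\<And>i. i \<in> I \<Longrightarrow> \<phi> i = \<psi> i) \<Longrightarrow> superpose I \<phi> = superpose I \<psi>"
  unfolding superpose_def by (simp cong: sum.cong)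

lemma superpose_config:
  assumes "finite I" "\<And>i. i \<in> I \<Longrightarrow> \<phi> i \<in> configs"
  shows "superpose I \<phi> \<in> configs"
proof -
  have s: "emeasure (superpose I \<phi>) A = (\<Sum>i\<in>I. emeasure (\<phi> i) A)" for A
    using assms(2) by (intro emeasure_superpose sets_config)
  have "(\<Sum>i\<in>I. emeasure (\<phi> i) A) \<in> insert \<infinity> (range of_nat)" for A
    using assms
  proof (induction I rule: finite_induct)
    case (insert i I)
    have "\<phi> i \<in> configs" using insert by auto
    from config_cases[OF this, of A] show ?case
    proof cases
      case (2 k)
      have "(\<Sum>i\<in>I. emeasure (\<phi> i) A) \<in> insert \<infinity> (range of_nat)" using insert by auto
      then consider "(\<Sum>i\<in>I. emeasure (\<phi> i) A) = \<infinity>" | j where "(\<Sum>i\<in>I. emeasure (\<phi> i) A) = of_nat j"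
        by blast
      then show ?thesis
        using 2 insert(1,2)
        by cases (auto simp: intro: range_eqI[of _ _ "k + j" for j] simp flip: of_nat_add)
    qed (use insert in auto)
  qed (auto intro: range_eqI[of _ _ 0])
  moreover have "emeasure (superpose I \<phi>) A < \<infinity>" if "A \<in> rc_borel" for A
    using assms that by (auto simp: s configs_def)
  ultimately show ?thesis by (auto simp: configs_def s)
qed

lemma measurable_superpose:
  fixes f :: "'i \<Rightarrow> 'b \<Rightarrow> 'a::metric_space measure"
  assumes "finite I" "\<And>i. i \<in> I \<Longrightarrow> f i \<in> measurable M config_space"
  shows "(\<lambda>x. superpose I (\<lambda>i. f i x)) \<in> measurable M config_space"
proof (rule measurable_config_spaceI)
  have c: "f i x \<in> configs" if "x \<in> space M" "i \<in> I" for x i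
    using measurable_space[OF assms(2)] that by auto
  then show "superpose I (\<lambda>i. f i x) \<in> configs" if "x \<in> space M" for x
    using assms(1) that by (intro superpose_config) auto
  fix A :: "'a set" assume A: "A \<in> rc_borel"
  have "(\<lambda>x. \<Sum>i\<in>I. emeasure (f i x) A) \<in> borel_measurable M"
    using assms(2) measurable_compose[OF _ measurable_emeasure_rc[OF A]]
    by (intro borel_measurable_sum) auto
  then show "(\<lambda>x. emeasure (superpose I (\<lambda>i. f i x)) A) \<in> borel_measurable M"
    by (subst measurable_cong[where g="\<lambda>x. \<Sum>i\<in>I. emeasure (f i x) A"])
       (use c in \<open>auto intro!: emeasure_superpose simp: sets_config\<close>)
qed

lemma measurable_return_config: "(return borel :: 'a::metric_space \<Rightarrow> _) \<in> measurable borel config_space"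
proof (rule measurable_config_spaceI)
  fix A :: "'a set" assume "A \<in> rc_borel"
  then show "(\<lambda>x. emeasure (return borel x) A) \<in> borel_measurable borel"
    by (auto simp: rc_borel_def)
qed simp

lemma emeasure_config_of_tuple:
  "A \<in> sets borel \<Longrightarrow> emeasure (config_of_tuple k x) A = (\<Sum>i<k. indicator A (x i))"
  unfolding config_of_tuple_def by (subst emeasure_superpose) auto

lemma measurable_config_of_tuple:
  assumes "\<And>i. i < k \<Longrightarrow> sets (M i) = sets borel"
  shows "config_of_tuple k \<in> measurable (Pi\<^sub>M {..<k} M) config_space"
  unfolding config_of_tuple_def
proof (rule measurable_superpose)
  fix i assume i: "i \<in> {..<k}"
  have "(\<lambda>x. x i) \<in> measurable (Pi\<^sub>M {..<k} M) borel"
    using measurable_component_singleton[OF i, of M] measurable_cong_sets[OF refl assms] i by blast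
  from measurable_compose[OF this measurable_return_config]
  show "(\<lambda>x. return borel (x i)) \<in> measurable (Pi\<^sub>M {..<k} M) config_space" .
qed simp

section \<open>A space carrying a finite point process is \<open>\<sigma>\<close>-compact\<close>

text \<open>The sets that depend on countably many counts form a sigma-algebra containing the
  generators, because a countable union of countable families is countable. It allows a
  configuration to be altered without a given event noticing.\<close>

lemma config_sets_countably_determined:
  assumes "N \<in> sets config_space"
  obtains \<A> where "countable \<A>" "\<A> \<subseteq> rc_borel"
    "\<And>\<phi> \<psi>. \<lbrakk>\<phi> \<in> configs; \<psi> \<in> configs; \<forall>A\<in>\<A>. emeasure \<phi> A = emeasure \<psi> A\<rbrakk> \<Longrightarrow> \<phi> \<in> N \<longleftrightarrow> \<psi> \<in> N"
proof -
  define D where "D N \<A> \<longleftrightarrow> countable \<A> \<and> \<A> \<subseteq> rc_borel \<and> (\<forall>\<phi>\<in>configs. \<forall>\<psi>\<in>configs.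
    (\<forall>A\<in>\<A>. emeasure \<phi> A = emeasure \<psi> A) \<longrightarrow> (\<phi> \<in> N \<longleftrightarrow> \<psi> \<in> N))" for N :: "'a measure set" and \<A>
  have "\<exists>\<A>. D N \<A>"
    using assms unfolding sets_config_space_sigma
  proof (induction rule: sigma_sets.induct)
    case (Basic a)
    then obtain A B where "a = (\<lambda>\<phi>. emeasure \<phi> A) -` B \<inter> configs" "A \<in> rc_borel"
      by auto
    then show ?case by (intro exI[of _ "{A}"]) (auto simp: D_def)
  next
    case Empty
    show ?case by (intro exI[of _ "{}"]) (auto simp: D_def)
  next
    case (Compl a)
    from Compl.IH obtain \<A> where "D a \<A>" by (rule exE)
    have "D (configs - a) \<A>"
      unfolding D_def
    proof (intro conjI ballI impI)
      fix \<phi> \<psi> :: "'a measure"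
      assume *: "\<phi> \<in> configs" "\<psi> \<in> configs" "\<forall>A\<in>\<A>. emeasure \<phi> A = emeasure \<psi> A"
      then have "\<phi> \<in> a \<longleftrightarrow> \<psi> \<in> a"
        using \<open>D a \<A>\<close> unfolding D_def by blast
      then show "\<phi> \<in> configs - a \<longleftrightarrow> \<psi> \<in> configs - a" using * by simp
    qed (use \<open>D a \<A>\<close> in \<open>unfold D_def, blast+\<close>)
    then show ?case by (rule exI)
  next
    case (Union a)
    from Union.IH have "\<forall>i. \<exists>\<A>. D (a i) \<A>" by (rule allI)
    from choice[OF this] obtain \<A> where \<A>: "\<And>i. D (a i) (\<A> i)" by blast
    have "D (\<Union> (range a)) (\<Union>i. \<A> i)"
      unfolding D_def
    proof (intro conjI ballI impI)
      fix \<phi> \<psi> :: "'a measure"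
      assume *: "\<phi> \<in> configs" "\<psi> \<in> configs" "\<forall>A\<in>(\<Union>i. \<A> i). emeasure \<phi> A = emeasure \<psi> A"
      have "\<phi> \<in> a i \<longleftrightarrow> \<psi> \<in> a i" for i
        using \<A>[of i] * unfolding D_def by blast
      then show "\<phi> \<in> \<Union> (range a) \<longleftrightarrow> \<psi> \<in> \<Union> (range a)" by blast
    qed (use \<A> in \<open>unfold D_def, blast intro: countable_UN[OF countableI_type], blast\<close>)
    then show ?case by (rule exI)
  qed
  then obtain \<A> where "D N \<A>" by blast
  then show ?thesis using that[of \<A>] unfolding D_def by blast
qed

text \<open>Finitely many open neighbourhoods with compact hulls cover \<open>K\<close>. With it the
  countably many sets of the previous lemma are enlarged to open ones, so that what they leave
  uncovered is closed.\<close>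

lemma compact_in_open_rc:
  fixes K :: "'a::metric_space set"
  assumes "locally_compact_space (euclidean :: 'a topology)" "compact K"
  shows "\<exists>U L. open U \<and> compact L \<and> K \<subseteq> U \<and> U \<subseteq> L"
proof -
  have "\<exists>U L. open U \<and> compact L \<and> x \<in> U \<and> U \<subseteq> L" for x :: 'a
    using assms(1) unfolding locally_compact_space_def by auto
  then obtain U L where UL: "\<And>x :: 'a. open (U x) \<and> compact (L x) \<and> x \<in> U x \<and> U x \<subseteq> L x"
    by metis
  obtain F where F: "F \<subseteq> K" "finite F" "K \<subseteq> (\<Union>x\<in>F. U x)"
    using compactE_image[OF assms(2), of K U] UL by blast
  have "open (\<Union>x\<in>F. U x)" "compact (\<Union>x\<in>F. L x)" "(\<Union>x\<in>F. U x) \<subseteq> (\<Union>x\<in>F. L x)"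
    using F(2) UL by (auto intro!: open_UN compact_UN)
  then show ?thesis using F(3) by blast
qed

text \<open>One point at each element of \<open>T\<close>. The counting is left to
  \<open>count_space UNIV\<close>, which measures every set, so \<open>T\<close> may be
  arbitrary.\<close>

definition counting_on :: "'a::metric_space set \<Rightarrow> 'a measure" where
  "counting_on T = measure_of UNIV (sets borel) (\<lambda>A. emeasure (count_space UNIV) (A \<inter> T))"

lemma sets_counting_on [simp]: "sets (counting_on T) = sets borel"
  unfolding counting_on_def using sets.sigma_sets_eq[of "borel :: 'a measure"]
  by (simp add: sets_measure_of_conv)

lemma emeasure_counting_on:
  fixes T :: "'a::metric_space set"
  assumes "A \<in> sets borel"
  shows "emeasure (counting_on T) A = emeasure (count_space UNIV) (A \<inter> T)"
  unfolding counting_on_def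
proof (rule emeasure_measure_of_sigma)
  show "sigma_algebra UNIV (sets (borel :: 'a measure))"
    using sets.sigma_algebra_axioms[of borel] by simp
  show "countably_additive (sets borel) (\<lambda>A. emeasure (count_space UNIV) (A \<inter> T))"
  proof (rule countably_additiveI)
    fix B :: "nat \<Rightarrow> 'a set"
    assume "disjoint_family B"
    then have "(\<Sum>k. emeasure (count_space UNIV) (B k \<inter> T)) = emeasure (count_space UNIV) (\<Union>k. B k \<inter> T)"
      by (intro suminf_emeasure) (auto simp: disjoint_family_on_def)
    then show "(\<Sum>k. emeasure (count_space UNIV) (B k \<inter> T)) = emeasure (count_space UNIV) (\<Union> (range B) \<inter> T)"
      by simp
  qed
qed (use assms in \<open>auto simp: positive_def\<close>)

lemma counting_on_config:
  assumes "\<And>K. compact K \<Longrightarrow> finite (K \<inter> T)"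
  shows "counting_on T \<in> configs"
proof -
  have *: "emeasure (count_space UNIV) A \<in> insert \<infinity> (range of_nat)" for A :: "'a set"
    by (cases "finite A") (auto simp: emeasure_count_space)
  have "emeasure (counting_on T) A < \<infinity>" if "A \<in> rc_borel" for A
  proof -
    have "finite (closure A \<inter> T)" using that assms by (auto simp: rc_borel_def)
    then have "finite (A \<inter> T)" by (rule rev_finite_subset) (use closure_subset in auto)
    then show ?thesis
      using that of_nat_less_top by (auto simp: emeasure_counting_on rc_borel_def)
  qed
  with * show ?thesis by (auto simp: configs_def emeasure_counting_on)
qed

lemma finite_process_sigma_compact:
  fixes P :: "'a::metric_space measure measure"
  assumes lc: "locally_compact_space (euclidean :: 'a topology)"
    and P: "prob_space P" "sets P = sets config_space" "finite_process P"
  shows "\<exists>K :: nat \<Rightarrow> 'a set. (\<forall>n. compact (K n)) \<and> (\<Union>n. K n) = UNIV"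
proof -
  interpret prob_space P by fact
  have spP: "space P = configs" using sets_eq_imp_space_eq[OF P(2)] by simp
  obtain N where N: "N \<in> null_sets P" "{\<phi> \<in> space P. \<phi> \<notin> finite_configs} \<subseteq> N"
    using P(3) unfolding finite_process_def eventually_ae_filter by auto
  have "N \<noteq> space P" using N(1) emeasure_space_1 by auto
  moreover have "N \<subseteq> space P" using N(1) by (auto dest: sets.sets_into_space)
  ultimately obtain \<phi> where \<phi>: "\<phi> \<in> configs" "\<phi> \<notin> N"
    using spP by auto
  have "N \<in> sets config_space" using N(1) P(2) by auto
  then obtain \<A> where
    \<A>: "countable \<A>" "\<A> \<subseteq> rc_borel"
      "\<And>\<phi> \<psi>. \<lbrakk>\<phi> \<in> configs; \<psi> \<in> configs; \<forall>A\<in>\<A>. emeasure \<phi> A = emeasure \<psi> A\<rbrakk> \<Longrightarrow> (\<phi> \<in> N \<longleftrightarrow> \<psi> \<in> N)"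
    using config_sets_countably_determined[of N] by blast
  have "\<exists>U L. open U \<and> compact L \<and> closure A \<subseteq> U \<and> U \<subseteq> L" if "A \<in> \<A>" for A
    using \<A> that by (intro compact_in_open_rc[OF lc]) (auto simp: rc_borel_def)
  then obtain U L where UL: "\<And>A. A \<in> \<A> \<Longrightarrow> open (U A) \<and> compact (L A) \<and> closure A \<subseteq> U A \<and> U A \<subseteq> L A"
    by metis
  \<comment> \<open>What the open hulls leave uncovered; once shown to be compact, it completes the
    sets \<open>L A\<close> to a countable compact cover.\<close>
  define C where "C = - (\<Union>A\<in>\<A>. U A)"
  have "closed C" unfolding C_def using UL by (auto intro!: open_UN)
  have "compact C"
    unfolding compact_eq_Bolzano_Weierstrass
  proof (intro allI impI, rule ccontr)
    fix T assume T: "infinite T \<and> T \<subseteq> C" and "\<not> (\<exists>x\<in>C. x islimpt T)"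
    \<comment> \<open>A limit point of \<open>T\<close> would lie in the closed set
      \<open>C\<close>, so \<open>T\<close> has none in the whole space. A compact set then meets
      \<open>T\<close> in finitely many points, which makes \<open>T\<close> a
      configuration.\<close>
    then have nl: "\<not> x islimpt T" for x
      using \<open>closed C\<close> by (meson closed_limpt islimpt_subset)
    have "finite (K \<inter> T)" if "compact K" for K
    proof (rule ccontr)
      assume "infinite (K \<inter> T)"
      moreover have "\<forall>S. infinite S \<and> S \<subseteq> K \<longrightarrow> (\<exists>x\<in>K. x islimpt S)"
        using that by (simp only: compact_eq_Bolzano_Weierstrass)
      ultimately obtain x where "x islimpt (K \<inter> T)" by blast
      then show False using nl islimpt_subset[of x "K \<inter> T" T] by auto
    qed
    then have c: "counting_on T \<in> configs" by (rule counting_on_config)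
    \<comment> \<open>\<open>\<psi>\<close> is \<open>\<phi>\<close> with the infinite set
      \<open>T\<close> added outside all sets of \<open>\<A>\<close>. The event \<open>N\<close>
      cannot tell the two apart, so \<open>\<psi>\<close> would have to be a finite
      configuration.\<close>
    define \<psi> where "\<psi> = superpose UNIV (\<lambda>b. if b then \<phi> else counting_on T)"
    have \<psi>: "\<psi> \<in> configs"
      unfolding \<psi>_def using \<phi> c by (intro superpose_config) auto
    have e: "emeasure \<psi> A = emeasure \<phi> A + emeasure (counting_on T) A" for A
      unfolding \<psi>_def using \<phi> c by (subst emeasure_superpose) (auto simp: sets_config UNIV_bool ac_simps)
    have "emeasure \<phi> A = emeasure \<psi> A" if "A \<in> \<A>" for A
    proof -
      have "A \<subseteq> U A" using UL[OF that] closure_subset[of A] by auto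
      then have "A \<inter> T = {}"
        using T that by (auto simp: C_def)
      then show ?thesis
        using \<A>(2) that by (auto simp: e emeasure_counting_on rc_borel_def)
    qed
    then have "\<psi> \<notin> N" using \<A>(3)[OF \<phi>(1) \<psi>] \<phi>(2) by blast
    then have "\<psi> \<in> finite_configs" using N(2) \<psi> spP by auto
    then show False using T by (auto simp: finite_configs_def e emeasure_counting_on)
  qed
  let ?\<K> = "insert C (L ` \<A>)"
  have "countable ?\<K>" "?\<K> \<noteq> {}" using \<A>(1) by auto
  then obtain K where K: "range (K :: nat \<Rightarrow> 'a set) = ?\<K>"
    using range_from_nat_into by metis
  have "compact (K n)" for n
  proof -
    have "K n \<in> insert C (L ` \<A>)" using K by blast
    then show ?thesis using UL \<open>compact C\<close> by auto
  qed
  moreover have "(\<Union>n. K n) = UNIV"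
    unfolding K using UL by (auto simp: C_def)
  ultimately show ?thesis by blast
qed

section \<open>Point processes on \<open>\<sigma>\<close>-compact spaces\<close>

text \<open>Three things rest on the exhaustion by the \<open>K n\<close>: counts in all Borel sets,
  the total number of points included, become measurable although \<open>config_space\<close> is
  generated by relatively compact sets only; finite configurations turn out to be sums of atoms; and
  a Radon measure is sigma-finite, as product integrals require.\<close>

locale sigma_compact_space =
  fixes K :: "nat \<Rightarrow> 'a::metric_space set"
  assumes compact_K: "compact (K n)" and UN_K: "(\<Union>n. K n) = UNIV"
begin

lemma measurable_emeasure_config:
  fixes A :: "'a set"
  assumes A: "A \<in> sets borel"
  shows "(\<lambda>\<phi>. emeasure \<phi> A) \<in> borel_measurable config_space"
proof -
  define L where "L n = (\<Union>i\<le>n. K i)" for n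
  have L: "compact (L n)" for n
    unfolding L_def by (intro compact_UN compact_K) simp
  then have rc: "A \<inter> L n \<in> rc_borel" for n
    using A by (intro rc_borel_subset[OF rc_borel_compact[OF L[of n]]])
      (auto intro: borel_closed compact_imp_closed)
  have inc: "incseq (\<lambda>n. A \<inter> L n)"
    unfolding incseq_def L_def by fastforce
  have un: "(\<Union>n. A \<inter> L n) = A"
    using UN_K unfolding L_def by blast
  have "emeasure \<phi> A = (SUP n. emeasure \<phi> (A \<inter> L n))" if "\<phi> \<in> configs" for \<phi>
    using rc inc un by (subst SUP_emeasure_incseq) (auto simp: sets_config[OF that] rc_borel_def)
  then show ?thesis
    using measurable_emeasure_rc[OF rc]
    by (subst measurable_cong[where g="\<lambda>\<phi>. SUP n. emeasure \<phi> (A \<inter> L n)"]) auto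
qed

section \<open>Finite configurations as finite sums of atoms\<close>

lemma finite_config_measure: "\<phi> \<in> finite_configs \<Longrightarrow> finite_measure \<phi>"
  by (intro finite_measureI) (auto simp: finite_configs_def space_config)

lemma finite_config_fin: "\<phi> \<in> finite_configs \<Longrightarrow> emeasure \<phi> A \<noteq> \<infinity>"
  using finite_measure.emeasure_finite[OF finite_config_measure] by auto

text \<open>Each atom has mass at least 1, so there are finitely many. Around every point some ball
  has mass 0 off \<open>D\<close>: as the radius shrinks these masses tend to 0, and they are
  integers. Finitely many such balls cover each \<open>K n\<close>.\<close>

lemma finite_config_atoms:
  fixes \<phi> :: "'a measure"
  assumes \<phi>: "\<phi> \<in> finite_configs"
  defines "D \<equiv> {x. emeasure \<phi> {x} \<noteq> 0}"
  shows "finite D" "emeasure \<phi> (- D) = 0"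
proof -
  have c: "\<phi> \<in> configs" using \<phi> by (simp add: finite_configs_def)
  note [simp] = sets_config[OF c]
  have fin: "emeasure \<phi> A \<noteq> \<infinity>" for A by (rule finite_config_fin[OF \<phi>])
  have D1: "1 \<le> emeasure \<phi> {x}" if "x \<in> D" for x
    using that config_ge_1[OF c, of "{x}"] by (simp add: D_def)
  show finD: "finite D"
  proof (rule ccontr)
    assume "infinite D"
    obtain k where k: "emeasure \<phi> UNIV = of_nat k"
      using config_finite_nat[OF c fin, of UNIV] by blast
    obtain F where F: "F \<subseteq> D" "card F = Suc k" "finite F"
      using infinite_arbitrarily_large[OF \<open>infinite D\<close>] by metis
    have "of_nat (Suc k) = (\<Sum>x\<in>F. 1 :: ennreal)" using F by simp
    also have "\<dots> \<le> (\<Sum>x\<in>F. emeasure \<phi> {x})" using F D1 by (intro sum_mono) auto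
    also have "\<dots> = emeasure \<phi> F" using F by (intro emeasure_eq_sum_singleton[symmetric]) auto
    also have "\<dots> \<le> emeasure \<phi> UNIV" by (intro emeasure_mono) auto
    finally show False unfolding k of_nat_le_iff by simp
  qed
  have [measurable]: "D \<in> sets borel" by (intro borel_closed finite_imp_closed finD)
  have "\<exists>r>0. emeasure \<phi> (ball x r - D) = 0" for x
  proof -
    define B where "B k = ball x (1 / Suc k) - D" for k :: nat
    have Bs: "range B \<subseteq> sets \<phi>" unfolding B_def by auto
    have "decseq B"
      unfolding B_def decseq_def
      by (intro allI impI Diff_mono subset_ball order_refl divide_left_mono) auto
    have "(\<Inter>k. B k) = {x} - D"
    proof -
      have "y = x" if "y \<in> (\<Inter>k. B k)" for y
      proof (rule ccontr)
        assume "y \<noteq> x"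
        then obtain k where "1 / Suc k < dist x y"
          using reals_Archimedean[of "dist x y"] by (auto simp: inverse_eq_divide)
        moreover have "dist x y < 1 / Suc k" using that by (auto simp: B_def)
        ultimately show False by linarith
      qed
      then have "(\<Inter>k. B k) \<subseteq> {x}" by blast
      moreover have "(\<Inter>k. B k) \<subseteq> - D" "{x} - D \<subseteq> (\<Inter>k. B k)" unfolding B_def by auto
      ultimately show ?thesis by (intro equalityI) (simp_all add: subset_Diff_insert Diff_eq)
    qed
    moreover have "emeasure \<phi> ({x} - D) = 0"
    proof (cases "x \<in> D")
      case False
      then have "{x} - D = {x}" by auto
      then show ?thesis using False by (simp add: D_def)
    qed simp
    ultimately have "(\<lambda>k. emeasure \<phi> (B k)) \<longlonglongrightarrow> 0"
      using Lim_emeasure_decseq[OF Bs \<open>decseq B\<close>] fin by simp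
    then have "eventually (\<lambda>k. emeasure \<phi> (B k) < 1) sequentially"
      by (rule order_tendstoD) simp
    then obtain k where "emeasure \<phi> (B k) < 1"
      by (auto simp: eventually_sequentially)
    then have "emeasure \<phi> (B k) = 0" using config_ge_1[OF c, of "B k"] by (meson not_le)
    then show ?thesis by (intro exI[of _ "1 / Suc k"]) (auto simp: B_def)
  qed
  then obtain r where r: "\<And>x. r x > 0" "\<And>x. emeasure \<phi> (ball x (r x) - D) = 0" by metis
  have "emeasure \<phi> (K n - D) = 0" for n
  proof -
    obtain F where F: "F \<subseteq> K n" "finite F" "K n \<subseteq> (\<Union>x\<in>F. ball x (r x))"
      using compactE_image[OF compact_K[of n], of "K n" "\<lambda>x. ball x (r x)"] r(1) by force
    have "(\<Union>x\<in>F. ball x (r x) - D) \<in> null_sets \<phi>"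
      using F(2) r(2) by (intro null_sets_UN' null_setsI countable_finite) auto
    then have "emeasure \<phi> (\<Union>x\<in>F. ball x (r x) - D) = 0" by auto
    moreover have "(\<Union>x\<in>F. ball x (r x)) \<in> sets borel" by (intro borel_open open_UN) simp
    then have "emeasure \<phi> (K n - D) \<le> emeasure \<phi> (\<Union>x\<in>F. ball x (r x) - D)"
      using F by (intro emeasure_mono) auto
    ultimately show ?thesis by simp
  qed
  moreover have "K n - D \<in> sets borel" for n
    using borel_closed[OF compact_imp_closed[OF compact_K[of n]]] by simp
  ultimately have "(\<Union>n. K n - D) \<in> null_sets \<phi>"
    by (intro null_sets_UN null_setsI) auto
  moreover have "(\<Union>n. K n - D) = - D" using UN_K by blast
  ultimately show "emeasure \<phi> (- D) = 0" by auto
qed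

lemma finite_config_eq_sum:
  fixes \<phi> :: "'a measure"
  assumes \<phi>: "\<phi> \<in> finite_configs" and A: "A \<in> sets borel"
  shows "emeasure \<phi> A = (\<Sum>x\<in>{x. emeasure \<phi> {x} \<noteq> 0}. emeasure \<phi> {x} * indicator A x)"
proof -
  have c: "\<phi> \<in> configs" using \<phi> by (simp add: finite_configs_def)
  note [simp] = sets_config[OF c]
  define D where "D = {x. emeasure \<phi> {x} \<noteq> 0}"
  note D = finite_config_atoms[OF \<phi>, folded D_def]
  have [measurable]: "D \<in> sets borel" by (intro borel_closed finite_imp_closed D)
  have "- D \<in> null_sets \<phi>" using D(2) by (intro null_setsI) auto
  then have "emeasure \<phi> A = emeasure \<phi> (A - (- D))"
    using A by (intro emeasure_Diff_null_set[symmetric]) auto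
  also have "A - (- D) = A \<inter> D" by auto
  also have "emeasure \<phi> (A \<inter> D) = (\<Sum>x\<in>A \<inter> D. emeasure \<phi> {x})"
    using D(1) by (intro emeasure_eq_sum_singleton) auto
  also have "\<dots> = (\<Sum>x\<in>D. emeasure \<phi> {x} * indicator A x)"
    by (subst Int_commute, subst sum.inter_restrict[OF D(1)]) (rule sum.cong, auto simp: indicator_def)
  finally show ?thesis unfolding D_def .
qed

text \<open>One atom takes the whole mass, so its complement is null. This is used to read an event
  among one-point configurations as a Borel set of points.\<close>

lemma config_mass_1:
  fixes \<phi> :: "'a measure"
  assumes \<phi>: "\<phi> \<in> configs" "emeasure \<phi> UNIV = 1"
  shows "\<exists>x. \<phi> = return borel x"
proof -
  have fc: "\<phi> \<in> finite_configs" using \<phi> by (auto simp: finite_configs_def)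
  note eq = finite_config_eq_sum[OF fc] and D = finite_config_atoms[OF fc]
  have "\<exists>x. emeasure \<phi> {x} \<noteq> 0"
    using eq[of UNIV] \<phi> by (auto intro: ccontr)
  then obtain x where x: "emeasure \<phi> {x} \<noteq> 0" by blast
  have "emeasure \<phi> {x} \<le> 1"
    using emeasure_mono[of "{x}" UNIV \<phi>] \<phi> by (simp add: sets_config)
  with x config_ge_1[OF \<phi>(1), of "{x}"] have x1: "emeasure \<phi> {x} = 1" by simp
  have "emeasure \<phi> (UNIV - {x}) = 0"
    using emeasure_Diff[of \<phi> "{x}" UNIV] x1 \<phi> by (simp add: sets_config)
  then have "UNIV - {x} \<in> null_sets \<phi>"
    using \<phi> by (intro null_setsI) (auto simp: sets_config)
  then have "emeasure \<phi> (A - (UNIV - {x})) = emeasure \<phi> A" if "A \<in> sets borel" for A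
    using that \<phi> by (intro emeasure_Diff_null_set) (auto simp: sets_config)
  moreover have "A - (UNIV - {x}) = (if x \<in> A then {x} else {})" for A :: "'a set" by auto
  ultimately have "emeasure \<phi> A = indicator A x" if "A \<in> sets borel" for A
    using that x1 by (cases "x \<in> A") (fastforce simp del: Diff_Diff_Int)+
  then show ?thesis
    using \<phi> by (intro exI[of _ x] measure_eqI) (auto simp: sets_config)
qed

text \<open>If removing an atom leaves nothing, the total mass was 1. Points that are not atoms are
  discarded almost everywhere: there \<open>return borel x\<close> is not below
  \<open>\<phi>\<close> and \<open>remove_point\<close> is not a true difference.\<close>

lemma remove_point_bound:
  fixes \<phi> :: "'a measure"
  assumes \<phi>: "\<phi> \<in> finite_configs" and A: "A \<in> sets borel"
  shows "(\<integral>\<^sup>+x. (if emeasure (remove_point \<phi> x) UNIV = 0 then indicator A x else 0) \<partial>\<phi>)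
    \<le> (if emeasure \<phi> UNIV = 1 then emeasure \<phi> A else 0)"
proof -
  have c: "\<phi> \<in> configs" using \<phi> by (simp add: finite_configs_def)
  note [simp] = sets_config[OF c] space_config[OF c]
  define D where "D = {x. emeasure \<phi> {x} \<noteq> 0}"
  note D = finite_config_atoms[OF \<phi>, folded D_def]
  have [measurable]: "D \<in> sets borel" by (intro borel_closed finite_imp_closed D)
  have one: "emeasure \<phi> UNIV = 1" if x: "x \<in> D" "emeasure (remove_point \<phi> x) UNIV = 0" for x
  proof -
    have ge: "1 \<le> emeasure \<phi> B" if "x \<in> B" "B \<in> sets borel" for B
      using emeasure_mono[of "{x}" B \<phi>] config_ge_1[OF c, of "{x}"] x(1) that
      by (auto simp: D_def intro: order_trans)
    have "emeasure (remove_point \<phi> x) UNIV = emeasure \<phi> UNIV - emeasure (return borel x) UNIV"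
      unfolding remove_point_def
      by (rule emeasure_diff_measure)
        (use ge in \<open>auto simp: finite_config_measure[OF \<phi>] indicator_def
          intro!: prob_space.finite_measure prob_space_return\<close>)
    then have "emeasure \<phi> UNIV - 1 = 0" using x(2) by simp
    then have "emeasure \<phi> UNIV \<le> 1"
      using finite_config_fin[OF \<phi>] by (simp add: diff_eq_0_iff_ennreal)
    then show ?thesis using ge[of UNIV] by simp
  qed
  have AE: "AE x in \<phi>. x \<in> D"
    by (rule AE_I'[of "- D"]) (use D(2) in \<open>auto intro: null_setsI\<close>)
  have "(\<integral>\<^sup>+x. (if emeasure (remove_point \<phi> x) UNIV = 0 then indicator A x else 0) \<partial>\<phi>)
    \<le> (\<integral>\<^sup>+x. (if emeasure \<phi> UNIV = 1 then 1 else 0) * indicator A x \<partial>\<phi>)"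
    by (rule nn_integral_mono_AE, use AE in eventually_elim) (use one in auto)
  also have "\<dots> = (if emeasure \<phi> UNIV = 1 then emeasure \<phi> A else 0)"
    using A by auto
  finally show ?thesis .
qed

text \<open>The two test functions are linked by the integral of
  \<open>c (x, null_measure borel)\<close> over \<open>A\<close>. By weak repulsion it bounds the
  mean of the count in \<open>A\<close>, via \<open>u1\<close>. Multiplied by the probability of the
  empty configuration it equals the other side of the equation for \<open>u2\<close>, because
  \<open>u2\<close> evaluates \<open>c\<close> at the empty configuration only.\<close>

lemma weakly_repulsive_one_point:
  fixes P :: "'a measure measure" and A :: "'a set"
  assumes P: "prob_space P" "sets P = sets config_space" "finite_process P"
    and l: "sets l = sets borel" and wr: "weakly_repulsive l P" and A: "A \<in> sets borel"
  shows "emeasure P {\<phi> \<in> configs. emeasure \<phi> UNIV = 0} * (\<integral>\<^sup>+\<phi>. emeasure \<phi> A \<partial>P)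
    \<le> (\<integral>\<^sup>+\<phi>. (if emeasure \<phi> UNIV = 1 then emeasure \<phi> A else 0) \<partial>P)"
proof -
  interpret prob_space P by fact
  have spP: "space P = configs" using sets_eq_imp_space_eq[OF P(2)] by simp
  obtain c where c: "papangelou_intensity l P c"
    and c_le: "\<And>x \<phi>. \<phi> \<in> configs \<Longrightarrow> c (x, \<phi>) \<le> c (x, null_measure borel)"
    using wr unfolding weakly_repulsive_def by blast
  have cm: "c \<in> borel_measurable (borel \<Otimes>\<^sub>M config_space)"
    and gnz: "\<And>u. u \<in> borel_measurable (borel \<Otimes>\<^sub>M config_space) \<Longrightarrow> (\<And>x \<phi>. \<phi> \<in> configs \<Longrightarrow> 0 \<le> u (x, \<phi>)) \<Longrightarrow>
        (\<integral>\<^sup>+\<phi>. (\<integral>\<^sup>+x. ennreal (u (x, remove_point \<phi> x)) \<partial>\<phi>) \<partial>P) =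
        (\<integral>\<^sup>+x. (\<integral>\<^sup>+\<phi>. ennreal (c (x, \<phi>) * u (x, \<phi>)) \<partial>P) \<partial>l)"
    using c unfolding papangelou_intensity_def by blast+
  note [measurable] = measurable_emeasure_config A
  define Z where "Z = {\<phi> \<in> configs. emeasure \<phi> (UNIV :: 'a set) = 0}"
  have "{\<phi> \<in> space config_space. emeasure \<phi> (UNIV :: 'a set) = 0} \<in> sets config_space"
    by measurable
  then have Zs: "Z \<in> sets P" unfolding Z_def P(2) by simp
  have Z_eq: "\<phi> \<in> Z \<longleftrightarrow> \<phi> = null_measure borel" if "\<phi> \<in> configs" for \<phi>
    using config_mass_0[OF that] that by (auto simp: Z_def)
  let ?c = "\<lambda>x. ennreal (c (x, null_measure borel))"
  have "(\<lambda>x :: 'a. (x, null_measure borel)) \<in> measurable borel (borel \<Otimes>\<^sub>M config_space)"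
    by (intro measurable_Pair) auto
  from measurable_compose[OF this cm] have "(\<lambda>x. c (x, null_measure borel)) \<in> borel_measurable l"
    by (subst measurable_cong_sets[OF l refl])
  then have [measurable]: "?c \<in> borel_measurable l" by simp
  have Al[measurable]: "A \<in> sets l" using A l by simp
  define u1 :: "'a \<times> 'a measure \<Rightarrow> real" where "u1 z = indicator A (fst z)" for z
  \<comment> \<open>Emptiness is expressed by total mass 0, which is visibly an event of
    \<open>config_space\<close>; among configurations it means equality with
    \<open>null_measure borel\<close>.\<close>
  define u2 :: "'a \<times> 'a measure \<Rightarrow> real" where
    "u2 z = (if emeasure (snd z) UNIV = 0 then indicator A (fst z) else 0)" for z
  have "(\<integral>\<^sup>+\<phi>. emeasure \<phi> A \<partial>P) = (\<integral>\<^sup>+\<phi>. (\<integral>\<^sup>+x. ennreal (u1 (x, remove_point \<phi> x)) \<partial>\<phi>) \<partial>P)"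
    by (intro nn_integral_cong) (auto simp: u1_def spP sets_config A ennreal_indicator)
  also have "\<dots> = (\<integral>\<^sup>+x. (\<integral>\<^sup>+\<phi>. ennreal (c (x, \<phi>) * u1 (x, \<phi>)) \<partial>P) \<partial>l)"
    by (rule gnz) (auto simp: u1_def[abs_def])
  \<comment> \<open>Weak repulsion enters here and nowhere else.\<close>
  also have "\<dots> \<le> (\<integral>\<^sup>+x. (\<integral>\<^sup>+\<phi>. ?c x * indicator A x \<partial>P) \<partial>l)"
    by (intro nn_integral_mono) (auto simp: u1_def spP indicator_def intro!: ennreal_leI c_le)
  also have "\<dots> = (\<integral>\<^sup>+x. ?c x * indicator A x \<partial>l)"
    by (simp add: emeasure_space_1)
  finally have "emeasure P Z * (\<integral>\<^sup>+\<phi>. emeasure \<phi> A \<partial>P) \<le> emeasure P Z * (\<integral>\<^sup>+x. ?c x * indicator A x \<partial>l)"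
    by (rule mult_left_mono) simp
  also have "\<dots> = (\<integral>\<^sup>+x. emeasure P Z * (?c x * indicator A x) \<partial>l)"
    by (rule nn_integral_cmult[symmetric]) measurable
  also have "\<dots> = (\<integral>\<^sup>+x. (\<integral>\<^sup>+\<phi>. ?c x * indicator A x * indicator Z \<phi> \<partial>P) \<partial>l)"
    by (intro nn_integral_cong, subst nn_integral_cmult_indicator[OF Zs]) (simp add: mult.commute)
  also have "\<dots> = (\<integral>\<^sup>+x. (\<integral>\<^sup>+\<phi>. ennreal (c (x, \<phi>) * u2 (x, \<phi>)) \<partial>P) \<partial>l)"
  proof (intro nn_integral_cong)
    fix x and \<phi> assume "\<phi> \<in> space P"
    then show "?c x * indicator A x * indicator Z \<phi> = ennreal (c (x, \<phi>) * u2 (x, \<phi>))"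
      using Z_eq[of \<phi>] by (cases "\<phi> \<in> Z") (auto simp: spP u2_def Z_def indicator_def)
  qed
  also have "\<dots> = (\<integral>\<^sup>+\<phi>. (\<integral>\<^sup>+x. ennreal (u2 (x, remove_point \<phi> x)) \<partial>\<phi>) \<partial>P)"
    by (rule gnz[symmetric]) (auto simp: u2_def[abs_def])
  also have "\<dots> \<le> (\<integral>\<^sup>+\<phi>. (if emeasure \<phi> UNIV = 1 then emeasure \<phi> A else 0) \<partial>P)"
  proof (rule nn_integral_mono_AE)
    have "AE \<phi> in P. \<phi> \<in> finite_configs" using P(3) by (simp add: finite_process_def)
    then show "AE \<phi> in P. (\<integral>\<^sup>+x. ennreal (u2 (x, remove_point \<phi> x)) \<partial>\<phi>)
        \<le> (if emeasure \<phi> UNIV = 1 then emeasure \<phi> A else 0)"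
    proof eventually_elim
      case (elim \<phi>)
      have "(\<integral>\<^sup>+x. ennreal (u2 (x, remove_point \<phi> x)) \<partial>\<phi>)
        = (\<integral>\<^sup>+x. (if emeasure (remove_point \<phi> x) UNIV = 0 then indicator A x else 0) \<partial>\<phi>)"
        by (intro nn_integral_cong) (auto simp: u2_def ennreal_indicator)
      also note remove_point_bound[OF elim A]
      finally show ?case .
    qed
  qed
  finally show ?thesis by (simp add: Z_def)
qed

text \<open>The test function keeps exactly the parts that consist of one labelled point lying in
  \<open>A\<close>. A point of multiplicity \<open>k x\<close> carries \<open>k x\<close> labels, so
  these singletons reproduce the measure.\<close>

lemma sum_finite_parts_single:
  fixes \<phi> :: "'a measure"
  assumes \<phi>: "\<phi> \<in> finite_configs" and A: "A \<in> sets borel"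
  shows "sum_finite_parts (\<lambda>\<alpha>. if emeasure \<alpha> UNIV = 1 \<and> emeasure \<alpha> A = 1 then 1 else 0) \<phi> = emeasure \<phi> A"
proof -
  have c: "\<phi> \<in> configs" using \<phi> by (simp add: finite_configs_def)
  define D where "D = {x. emeasure \<phi> {x} \<noteq> 0}"
  note D = finite_config_atoms[OF \<phi>, folded D_def]
  define k where "k x = (SOME j. emeasure \<phi> {x} = of_nat j)" for x
  have k: "emeasure \<phi> {x} = of_nat (k x)" for x
    unfolding k_def by (rule someI_ex[OF config_finite_nat[OF c finite_config_fin[OF \<phi>]]])
  define LP where "LP = labelled_points \<phi>"
  have LP: "LP = Sigma D (\<lambda>x. {..<k x})"
    unfolding LP_def labelled_points_def D_def k by auto
  then have fLP: "finite LP" using D by auto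
  let ?u = "\<lambda>\<alpha> :: 'a measure. if emeasure \<alpha> UNIV = 1 \<and> emeasure \<alpha> A = 1 then 1 else (0 :: real)"
  let ?s = "\<lambda>S :: ('a \<times> nat) set. superpose S (\<lambda>p. return borel (fst p))"
  have s1: "emeasure (?s S) UNIV = of_nat (card S)" for S
    by (subst emeasure_superpose) auto
  have sA: "emeasure (?s S) A = (\<Sum>p\<in>S. indicator A (fst p))" for S
    using A by (subst emeasure_superpose) auto
  have "{S. finite S \<and> S \<subseteq> labelled_points \<phi>} = Pow LP"
    using fLP by (auto simp: LP_def intro: finite_subset)
  then have "sum_finite_parts ?u \<phi> = (\<integral>\<^sup>+S. ennreal (?u (?s S)) \<partial>count_space (Pow LP))"
    unfolding sum_finite_parts_def by simp
  also have "\<dots> = (\<Sum>S\<in>Pow LP. ennreal (?u (?s S)))"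
    using fLP by (intro nn_integral_count_space_finite) auto
  also have "\<dots> = (\<Sum>S\<in>(\<lambda>p. {p}) ` LP. ennreal (?u (?s S)))"
  proof (rule sum.mono_neutral_right)
    show "\<forall>S\<in>Pow LP - (\<lambda>p. {p}) ` LP. ennreal (?u (?s S)) = 0"
    proof
      fix S assume S: "S \<in> Pow LP - (\<lambda>p. {p}) ` LP"
      then have "card S \<noteq> 1" by (auto simp: card_1_singleton_iff)
      then have "emeasure (?s S) UNIV \<noteq> 1" unfolding s1 by simp
      then show "ennreal (?u (?s S)) = 0" by simp
    qed
  qed (use fLP in auto)
  also have "\<dots> = (\<Sum>p\<in>LP. indicator A (fst p))"
  proof -
    have "ennreal (?u (?s {p})) = indicator A (fst p)" for p :: "'a \<times> nat"
      using s1[of "{p}"] sA[of "{p}"] by (cases "fst p \<in> A") auto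
    then show ?thesis by (subst sum.reindex) auto
  qed
  also have "\<dots> = (\<Sum>x\<in>D. \<Sum>j<k x. indicator A x)"
    unfolding LP using D by (subst sum.Sigma) (auto simp: split_beta)
  also have "\<dots> = (\<Sum>x\<in>D. emeasure \<phi> {x} * indicator A x)"
    by (simp add: k)
  also have "\<dots> = emeasure \<phi> A"
    unfolding D_def by (rule finite_config_eq_sum[OF \<phi> A, symmetric])
  finally show ?thesis .
qed

text \<open>The test function of the previous lemma vanishes on the configuration of a
  \<open>k\<close>-tuple unless \<open>k = 1\<close>, since that configuration has total mass
  \<open>k\<close>. One term of the series survives.\<close>

lemma correlation_function_intensity:
  fixes P :: "'a measure measure" and A :: "'a set"
  assumes fin: "finite_process P"
    and l: "radon_measure l" and cf: "correlation_function l P \<rho>" and A: "A \<in> sets borel"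
  shows "(\<lambda>x. \<rho> (return borel x)) \<in> borel_measurable borel"
    and "0 \<le> \<rho> (return borel x)"
    and "(\<integral>\<^sup>+\<phi>. emeasure \<phi> A \<partial>P) = (\<integral>\<^sup>+x. ennreal (\<rho> (return borel x)) * indicator A x \<partial>l)"
proof -
  have sl: "sets l = sets borel" using l by (simp add: radon_measure_def)
  have spl: "space l = UNIV" using sets_eq_imp_space_eq[OF sl] by simp
  have ret: "return borel x \<in> finite_configs" for x :: 'a
    by (auto simp: finite_configs_def)
  have \<rho>m: "\<rho> \<in> borel_measurable (restrict_space config_space finite_configs)"
    and \<rho>0: "\<And>\<alpha>. \<alpha> \<in> finite_configs \<Longrightarrow> 0 \<le> \<rho> \<alpha>"
    using cf by (auto simp: correlation_function_def)
  have "(return borel :: 'a \<Rightarrow> _) \<in> measurable borel (restrict_space config_space finite_configs)"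
    using ret by (intro measurable_restrict_space2 measurable_return_config) auto
  from measurable_compose[OF this \<rho>m]
  show m: "(\<lambda>x. \<rho> (return borel x)) \<in> borel_measurable borel" .
  show "0 \<le> \<rho> (return borel x)" using \<rho>0 ret by blast
  define u where "u \<alpha> = (if emeasure \<alpha> UNIV = 1 \<and> emeasure \<alpha> A = 1 then 1 else (0 :: real))"
    for \<alpha> :: "'a measure"
  note [measurable] = measurable_emeasure_config A
  have um: "u \<in> borel_measurable config_space" unfolding u_def[abs_def] by measurable
  have "sigma_finite_measure l"
  proof
    show "\<exists>B. countable B \<and> B \<subseteq> sets l \<and> \<Union> B = space l \<and> (\<forall>a\<in>B. emeasure l a \<noteq> \<infinity>)"
    proof (intro exI conjI ballI)
      fix a assume "a \<in> range K"
      then have "compact a" using compact_K by auto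
      then show "emeasure l a \<noteq> \<infinity>" using l by (auto simp: radon_measure_def)
    qed (use compact_K UN_K in \<open>auto simp: spl sl intro: borel_closed compact_imp_closed\<close>)
  qed
  then interpret product_sigma_finite "\<lambda>_::nat. l" by (rule product_sigma_finite.intro)
  let ?f = "\<lambda>k. ennreal (1 / fact k) * (\<integral>\<^sup>+x. ennreal (u (config_of_tuple k x) * \<rho> (config_of_tuple k x))
              \<partial>(\<Pi>\<^sub>M i\<in>{..<k}. l))"
  have "(\<integral>\<^sup>+\<phi>. emeasure \<phi> A \<partial>P) = (\<integral>\<^sup>+\<phi>. sum_finite_parts u \<phi> \<partial>P)"
  proof (rule nn_integral_cong_AE)
    have "AE \<phi> in P. \<phi> \<in> finite_configs" using fin by (simp add: finite_process_def)
    then show "AE \<phi> in P. emeasure \<phi> A = sum_finite_parts u \<phi>"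
      by eventually_elim (simp add: u_def[abs_def] sum_finite_parts_single A)
  qed
  also have "\<dots> = (\<Sum>k. ?f k)"
    using cf measurable_restrict_space1[OF um, of finite_configs]
    unfolding correlation_function_def by (auto simp: u_def)
  also have "\<dots> = (\<Sum>k\<in>{1}. ?f k)"
  proof (rule suminf_finite)
    fix k :: nat assume "k \<notin> {1}"
    then have "u (config_of_tuple k x) = 0" for x
      by (simp add: u_def emeasure_config_of_tuple)
    then show "?f k = 0" by simp
  qed simp
  also have "\<dots> = (\<integral>\<^sup>+x. ennreal (\<rho> (return borel (x 0))) * indicator A (x 0) \<partial>(\<Pi>\<^sub>M i\<in>{0::nat}. l))"
  proof -
    have 1: "config_of_tuple 1 x = return borel (x 0)" for x :: "nat \<Rightarrow> 'a"
      by (rule measure_eqI) (auto simp: config_of_tuple_def emeasure_superpose)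
    have "{..<1} = {0::nat}" by auto
    then have "(\<Sum>k\<in>{1}. ?f k) = (\<integral>\<^sup>+x. ennreal (u (config_of_tuple 1 x) * \<rho> (config_of_tuple 1 x))
              \<partial>(\<Pi>\<^sub>M i\<in>{0::nat}. l))" by simp
    also have "\<dots> = (\<integral>\<^sup>+x. ennreal (\<rho> (return borel (x 0))) * indicator A (x 0) \<partial>(\<Pi>\<^sub>M i\<in>{0::nat}. l))"
      unfolding 1 by (intro nn_integral_cong) (use A in \<open>auto simp: u_def indicator_def\<close>)
    finally show ?thesis .
  qed
  also have "\<dots> = (\<integral>\<^sup>+x. ennreal (\<rho> (return borel x)) * indicator A x \<partial>l)"
    by (rule product_nn_integral_singleton[of "\<lambda>x. ennreal (\<rho> (return borel x)) * indicator A x"])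
       (use m A in \<open>subst measurable_cong_sets[OF sl refl], simp\<close>)
  finally show "(\<integral>\<^sup>+\<phi>. emeasure \<phi> A \<partial>P) = (\<integral>\<^sup>+x. ennreal (\<rho> (return borel x)) * indicator A x \<partial>l)" .
qed

end

section \<open>Laws of point processes and their generating functions\<close>

text \<open>Counts as natural numbers, to serve as exponents. On a set of infinite mass the value is
  0, because \<open>measure\<close> is 0 there.\<close>

definition count_in :: "'a::metric_space measure \<Rightarrow> 'a set \<Rightarrow> nat" where
  "count_in \<phi> A = nat \<lfloor>measure \<phi> A\<rfloor>"

definition gen_prod :: "('a::metric_space set \<Rightarrow> real) \<Rightarrow> 'a set set \<Rightarrow> 'a measure \<Rightarrow> real" where
  "gen_prod s \<B> \<phi> = (\<Prod>B\<in>\<B>. s B ^ count_in \<phi> B)"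

text \<open>The probability generating functional of a Poisson process, evaluated at the function
  that equals \<open>s B\<close> on each \<open>B\<close> and 1 elsewhere. Marginal laws and
  independence are condensed into a single identity, which passes to independent superpositions by
  multiplication.\<close>

definition poisson_gf :: "'a::metric_space measure \<Rightarrow> 'a measure measure \<Rightarrow> bool" where
  "poisson_gf \<mu> Q \<longleftrightarrow> (\<forall>\<B> s. finite \<B> \<longrightarrow> \<B> \<subseteq> rc_borel \<longrightarrow> disjoint \<B> \<longrightarrow> (\<forall>B. s B \<in> {0..1}) \<longrightarrow>
     (\<integral>\<^sup>+\<phi>. ennreal (gen_prod s \<B> \<phi>) \<partial>Q) = ennreal (exp (- (\<Sum>B\<in>\<B>. (1 - s B) * measure \<mu> B))))"

lemma count_in_eq: "emeasure \<phi> A = of_nat k \<Longrightarrow> count_in \<phi> A = k"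
  by (simp add: count_in_def measure_def)

lemma emeasure_eq_count_in:
  assumes "\<phi> \<in> configs" "emeasure \<phi> A \<noteq> \<infinity>"
  shows "emeasure \<phi> A = of_nat (count_in \<phi> A)"
  using config_finite_nat[OF assms] count_in_eq by metis

lemma emeasure_eq_count_in_rc:
  assumes "\<phi> \<in> configs" "A \<in> rc_borel"
  shows "emeasure \<phi> A = of_nat (count_in \<phi> A)"
  using assms by (intro emeasure_eq_count_in) (auto simp: configs_def)

lemma measurable_count_in [measurable]:
  assumes "A \<in> rc_borel"
  shows "(\<lambda>\<phi>. count_in \<phi> A) \<in> measurable config_space (count_space UNIV)"
  using measurable_emeasure_rc[OF assms] unfolding count_in_def measure_def by measurable

lemma count_in_superpose:
  assumes "finite I" "\<And>i. i \<in> I \<Longrightarrow> \<phi> i \<in> configs" "A \<in> rc_borel"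
  shows "count_in (superpose I \<phi>) A = (\<Sum>i\<in>I. count_in (\<phi> i) A)"
  by (rule count_in_eq, subst emeasure_superpose)
    (use assms in \<open>auto simp: sets_config emeasure_eq_count_in_rc\<close>)

lemma count_in_UN_disjoint:
  assumes "\<phi> \<in> configs" "finite \<B>" "\<B> \<subseteq> rc_borel" "disjoint \<B>"
  shows "count_in \<phi> (\<Union>\<B>) = (\<Sum>B\<in>\<B>. count_in \<phi> B)"
proof (rule count_in_eq)
  have "emeasure \<phi> (\<Union>\<B>) = (\<Sum>B\<in>\<B>. emeasure \<phi> B)"
  proof -
    have "\<B> \<subseteq> sets borel" using assms(3) by (auto simp: rc_borel_def)
    then have "(\<Sum>B\<in>\<B>. emeasure \<phi> (id B)) = emeasure \<phi> (\<Union>B\<in>\<B>. id B)"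
      using assms by (intro sum_emeasure) (auto simp: disjoint_def disjoint_family_on_def sets_config)
    then show ?thesis by simp
  qed
  also have "\<dots> = of_nat (\<Sum>B\<in>\<B>. count_in \<phi> B)"
    using assms by (auto simp: emeasure_eq_count_in_rc subset_iff)
  finally show "emeasure \<phi> (\<Union>\<B>) = of_nat (\<Sum>B\<in>\<B>. count_in \<phi> B)" .
qed

lemma gen_prod_bounds:
  assumes "\<And>B. s B \<in> {0..1}"
  shows "0 \<le> gen_prod s \<B> \<phi>" "gen_prod s \<B> \<phi> \<le> 1"
  using assms by (auto simp: gen_prod_def intro!: prod_nonneg prod_le_1 power_le_one)

lemma measurable_gen_prod [measurable]:
  assumes "\<B> \<subseteq> rc_borel"
  shows "gen_prod s \<B> \<in> borel_measurable config_space"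
  unfolding gen_prod_def[abs_def]
proof (rule borel_measurable_prod)
  fix B assume "B \<in> \<B>"
  then have [measurable]: "(\<lambda>\<phi>. count_in \<phi> B) \<in> measurable config_space (count_space UNIV)"
    using assms by (intro measurable_count_in) auto
  show "(\<lambda>\<phi>. s B ^ count_in \<phi> B) \<in> borel_measurable config_space" by measurable
qed

lemma gen_prod_superpose:
  assumes "finite I" "\<And>i. i \<in> I \<Longrightarrow> \<phi> i \<in> configs" "\<B> \<subseteq> rc_borel"
  shows "gen_prod s \<B> (superpose I \<phi>) = (\<Prod>i\<in>I. gen_prod s \<B> (\<phi> i))"
proof -
  have "gen_prod s \<B> (superpose I \<phi>) = (\<Prod>B\<in>\<B>. \<Prod>i\<in>I. s B ^ count_in (\<phi> i) B)"
    unfolding gen_prod_def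
    by (rule prod.cong) (use assms in \<open>auto simp: count_in_superpose subset_iff power_sum\<close>)
  also have "\<dots> = (\<Prod>i\<in>I. \<Prod>B\<in>\<B>. s B ^ count_in (\<phi> i) B)"
    by (rule prod.swap)
  finally show ?thesis unfolding gen_prod_def .
qed

text \<open>The atoms are the classes of points that belong to the same members of
  \<open>\<F>\<close>. Only classes of points of the union are taken: each of them lies in a member
  and is therefore relatively compact, while the class of the outside points need not be.\<close>

lemma atoms_of_finite_family:
  assumes "finite \<F>" "\<F> \<subseteq> rc_borel"
  obtains \<B> where "finite \<B>" "\<B> \<subseteq> rc_borel" "disjoint \<B>" "\<And>A. A \<in> \<F> \<Longrightarrow> A = \<Union>{B\<in>\<B>. B \<subseteq> A}"
proof
  define b where "b x = {y. \<forall>A\<in>\<F>. y \<in> A \<longleftrightarrow> x \<in> A}" for x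
  \<comment> \<open>Used only to bound the number of classes: a class is determined by the members
    of \<open>\<F>\<close> that contain it.\<close>
  define b' where "b' \<G> = {y. \<forall>A\<in>\<F>. y \<in> A \<longleftrightarrow> A \<in> \<G>}" for \<G>
  have "b ` \<Union>\<F> \<subseteq> b' ` Pow \<F>"
  proof
    fix B assume "B \<in> b ` \<Union>\<F>"
    then obtain x where "B = b x" by blast
    then have "B = b' {A\<in>\<F>. x \<in> A}" by (auto simp: b_def b'_def)
    then show "B \<in> b' ` Pow \<F>" by blast
  qed
  then show "finite (b ` \<Union>\<F>)" using assms(1) by (meson finite_Pow_iff finite_imageI finite_subset)
  show "disjoint (b ` \<Union>\<F>)" by (auto simp: disjoint_def b_def)
  show "b ` \<Union>\<F> \<subseteq> rc_borel"
  proof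
    fix B assume "B \<in> b ` \<Union>\<F>"
    then obtain x A where x: "x \<in> A" "A \<in> \<F>" "B = b x" by blast
    have "b x = (\<Inter>A\<in>\<F>. if x \<in> A then A else - A)" by (auto simp: b_def)
    also have "\<dots> \<in> sets borel"
      using assms x by (intro sets.finite_INT) (auto simp: rc_borel_def intro: borel_comp)
    finally have "B \<in> sets borel" using x by simp
    moreover have "A \<in> rc_borel" "B \<subseteq> A" using x assms(2) by (auto simp: b_def)
    ultimately show "B \<in> rc_borel" by (intro rc_borel_subset[of A B])
  qed
  fix A assume A: "A \<in> \<F>"
  then have "x \<in> b x" "x \<in> A \<Longrightarrow> b x \<subseteq> A" for x by (auto simp: b_def)
  then show "A = \<Union>{B \<in> b ` \<Union>\<F>. B \<subseteq> A}" using A by blast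
qed

text \<open>A generating function over overlapping sets is one over the atoms they generate, the
  argument at an atom being the product of the arguments of the sets containing it.\<close>

lemma overlapping_gf_eq:
  fixes P Q :: "'a::metric_space measure measure" and A :: "'i \<Rightarrow> 'a set"
  assumes P: "sets P = sets config_space" "poisson_gf \<mu> P"
    and Q: "sets Q = sets config_space" "poisson_gf \<mu> Q"
    and J: "finite J" "\<And>j. j \<in> J \<Longrightarrow> A j \<in> rc_borel" and s: "\<And>j. s j \<in> {0..1}"
  shows "(\<integral>\<^sup>+\<phi>. ennreal (\<Prod>j\<in>J. s j ^ count_in \<phi> (A j)) \<partial>P)
    = (\<integral>\<^sup>+\<phi>. ennreal (\<Prod>j\<in>J. s j ^ count_in \<phi> (A j)) \<partial>Q)"
proof -
  have spP: "space P = configs" and spQ: "space Q = configs"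
    using sets_eq_imp_space_eq[OF P(1)] sets_eq_imp_space_eq[OF Q(1)] by auto
  have "finite (A ` J)" "A ` J \<subseteq> rc_borel" using J by auto
  then obtain \<B> where \<B>: "finite \<B>" "\<B> \<subseteq> rc_borel" "disjoint \<B>"
      "\<And>B. B \<in> A ` J \<Longrightarrow> B = \<Union>{b\<in>\<B>. b \<subseteq> B}"
    by (rule atoms_of_finite_family) blast
  define s' where "s' b = (\<Prod>j\<in>{j\<in>J. b \<subseteq> A j}. s j)" for b
  have s': "s' b \<in> {0..1}" for b
    using s by (auto simp: s'_def intro!: prod_nonneg prod_le_1)
  have "(\<Prod>j\<in>J. s j ^ count_in \<phi> (A j)) = gen_prod s' \<B> \<phi>" if \<phi>: "\<phi> \<in> configs" for \<phi>
  proof -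
    have "count_in \<phi> (A j) = (\<Sum>b\<in>{b\<in>\<B>. b \<subseteq> A j}. count_in \<phi> b)" if "j \<in> J" for j
    proof -
      have "count_in \<phi> (\<Union>{b\<in>\<B>. b \<subseteq> A j}) = (\<Sum>b\<in>{b\<in>\<B>. b \<subseteq> A j}. count_in \<phi> b)"
        using \<B> by (intro count_in_UN_disjoint[OF \<phi>]) (auto simp: disjoint_def)
      then show ?thesis using \<B>(4)[of "A j"] that by simp
    qed
    then have "(\<Prod>j\<in>J. s j ^ count_in \<phi> (A j)) = (\<Prod>j\<in>J. \<Prod>b\<in>{b\<in>\<B>. b \<subseteq> A j}. s j ^ count_in \<phi> b)"
      by (intro prod.cong) (auto simp: power_sum)
    also have "\<dots> = (\<Prod>j\<in>J. \<Prod>b\<in>\<B>. if b \<subseteq> A j then s j ^ count_in \<phi> b else 1)"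
      using \<B>(1) by (simp add: prod.inter_filter)
    also have "\<dots> = (\<Prod>b\<in>\<B>. \<Prod>j\<in>J. if b \<subseteq> A j then s j ^ count_in \<phi> b else 1)"
      by (rule prod.swap)
    also have "\<dots> = (\<Prod>b\<in>\<B>. \<Prod>j\<in>{j\<in>J. b \<subseteq> A j}. s j ^ count_in \<phi> b)"
      using J(1) by (simp add: prod.inter_filter)
    also have "\<dots> = gen_prod s' \<B> \<phi>"
      by (simp add: gen_prod_def s'_def prod_power_distrib)
    finally show ?thesis .
  qed
  then have "(\<integral>\<^sup>+\<phi>. ennreal (\<Prod>j\<in>J. s j ^ count_in \<phi> (A j)) \<partial>P) = (\<integral>\<^sup>+\<phi>. ennreal (gen_prod s' \<B> \<phi>) \<partial>P)"
    "(\<integral>\<^sup>+\<phi>. ennreal (\<Prod>j\<in>J. s j ^ count_in \<phi> (A j)) \<partial>Q) = (\<integral>\<^sup>+\<phi>. ennreal (gen_prod s' \<B> \<phi>) \<partial>Q)"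
    by (auto intro!: nn_integral_cong simp: spP spQ)
  moreover have "(\<integral>\<^sup>+\<phi>. ennreal (gen_prod s' \<B> \<phi>) \<partial>R)
      = ennreal (exp (- (\<Sum>B\<in>\<B>. (1 - s' B) * measure \<mu> B)))" if "poisson_gf \<mu> R" for R
    by (rule that[unfolded poisson_gf_def, rule_format]) (use \<B>(1-3) s' in auto)
  ultimately show ?thesis using P(2) Q(2) by simp
qed

text \<open>By induction the difference of the two series starts at index \<open>n\<close>. Divided
  by \<open>s ^ n\<close> it vanishes on the open unit interval and tends to \<open>d n\<close> at
  0. The sums are compared for positive \<open>s\<close> only, hence the limit from the
  right.\<close>

lemma power_series_coeff_unique:
  fixes p q :: "nat \<Rightarrow> real"
  assumes "summable p" "summable q"
    and eq: "\<And>s. 0 < s \<Longrightarrow> s < 1 \<Longrightarrow> (\<Sum>k. p k * s ^ k) = (\<Sum>k. q k * s ^ k)"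
  shows "p n = q n"
proof (induction n rule: less_induct)
  case (less n)
  define d where "d k = p k - q k" for k
  have d0: "d k = 0" if "k < n" for k using less[OF that] by (simp add: d_def)
  have "summable d"
    unfolding d_def[abs_def] by (rule summable_diff[OF assms(1,2)])
  have sd: "summable (\<lambda>k. d k * x ^ k)" if "norm x < 1" for x :: real
    using powser_inside[of d 1 x] \<open>summable d\<close> that by simp
  have sdn: "summable (\<lambda>k. d (k + n) * x ^ k)" if "norm x < 1" for x :: real
    using powser_inside[of "\<lambda>k. d (k + n)" 1 x] summable_ignore_initial_segment[OF \<open>summable d\<close>, of n] that
    by simp
  define f where "f x = (\<Sum>k. d (k + n) * x ^ k)" for x :: real
  have "f \<midarrow>0\<rightarrow> d (0 + n)"
    by (rule powser_limit_0[of 1 "\<lambda>k. d (k + n)"]) (use sdn in \<open>auto simp: f_def\<close>)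
  then have lim: "(f \<longlongrightarrow> d n) (at_right 0)"
    using filterlim_at_split by auto
  have f0: "f s = 0" if "0 < s" "s < 1" for s
  proof -
    have sm: "summable (\<lambda>k. r k * s ^ k)" if "summable r" for r :: "nat \<Rightarrow> real"
      using powser_inside[of r 1 s] that \<open>0 < s\<close> \<open>s < 1\<close> by simp
    have "(\<Sum>k. d k * s ^ k) = 0"
      using eq[OF that] suminf_diff[OF sm[OF assms(1)] sm[OF assms(2)]]
      by (simp add: d_def left_diff_distrib)
    moreover have "(\<Sum>k. d k * s ^ k) = (\<Sum>k. d (k + n) * s ^ (k + n)) + (\<Sum>k<n. d k * s ^ k)"
      using that by (intro suminf_split_initial_segment sd) auto
    moreover have "(\<Sum>k. d (k + n) * s ^ (k + n)) = s ^ n * f s"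
      unfolding f_def using that
      by (subst suminf_mult[symmetric]) (use sdn[of s] that in \<open>auto simp: power_add mult_ac\<close>)
    moreover have "(\<Sum>k<n. d k * s ^ k) = 0" using d0 by (intro sum.neutral) auto
    ultimately show ?thesis using that(1) by simp
  qed
  have "eventually (\<lambda>s. f s = 0) (at_right 0)"
    by (subst eventually_at_right[of 0 1]) (auto intro!: exI[of _ 1] f0)
  then have "(f \<longlongrightarrow> 0) (at_right 0)" by (rule tendsto_eventually)
  then have "d n = 0" using tendsto_unique[OF _ lim] by auto
  then show ?case by (simp add: d_def)
qed

text \<open>In \<open>s\<close>, the hypothesis equates two power series whose coefficients are the
  integrals in the conclusion. The weight \<open>W\<close> carries the factors that belong to other
  counts, so that counts can be treated one at a time.\<close>

lemma gf_coefficient_eq: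
  fixes N :: "'b \<Rightarrow> nat" and W :: "'b \<Rightarrow> real"
  assumes P: "prob_space P" and Q: "prob_space Q" and PQ: "sets P = sets Q"
    and N: "N \<in> measurable P (count_space UNIV)" and W: "W \<in> borel_measurable P" "\<And>x. W x \<in> {0..1}"
    and eq: "\<And>s. s \<in> {0..1} \<Longrightarrow>
      (\<integral>\<^sup>+x. ennreal (W x * s ^ N x) \<partial>P) = (\<integral>\<^sup>+x. ennreal (W x * s ^ N x) \<partial>Q)"
  shows "(\<integral>\<^sup>+x. ennreal (W x * of_bool (N x = k)) \<partial>P) = (\<integral>\<^sup>+x. ennreal (W x * of_bool (N x = k)) \<partial>Q)"
proof -
  define I where "I R k = (\<integral>\<^sup>+x. ennreal (W x * of_bool (N x = k)) \<partial>R)" for R k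
  have *: "\<exists>p. (\<forall>k. I R k = ennreal (p k)) \<and> (\<forall>k. 0 \<le> p k) \<and> summable p \<and>
      (\<forall>s\<in>{0..1}. (\<integral>\<^sup>+x. ennreal (W x * s ^ N x) \<partial>R) = ennreal (\<Sum>k. p k * s ^ k))"
    if R: "prob_space R" "sets R = sets P" for R
  proof -
    interpret prob_space R by fact
    have [measurable]: "N \<in> measurable R (count_space UNIV)" "W \<in> borel_measurable R"
      using N W measurable_cong_sets[OF R(2) refl] by auto
    have le1: "ennreal (W x) \<le> 1" for x using W(2)[of x] by simp
    have ser: "(\<integral>\<^sup>+x. ennreal (W x * s ^ N x) \<partial>R) = (\<Sum>k. I R k * ennreal (s ^ k))" if "s \<in> {0..1}" for s
    proof -
      have "ennreal (W x * s ^ N x) = (\<Sum>k. ennreal (W x * of_bool (N x = k)) * ennreal (s ^ k))" for x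
      proof -
        have "(\<Sum>k. ennreal (W x * of_bool (N x = k)) * ennreal (s ^ k))
          = (\<Sum>k\<in>{N x}. ennreal (W x * of_bool (N x = k)) * ennreal (s ^ k))"
          by (rule suminf_finite) auto
        then show ?thesis using that W(2)[of x] by (simp add: ennreal_mult)
      qed
      then have "(\<integral>\<^sup>+x. ennreal (W x * s ^ N x) \<partial>R)
        = (\<integral>\<^sup>+x. (\<Sum>k. ennreal (W x * of_bool (N x = k)) * ennreal (s ^ k)) \<partial>R)" by simp
      also have "\<dots> = (\<Sum>k. \<integral>\<^sup>+x. ennreal (W x * of_bool (N x = k)) * ennreal (s ^ k) \<partial>R)"
        by (rule nn_integral_suminf) measurable
      also have "\<dots> = (\<Sum>k. I R k * ennreal (s ^ k))"
        unfolding I_def by (intro suminf_cong nn_integral_multc) measurable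
      finally show ?thesis .
    qed
    \<comment> \<open>At \<open>s = 1\<close> the series is the integral of \<open>W\<close>; this
      bound makes all coefficients finite and summable.\<close>
    have "(\<Sum>k. I R k) \<le> 1"
    proof -
      have "(\<Sum>k. I R k) = (\<integral>\<^sup>+x. ennreal (W x) \<partial>R)" using ser[of 1] by simp
      also have "\<dots> \<le> (\<integral>\<^sup>+x. 1 \<partial>R)" by (intro nn_integral_mono le1)
      finally show ?thesis by (simp add: emeasure_space_1)
    qed
    then have fin: "(\<Sum>k. I R k) \<noteq> top" by (metis ennreal_one_less_top leD)
    then have I1: "I R k \<noteq> top" for k
      using sum_le_suminf[of "I R" "{k}"] by (auto simp: top_unique)
    define p where "p k = enn2real (I R k)" for k
    have p: "I R k = ennreal (p k)" "0 \<le> p k" for k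
      using I1[of k] by (auto simp: p_def less_top)
    have sp: "summable p"
      using fin p by (intro summable_suminf_not_top) auto
    have "(\<integral>\<^sup>+x. ennreal (W x * s ^ N x) \<partial>R) = ennreal (\<Sum>k. p k * s ^ k)" if "s \<in> {0..1}" for s
    proof -
      have "summable (\<lambda>k. p k * s ^ k)"
        using that p(2)
        by (intro summable_comparison_test'[OF sp]) (auto intro!: mult_left_le power_le_one simp: abs_mult)
      then have "(\<Sum>k. ennreal (p k * s ^ k)) = ennreal (\<Sum>k. p k * s ^ k)"
        using that p(2) by (intro suminf_ennreal2) auto
      then show ?thesis using that p by (simp add: ser ennreal_mult)
    qed
    then show ?thesis using p sp by blast
  qed
  obtain p where p: "\<And>k. I P k = ennreal (p k)" "\<And>k. 0 \<le> p k" "summable p"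
      "\<And>s. s \<in> {0..1} \<Longrightarrow> (\<integral>\<^sup>+x. ennreal (W x * s ^ N x) \<partial>P) = ennreal (\<Sum>k. p k * s ^ k)"
    using *[OF P refl] by blast
  obtain q where q: "\<And>k. I Q k = ennreal (q k)" "\<And>k. 0 \<le> q k" "summable q"
      "\<And>s. s \<in> {0..1} \<Longrightarrow> (\<integral>\<^sup>+x. ennreal (W x * s ^ N x) \<partial>Q) = ennreal (\<Sum>k. q k * s ^ k)"
    using *[OF Q PQ[symmetric]] by blast
  have "p k = q k"
  proof (rule power_series_coeff_unique[OF p(3) q(3)])
    fix s :: real assume s: "0 < s" "s < 1"
    have "0 \<le> (\<Sum>k. r k * s ^ k)" if "\<And>k. 0 \<le> r k" "summable r" for r :: "nat \<Rightarrow> real"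
      using that s powser_inside[of r 1 s] by (intro suminf_nonneg) auto
    moreover have "ennreal (\<Sum>k. p k * s ^ k) = ennreal (\<Sum>k. q k * s ^ k)"
      using eq[of s] p(4)[of s] q(4)[of s] s by simp
    ultimately show "(\<Sum>k. p k * s ^ k) = (\<Sum>k. q k * s ^ k)"
      using p(2,3) q(2,3) by simp
  qed
  then show ?thesis using p(1) q(1) unfolding I_def by simp
qed

text \<open>Interpolates between a generating function (\<open>F\<close> empty) and the probability
  that finitely many counts take given values (\<open>G\<close> empty). Each induction step turns
  one power into an indicator by reading off a coefficient.\<close>

lemma count_events_eq:
  fixes P Q :: "'a::metric_space measure measure" and A :: "'i \<Rightarrow> 'a set"
  assumes P: "prob_space P" "sets P = sets config_space" "poisson_gf \<mu> P"
    and Q: "prob_space Q" "sets Q = sets config_space" "poisson_gf \<mu> Q"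
    and A: "\<And>j. A j \<in> rc_borel"
  assumes "finite F" "finite G" "F \<inter> G = {}" "\<And>j. s j \<in> {0..1}"
  shows "(\<integral>\<^sup>+\<phi>. ennreal ((\<Prod>j\<in>F. of_bool (count_in \<phi> (A j) = k j)) * (\<Prod>j\<in>G. s j ^ count_in \<phi> (A j))) \<partial>P)
    = (\<integral>\<^sup>+\<phi>. ennreal ((\<Prod>j\<in>F. of_bool (count_in \<phi> (A j) = k j)) * (\<Prod>j\<in>G. s j ^ count_in \<phi> (A j))) \<partial>Q)"
  using assms(8-)
proof (induction F arbitrary: G s rule: finite_induct)
  case empty
  then show ?case
    using overlapping_gf_eq[OF P(2,3) Q(2,3), of G A s] A by simp
next
  case (insert i F)
  define W where "W \<phi> = (\<Prod>j\<in>F. of_bool (count_in \<phi> (A j) = k j)) * (\<Prod>j\<in>G. s j ^ count_in \<phi> (A j))"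
    for \<phi> :: "'a measure"
  note [measurable] = measurable_count_in[OF A]
  have m: "W \<in> borel_measurable config_space"
    unfolding W_def[abs_def] by measurable
  have "(\<integral>\<^sup>+\<phi>. ennreal (W \<phi> * of_bool (count_in \<phi> (A i) = k i)) \<partial>P)
    = (\<integral>\<^sup>+\<phi>. ennreal (W \<phi> * of_bool (count_in \<phi> (A i) = k i)) \<partial>Q)"
  proof (rule gf_coefficient_eq[OF P(1) Q(1)])
    show "W \<phi> \<in> {0..1}" for \<phi>
      using insert.prems by (auto simp: W_def intro!: mult_nonneg_nonneg mult_le_one prod_nonneg prod_le_1 power_le_one)
    fix t :: real assume t: "t \<in> {0..1}"
    \<comment> \<open>The count at \<open>i\<close>, still to be fixed, is moved to \<open>G\<close>
      with argument \<open>t\<close>; the induction hypothesis holds for all \<open>G\<close> and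
      \<open>s\<close>.\<close>
    have *: "W \<phi> * t ^ count_in \<phi> (A i) = (\<Prod>j\<in>F. of_bool (count_in \<phi> (A j) = k j)) *
        (\<Prod>j\<in>insert i G. (s(i := t)) j ^ count_in \<phi> (A j))" for \<phi>
    proof -
      have "i \<notin> G" using insert by auto
      then have "(\<Prod>j\<in>G. (s(i := t)) j ^ count_in \<phi> (A j)) = (\<Prod>j\<in>G. s j ^ count_in \<phi> (A j))"
        by (intro prod.cong) auto
      then show ?thesis using insert \<open>i \<notin> G\<close> by (simp add: W_def)
    qed
    show "(\<integral>\<^sup>+\<phi>. ennreal (W \<phi> * t ^ count_in \<phi> (A i)) \<partial>P) = (\<integral>\<^sup>+\<phi>. ennreal (W \<phi> * t ^ count_in \<phi> (A i)) \<partial>Q)"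
      unfolding * by (rule insert.IH) (use insert.prems insert.hyps t in auto)
  qed (use m P(2) Q(2) in \<open>simp_all cong: measurable_cong_sets\<close>)
  then show ?case
    using insert.hyps by (simp add: W_def mult_ac)
qed

text \<open>The events that prescribe finitely many counts generate the sigma-algebra and are stable
  under intersection. They are indexed by sets of pairs (set, value), so that an intersection is the
  event of the union of the indices, even when one set occurs with two different values.\<close>

lemma poisson_gf_unique:
  fixes P Q :: "'a::metric_space measure measure"
  assumes P: "prob_space P" "sets P = sets config_space" "poisson_gf \<mu> P"
    and Q: "prob_space Q" "sets Q = sets config_space" "poisson_gf \<mu> Q"
  shows "P = Q"
proof -
  define ev where "ev F = {\<phi> \<in> configs. \<forall>j\<in>F. count_in \<phi> (fst j) = snd j}" for F :: "('a set \<times> nat) set"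
  define E where "E = ev ` {F. finite F \<and> fst ` F \<subseteq> rc_borel}"
  interpret P: prob_space P by fact
  have ev_sets: "ev F \<in> sets config_space" if "finite F" "fst ` F \<subseteq> rc_borel" for F
  proof -
    have "{\<phi> \<in> space config_space. count_in \<phi> (fst j) = snd j} \<in> sets config_space" if "j \<in> F" for j
    proof -
      have "fst j \<in> rc_borel" using \<open>fst ` F \<subseteq> rc_borel\<close> imageI[OF \<open>j \<in> F\<close>, of fst] by (rule subsetD)
      note [measurable] = measurable_count_in[OF this]
      show ?thesis by measurable
    qed
    then have "{\<phi> \<in> space config_space. \<forall>j\<in>F. count_in \<phi> (fst j) = snd j} \<in> sets config_space"
      using \<open>finite F\<close> by (intro sets.sets_Collect_finite_All) auto
    then show ?thesis by (simp add: ev_def)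
  qed
  have gen: "sets config_space = sigma_sets configs E"
    unfolding sets_config_space_sigma
  proof (rule sigma_sets_eqI)
    fix X :: "'a measure set" assume "X \<in> {(\<lambda>\<phi>. emeasure \<phi> A) -` B \<inter> configs |A B. A \<in> rc_borel \<and> B \<in> sets borel}"
    then obtain A B where X: "X = (\<lambda>\<phi>. emeasure \<phi> A) -` B \<inter> configs" and A: "A \<in> rc_borel" by auto
    have "X = (\<Union>k\<in>{k. of_nat k \<in> B}. ev {(A, k)})"
      by (auto simp: X ev_def emeasure_eq_count_in_rc[OF _ A])
    also have "\<dots> = (\<Union>k. if of_nat k \<in> B then ev {(A, k)} else {})" by auto
    also have "\<dots> \<in> sigma_sets configs E"
      using A by (intro sigma_sets.Union) (auto simp: E_def intro: sigma_sets.Basic sigma_sets.Empty)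
    finally show "X \<in> sigma_sets configs E" .
  next
    fix X assume "X \<in> E"
    then have "X \<in> sets config_space" using ev_sets by (auto simp: E_def)
    then show "X \<in> sigma_sets configs {(\<lambda>\<phi>. emeasure \<phi> A) -` B \<inter> configs |A B. A \<in> rc_borel \<and> B \<in> sets borel}"
      unfolding sets_config_space_sigma .
  qed
  show ?thesis
  proof (rule measure_eqI_generator_eq[where A="\<lambda>_. ev {}"])
    show "Int_stable E"
    proof (rule Int_stableI)
      fix X Y assume "X \<in> E" "Y \<in> E"
      then obtain F G where "X = ev F" "Y = ev G" "finite F" "finite G" "fst ` F \<subseteq> rc_borel" "fst ` G \<subseteq> rc_borel"
        by (auto simp: E_def)
      moreover have "ev F \<inter> ev G = ev (F \<union> G)" unfolding ev_def by blast
      ultimately show "X \<inter> Y \<in> E" by (auto simp: E_def image_Un)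
    qed
    show "E \<subseteq> Pow configs" by (auto simp: E_def ev_def)
    show "sets P = sigma_sets configs E" "sets Q = sigma_sets configs E" using P(2) Q(2) gen by auto
    show "range (\<lambda>_. ev {}) \<subseteq> E" by (auto simp: E_def)
    show "(\<Union>_::nat. ev {}) = configs" by (auto simp: ev_def)
    show "emeasure P (ev {}) \<noteq> \<infinity>" by simp
    fix X assume "X \<in> E"
    then obtain F where F: "X = ev F" "finite F" "fst ` F \<subseteq> rc_borel" by (auto simp: E_def)
    \<comment> \<open>\<open>count_events_eq\<close> wants a relatively compact set at every index,
      hence the default \<open>{}\<close> for pairs whose first component is not one.\<close>
    define A where "A j = (if fst j \<in> rc_borel then fst j else {})" for j :: "'a set \<times> nat"
    have int: "emeasure R X = (\<integral>\<^sup>+\<phi>. ennreal ((\<Prod>j\<in>F. of_bool (count_in \<phi> (A j) = snd j)) *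
        (\<Prod>j\<in>{}. 1 ^ count_in \<phi> (A j))) \<partial>R)" if R: "sets R = sets config_space" for R
    proof -
      have "emeasure R X = (\<integral>\<^sup>+\<phi>. indicator X \<phi> \<partial>R)"
        using ev_sets[OF F(2,3)] F(1) R by simp
      also have "\<dots> = (\<integral>\<^sup>+\<phi>. ennreal ((\<Prod>j\<in>F. of_bool (count_in \<phi> (A j) = snd j)) *
        (\<Prod>j\<in>{}. 1 ^ count_in \<phi> (A j))) \<partial>R)"
      proof (rule nn_integral_cong)
        fix \<phi> assume "\<phi> \<in> space R"
        then have "\<phi> \<in> configs" using sets_eq_imp_space_eq[OF R] by simp
        moreover have "A j = fst j" if "j \<in> F" for j using F(3) that by (auto simp: A_def)
        ultimately have "\<phi> \<in> X \<longleftrightarrow> (\<forall>j\<in>F. count_in \<phi> (A j) = snd j)"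
          unfolding F(1) ev_def by auto
        moreover have "(\<Prod>j\<in>F. of_bool (count_in \<phi> (A j) = snd j) :: real)
            = of_bool (\<forall>j\<in>F. count_in \<phi> (A j) = snd j)"
          using F(2) by (induction F rule: finite_induct) auto
        ultimately show "indicator X \<phi> = ennreal ((\<Prod>j\<in>F. of_bool (count_in \<phi> (A j) = snd j)) *
           (\<Prod>j\<in>{}. 1 ^ count_in \<phi> (A j)))"
          by (simp add: indicator_def)
      qed
      finally show ?thesis .
    qed
    show "emeasure P X = emeasure Q X"
      unfolding int[OF P(2)] int[OF Q(2)]
      by (rule count_events_eq[OF P Q]) (use F(2) in \<open>auto simp: A_def\<close>)
  qed
qed

text \<open>For one set the generating function is an exponential series; over disjoint sets
  independence turns the mean of the product into the product of the means.\<close>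

lemma poisson_process_gf:
  fixes P :: "'a::metric_space measure measure"
  assumes "poisson_process M P"
  shows "poisson_gf M P"
  unfolding poisson_gf_def
proof (intro allI impI)
  fix \<B> :: "'a set set" and s :: "'a set \<Rightarrow> real"
  assume \<B>: "finite \<B>" "\<B> \<subseteq> rc_borel" "disjoint \<B>" and s: "\<forall>B. s B \<in> {0..1}"
  have P: "prob_space P" "sets P = sets config_space"
    using assms by (auto simp: poisson_process_def)
  interpret prob_space P by fact
  have spP: "space P = configs" using sets_eq_imp_space_eq[OF P(2)] by simp
  \<comment> \<open>The power is written as a function of an \<open>ennreal\<close> because the
    independence in \<open>poisson_process\<close> is that of the variables
    \<open>emeasure \<phi> (A i)\<close>.\<close>
  define g :: "real \<Rightarrow> ennreal \<Rightarrow> ennreal" where "g t e = ennreal (t ^ nat \<lfloor>enn2real e\<rfloor>)" for t e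
  have gm [measurable]: "g t \<in> borel_measurable borel" for t
    unfolding g_def[abs_def] by measurable
  have g: "g t (emeasure \<phi> B) = ennreal (t ^ count_in \<phi> B)" for t B and \<phi> :: "'a measure"
    by (simp add: g_def count_in_def measure_def)
  have one: "(\<integral>\<^sup>+\<phi>. g (s B) (emeasure \<phi> B) \<partial>P) = ennreal (exp (- ((1 - s B) * measure M B)))"
    if B: "B \<in> rc_borel" for B
  proof -
    note [measurable] = measurable_count_in[OF B]
    define a where "a = measure M B"
    have a: "0 \<le> a" by (simp add: a_def)
    have sB: "0 \<le> s B" using s by auto
    have "emeasure P {\<phi> \<in> space P. count_in \<phi> B = k} = ennreal (a ^ k / fact k * exp (- a))" for k
    proof -
      have "{\<phi> \<in> space P. count_in \<phi> B = k} = {\<phi> \<in> space P. emeasure \<phi> B = of_nat k}"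
        using emeasure_eq_count_in_rc[OF _ B] by (auto simp: spP)
      then show ?thesis
        using assms B unfolding poisson_process_def a_def by (simp add: emeasure_eq_measure)
    qed
    moreover have ms: "{\<phi> \<in> space P. count_in \<phi> B = k} \<in> sets P" for k
    proof -
      have "{\<phi> \<in> space config_space. count_in \<phi> B = k} \<in> sets config_space" by measurable
      then show ?thesis by (simp add: P(2) spP)
    qed
    ultimately have pk: "(\<integral>\<^sup>+\<phi>. ennreal (s B ^ k) * indicator {\<phi> \<in> space P. count_in \<phi> B = k} \<phi> \<partial>P)
      = ennreal ((s B * a) ^ k / fact k * exp (- a))" for k
      using a sB by (subst nn_integral_cmult_indicator)
        (auto simp: power_mult_distrib mult_ac simp flip: ennreal_mult)
    have "(\<integral>\<^sup>+\<phi>. g (s B) (emeasure \<phi> B) \<partial>P)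
      = (\<integral>\<^sup>+\<phi>. (\<Sum>k. ennreal (s B ^ k) * indicator {\<phi> \<in> space P. count_in \<phi> B = k} \<phi>) \<partial>P)"
    proof (rule nn_integral_cong)
      fix \<phi> assume "\<phi> \<in> space P"
      then have "(\<Sum>k. ennreal (s B ^ k) * indicator {\<phi> \<in> space P. count_in \<phi> B = k} \<phi>)
        = (\<Sum>k\<in>{count_in \<phi> B}. ennreal (s B ^ k) * indicator {\<phi> \<in> space P. count_in \<phi> B = k} \<phi>)"
        by (intro suminf_finite) auto
      then show "g (s B) (emeasure \<phi> B)
        = (\<Sum>k. ennreal (s B ^ k) * indicator {\<phi> \<in> space P. count_in \<phi> B = k} \<phi>)"
        using \<open>\<phi> \<in> space P\<close> by (simp add: g)
    qed
    also have "\<dots> = (\<Sum>k. \<integral>\<^sup>+\<phi>. ennreal (s B ^ k) * indicator {\<phi> \<in> space P. count_in \<phi> B = k} \<phi> \<partial>P)"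
      using ms by (intro nn_integral_suminf) auto
    also have "\<dots> = (\<Sum>k. ennreal ((s B * a) ^ k / fact k * exp (- a)))" by (simp add: pk)
    also have "\<dots> = ennreal (exp (s B * a) * exp (- a))"
    proof (rule suminf_ennreal_eq)
      have "(\<lambda>k. (s B * a) ^ k / fact k) sums exp (s B * a)"
        using exp_converges[of "s B * a"] by (simp add: field_simps)
      then show "(\<lambda>k. (s B * a) ^ k / fact k * exp (- a)) sums (exp (s B * a) * exp (- a))"
        by (rule sums_mult2)
    qed (use a sB in auto)
    also have "exp (s B * a) * exp (- a) = exp (- ((1 - s B) * measure M B))"
      by (simp add: a_def algebra_simps flip: exp_add)
    finally show ?thesis .
  qed
  \<comment> \<open>\<open>poisson_process\<close> states independence for numbered sets, so
    \<open>\<B>\<close> is enumerated.\<close>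
  obtain b where b: "bij_betw b {..<card \<B>} \<B>"
    using ex_bij_betw_nat_finite[OF \<B>(1)] by (auto simp: atLeast0LessThan)
  have brc: "b i \<in> rc_borel" if "i < card \<B>" for i
    using bij_betw_apply[OF b, of i] that \<B>(2) by auto
  have "disjoint_family_on b {..<card \<B>}"
    unfolding disjoint_family_on_def
  proof (intro ballI impI)
    fix i j assume "i \<in> {..<card \<B>}" "j \<in> {..<card \<B>}" "i \<noteq> j"
    then have "b i \<noteq> b j" "b i \<in> \<B>" "b j \<in> \<B>"
      using b by (auto simp: bij_betw_def inj_on_def)
    then show "b i \<inter> b j = {}" using \<B>(3) by (auto simp: disjoint_def)
  qed
  then have "indep_vars (\<lambda>_. borel) (\<lambda>i \<phi>. emeasure \<phi> (b i)) {..<card \<B>}"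
    using assms brc unfolding poisson_process_def by blast
  then have ind: "indep_vars (\<lambda>_. borel) (\<lambda>i \<phi>. g (s (b i)) (emeasure \<phi> (b i))) {..<card \<B>}"
    by (rule indep_vars_compose2) simp
  have "(\<integral>\<^sup>+\<phi>. ennreal (gen_prod s \<B> \<phi>) \<partial>P) = (\<integral>\<^sup>+\<phi>. (\<Prod>i<card \<B>. g (s (b i)) (emeasure \<phi> (b i))) \<partial>P)"
  proof (rule nn_integral_cong)
    fix \<phi>
    have "ennreal (gen_prod s \<B> \<phi>) = (\<Prod>B\<in>\<B>. g (s B) (emeasure \<phi> B))"
      using s by (simp add: g gen_prod_def prod_ennreal)
    then show "ennreal (gen_prod s \<B> \<phi>) = (\<Prod>i<card \<B>. g (s (b i)) (emeasure \<phi> (b i)))"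
      using prod.reindex_bij_betw[OF b, of "\<lambda>B. g (s B) (emeasure \<phi> B)"] by simp
  qed
  also have "\<dots> = (\<Prod>i<card \<B>. \<integral>\<^sup>+\<phi>. g (s (b i)) (emeasure \<phi> (b i)) \<partial>P)"
    by (rule indep_vars_nn_integral[OF _ ind]) auto
  also have "\<dots> = (\<Prod>i<card \<B>. ennreal (exp (- ((1 - s (b i)) * measure M (b i)))))"
    by (intro prod.cong one brc) auto
  also have "\<dots> = (\<Prod>B\<in>\<B>. ennreal (exp (- ((1 - s B) * measure M B))))"
    by (rule prod.reindex_bij_betw[OF b])
  also have "\<dots> = ennreal (exp (- (\<Sum>B\<in>\<B>. (1 - s B) * measure M B)))"
    using \<B>(1) by (simp add: prod_ennreal exp_sum sum_negf flip: sum_negf)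
  finally show "(\<integral>\<^sup>+\<phi>. ennreal (gen_prod s \<B> \<phi>) \<partial>P) = ennreal (exp (- (\<Sum>B\<in>\<B>. (1 - s B) * measure M B)))" .
qed

section \<open>Construction of finite Poisson processes\<close>

lemma config_of_tuple_0: "config_of_tuple 0 x = null_measure borel"
  by (rule measure_eqI) (auto simp: config_of_tuple_def emeasure_superpose)

lemma config_of_tuple_1: "config_of_tuple (Suc 0) x = return borel (x 0)"
  by (rule measure_eqI) (auto simp: config_of_tuple_def emeasure_superpose)

lemma gen_prod_config_of_tuple:
  assumes "\<B> \<subseteq> sets borel"
  shows "gen_prod s \<B> (config_of_tuple k x) = (\<Prod>i<k. \<Prod>B\<in>\<B>. if x i \<in> B then s B else 1)"
proof -
  have "s B ^ count_in (config_of_tuple k x) B = (\<Prod>i<k. if x i \<in> B then s B else 1)" if "B \<in> \<B>" for B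
  proof -
    have "B \<in> sets borel" using assms that by auto
    then have "count_in (config_of_tuple k x) B = (\<Sum>i<k. of_bool (x i \<in> B))"
      by (intro count_in_eq) (simp add: emeasure_config_of_tuple indicator_def)
    also have "s B ^ (\<Sum>i<k. of_bool (x i \<in> B)) = (\<Prod>i<k. s B ^ of_bool (x i \<in> B))"
      by (rule power_sum)
    also have "\<dots> = (\<Prod>i<k. if x i \<in> B then s B else 1)" by (intro prod.cong) auto
    finally show ?thesis .
  qed
  then have "gen_prod s \<B> (config_of_tuple k x) = (\<Prod>B\<in>\<B>. \<Prod>i<k. if x i \<in> B then s B else 1)"
    unfolding gen_prod_def by (rule prod.cong[OF refl])
  also have "\<dots> = (\<Prod>i<k. \<Prod>B\<in>\<B>. if x i \<in> B then s B else 1)"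
    by (rule prod.swap)
  finally show ?thesis .
qed

text \<open>At most one factor differs from 1. The right-hand side is affine in the indicators and
  can be integrated term by term.\<close>

lemma prod_disjoint_indicator:
  fixes s :: "'a set \<Rightarrow> real"
  assumes "finite \<B>" "disjoint \<B>"
  shows "(\<Prod>B\<in>\<B>. if y \<in> B then s B else 1) = 1 - (\<Sum>B\<in>\<B>. (1 - s B) * indicator B y)"
proof (cases "y \<in> \<Union>\<B>")
  case True
  then obtain C where C: "C \<in> \<B>" "y \<in> C" by blast
  then have iff: "y \<in> B \<longleftrightarrow> B = C" if "B \<in> \<B>" for B
    using assms(2) that by (auto simp: disjoint_def)
  have "(\<Prod>B\<in>\<B>. if y \<in> B then s B else 1) = (\<Prod>B\<in>\<B>. if B = C then s B else 1)"
    using iff by (intro prod.cong) auto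
  moreover have "(\<Sum>B\<in>\<B>. (1 - s B) * indicator B y) = (\<Sum>B\<in>\<B>. if B = C then 1 - s B else 0)"
    using iff by (intro sum.cong) auto
  ultimately show ?thesis using C assms(1) by simp
next
  case False
  then have "(\<Prod>B\<in>\<B>. if y \<in> B then s B else 1) = (\<Prod>B\<in>\<B>. 1)" by (intro prod.cong) auto
  moreover have "(\<Sum>B\<in>\<B>. (1 - s B) * indicator B y) = (\<Sum>B\<in>\<B>. 0)"
    using False by (intro sum.cong) auto
  ultimately show ?thesis by simp
qed

context sigma_compact_space
begin

text \<open>The degenerate case of the construction below, in which the intensity cannot be
  normalised to a probability.\<close>

lemma null_poisson:
  fixes \<mu> :: "'a measure"
  assumes \<mu>: "finite_measure \<mu>" "sets \<mu> = sets borel" and 0: "emeasure \<mu> UNIV = 0"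
  shows "poisson_gf \<mu> (return config_space (null_measure borel))"
  unfolding poisson_gf_def
proof (intro allI impI)
  fix \<B> :: "'a set set" and s :: "'a set \<Rightarrow> real"
  assume \<B>: "finite \<B>" "\<B> \<subseteq> rc_borel" "disjoint \<B>" and s: "\<forall>B. s B \<in> {0..1}"
  have "emeasure \<mu> B = 0" for B
    using emeasure_space[of \<mu> B] 0 sets_eq_imp_space_eq[OF \<mu>(2)] by simp
  then have "measure \<mu> B = 0" for B by (simp add: measure_def)
  moreover have "gen_prod s \<B> (null_measure borel) = 1"
    by (simp add: gen_prod_def count_in_def measure_def)
  ultimately show "(\<integral>\<^sup>+\<phi>. ennreal (gen_prod s \<B> \<phi>) \<partial>return config_space (null_measure borel))
      = ennreal (exp (- (\<Sum>B\<in>\<B>. (1 - s B) * measure \<mu> B)))"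
    using \<B>(2) by (subst nn_integral_return) auto
qed

text \<open>A Poisson number of independent points, each with law \<open>\<mu>\<close> divided by
  its mass \<open>a\<close>. The last clause keeps the contributions of zero and of one point: the
  weight of one point is \<open>a * exp (- a)\<close>, and its factor \<open>a\<close> undoes the
  normalisation, so both terms come with the same constant.\<close>

lemma poisson_exists:
  fixes \<mu> :: "'a measure"
  assumes \<mu>: "finite_measure \<mu>" "sets \<mu> = sets borel"
  shows "\<exists>Q. prob_space Q \<and> sets Q = sets config_space \<and> poisson_gf \<mu> Q \<and>
     (\<integral>\<^sup>+\<phi>. emeasure \<phi> UNIV \<partial>Q) = emeasure \<mu> UNIV \<and>
     (\<forall>B\<in>sets config_space. ennreal (exp (- measure \<mu> UNIV)) *
        (indicator B (null_measure borel) + emeasure \<mu> {x. return borel x \<in> B}) \<le> emeasure Q B)"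
proof (cases "emeasure \<mu> UNIV = 0")
  case True
  have "emeasure \<mu> B = 0" for B
    using emeasure_space[of \<mu> B] True sets_eq_imp_space_eq[OF \<mu>(2)] by simp
  then show ?thesis
    using null_poisson[OF \<mu> True] measurable_emeasure_config[of UNIV]
    by (intro exI[of _ "return config_space (null_measure borel)"])
      (auto simp: measure_def nn_integral_return intro!: prob_space_return)
next
  case False
  interpret \<mu>: finite_measure \<mu> by fact
  have sp\<mu>: "space \<mu> = UNIV" using sets_eq_imp_space_eq[OF \<mu>(2)] by simp
  define a where "a = measure \<mu> UNIV"
  have \<mu>a: "emeasure \<mu> UNIV = ennreal a" by (simp add: a_def \<mu>.emeasure_eq_measure)
  have a: "a > 0" using False \<mu>a by (cases "a > 0") (auto simp: ennreal_neg)
  define \<nu> where "\<nu> = density \<mu> (\<lambda>_. ennreal (1 / a))"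
  have s\<nu>: "sets \<nu> = sets borel" by (simp add: \<nu>_def \<mu>)
  have sp\<nu>: "space \<nu> = UNIV" by (simp add: \<nu>_def sp\<mu>)
  have \<nu>: "emeasure \<nu> A = ennreal (1 / a) * emeasure \<mu> A" if "A \<in> sets borel" for A
    unfolding \<nu>_def using that \<mu> by (subst emeasure_density_const) auto
  have "emeasure \<nu> UNIV = 1"
    using a by (simp add: \<nu> \<mu>a flip: ennreal_mult')
  then have pr\<nu>: "prob_space \<nu>" by (intro prob_spaceI) (simp add: sp\<nu>)
  interpret \<nu>: prob_space \<nu> by fact
  have \<nu>1: "measure \<nu> UNIV = 1" using \<nu>.prob_space sp\<nu> by simp
  have m\<nu>: "measure \<nu> A = measure \<mu> A / a" if "A \<in> sets borel" for A
    using \<nu>[OF that] a by (simp add: measure_def enn2real_mult)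
  interpret product_prob_space "\<lambda>_::nat. \<nu>" by (intro product_prob_spaceI pr\<nu>)
  define T where "T k = Pi\<^sub>M {..<k} (\<lambda>_. \<nu>)" for k :: nat
  have prT: "prob_space (T k)" for k unfolding T_def by (intro prob_space_PiM pr\<nu>)
  have Tm: "config_of_tuple k \<in> measurable (T k) config_space" for k
    unfolding T_def by (intro measurable_config_of_tuple s\<nu>)
  define R where "R k = distr (T k) config_space (config_of_tuple k)" for k
  have prR: "prob_space (R k)" for k
    unfolding R_def by (intro prob_space.prob_space_distr prT Tm)
  define p where "p = poisson_pmf a"
  have Rm: "R \<in> measurable (measure_pmf p) (subprob_algebra config_space)"
    using prR by (auto simp: space_subprob_algebra R_def prob_space_imp_subprob_space)
  define Q where "Q = measure_pmf p \<bind> R"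
  have sQ: "sets Q = sets config_space"
    unfolding Q_def by (rule sets_bind) (auto simp: R_def)
  have prQ: "prob_space Q"
    unfolding Q_def by (rule prob_space.prob_space_bind[OF _ _ Rm]) (auto simp: prob_space_measure_pmf prR)
  define w where "w k = a ^ k / fact k * exp (- a)" for k :: nat
  have w0: "0 \<le> w k" for k using a by (simp add: w_def)
  \<comment> \<open>Integration conditional on the number of points; the generating function, the
    mean and the lower bound are all computed from it.\<close>
  have int: "(\<integral>\<^sup>+\<phi>. h \<phi> \<partial>Q) = (\<Sum>k. ennreal (w k) * (\<integral>\<^sup>+x. h (config_of_tuple k x) \<partial>T k))"
    if h: "h \<in> borel_measurable config_space" for h :: "'a measure \<Rightarrow> ennreal"
  proof -
    have "(\<integral>\<^sup>+\<phi>. h \<phi> \<partial>Q) = (\<integral>\<^sup>+k. (\<integral>\<^sup>+\<phi>. h \<phi> \<partial>R k) \<partial>measure_pmf p)"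
      unfolding Q_def by (rule nn_integral_bind[OF h Rm])
    also have "\<dots> = (\<Sum>k. ennreal (pmf p k) * (\<integral>\<^sup>+\<phi>. h \<phi> \<partial>R k))"
      by (simp add: nn_integral_measure_pmf nn_integral_count_space_nat)
    also have "\<dots> = (\<Sum>k. ennreal (w k) * (\<integral>\<^sup>+x. h (config_of_tuple k x) \<partial>T k))"
      unfolding R_def using a by (simp add: nn_integral_distr[OF Tm] h p_def w_def)
    finally show ?thesis .
  qed
  have gf: "poisson_gf \<mu> Q"
    unfolding poisson_gf_def
  proof (intro allI impI)
    fix \<B> :: "'a set set" and s :: "'a set \<Rightarrow> real"
    assume \<B>: "finite \<B>" "\<B> \<subseteq> rc_borel" "disjoint \<B>" and s: "\<forall>B. s B \<in> {0..1}"
    have \<B>b: "\<B> \<subseteq> sets borel" using \<B>(2) by (auto simp: rc_borel_def)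
    \<comment> \<open>Each point contributes the factor \<open>g y\<close>, whose mean is
      \<open>c\<close>. Averaging \<open>c ^ k\<close> over the Poisson number of points gives
      \<open>exp (a * c - a)\<close>, which is \<open>exp (- S)\<close>.\<close>
    define g where "g y = (\<Prod>B\<in>\<B>. if y \<in> B then s B else 1)" for y
    have g0: "0 \<le> g y" for y using s by (auto simp: g_def intro!: prod_nonneg)
    define S where "S = (\<Sum>B\<in>\<B>. (1 - s B) * measure \<mu> B)"
    define c where "c = 1 - S / a"
    have g_eq: "g y = 1 - (\<Sum>B\<in>\<B>. (1 - s B) * indicator B y)" for y
      unfolding g_def by (rule prod_disjoint_indicator[OF \<B>(1,3)])
    have ind: "integrable \<nu> (\<lambda>y. (1 - s B) * indicator B y)" if "B \<in> \<B>" for B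
      using that \<B>b s\<nu> by (intro integrable_mult_right \<nu>.integrable_const_bound[where B=1])
        (auto simp: indicator_def)
    have gint: "integrable \<nu> g"
      unfolding g_eq[abs_def] by (intro Bochner_Integration.integrable_diff Bochner_Integration.integrable_sum ind) simp
    have "(\<integral>y. g y \<partial>\<nu>) = 1 - (\<Sum>B\<in>\<B>. (1 - s B) * measure \<nu> B)"
      unfolding g_eq using ind \<B>b s\<nu>
      by (subst Bochner_Integration.integral_diff)
        (auto simp: Bochner_Integration.integral_sum \<nu>1 sp\<nu> intro!: sum.cong Bochner_Integration.integrable_sum)
    also have "\<dots> = c"
      unfolding c_def S_def using \<B>b by (auto simp: m\<nu> sum_divide_distrib intro!: sum.cong)
    finally have gc: "(\<integral>y. g y \<partial>\<nu>) = c" .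
    have c0: "0 \<le> c" unfolding gc[symmetric] by (rule Bochner_Integration.integral_nonneg) (rule g0)
    have gnn: "(\<integral>\<^sup>+y. ennreal (g y) \<partial>\<nu>) = ennreal c"
      using nn_integral_eq_integral[OF gint] g0 gc by simp
    have gm: "(\<lambda>y. ennreal (g y)) \<in> borel_measurable \<nu>" using gint by simp
    have "(\<integral>\<^sup>+x. ennreal (gen_prod s \<B> (config_of_tuple k x)) \<partial>T k) = ennreal (c ^ k)" for k
    proof -
      have "(\<integral>\<^sup>+x. ennreal (gen_prod s \<B> (config_of_tuple k x)) \<partial>T k)
        = (\<integral>\<^sup>+x. (\<Prod>i<k. ennreal (g (x i))) \<partial>T k)"
        using g0 by (simp add: gen_prod_config_of_tuple[OF \<B>b] prod_ennreal flip: g_def)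
      also have "\<dots> = (\<Prod>i<k. \<integral>\<^sup>+y. ennreal (g y) \<partial>\<nu>)"
        unfolding T_def by (rule product_nn_integral_prod) (use gm in auto)
      finally show ?thesis using c0 by (simp add: gnn ennreal_power)
    qed
    then have "(\<integral>\<^sup>+\<phi>. ennreal (gen_prod s \<B> \<phi>) \<partial>Q) = (\<Sum>k. ennreal (w k) * ennreal (c ^ k))"
      using measurable_gen_prod[OF \<B>(2), of s] by (subst int) auto
    also have "\<dots> = (\<Sum>k. ennreal ((a * c) ^ k / fact k * exp (- a)))"
      using w0 c0 by (simp add: w_def power_mult_distrib mult_ac flip: ennreal_mult')
    also have "\<dots> = ennreal (exp (a * c) * exp (- a))"
    proof (rule suminf_ennreal_eq)
      have "(\<lambda>k. (a * c) ^ k / fact k) sums exp (a * c)"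
        using exp_converges[of "a * c"] by (simp add: field_simps)
      then show "(\<lambda>k. (a * c) ^ k / fact k * exp (- a)) sums (exp (a * c) * exp (- a))"
        by (rule sums_mult2)
    qed (use a c0 in auto)
    also have "exp (a * c) * exp (- a) = exp (- S)"
      using a by (simp add: c_def right_diff_distrib flip: exp_add)
    finally show "(\<integral>\<^sup>+\<phi>. ennreal (gen_prod s \<B> \<phi>) \<partial>Q) = ennreal (exp (- (\<Sum>B\<in>\<B>. (1 - s B) * measure \<mu> B)))"
      unfolding S_def .
  qed
  have mass: "(\<integral>\<^sup>+\<phi>. emeasure \<phi> UNIV \<partial>Q) = emeasure \<mu> UNIV"
  proof -
    have "(\<integral>\<^sup>+\<phi>. emeasure \<phi> UNIV \<partial>Q) = (\<Sum>k. ennreal (w k) * of_nat k)"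
      by (subst int) (auto simp: measurable_emeasure_config emeasure_config_of_tuple prob_space.emeasure_space_1[OF prT])
    also have "\<dots> = (\<Sum>k. ennreal (w k * real k))"
      using w0 by (simp add: ennreal_mult ennreal_of_nat_eq_real_of_nat)
    also have "\<dots> = ennreal a"
    proof (rule suminf_ennreal_eq)
      have "(\<lambda>k. a ^ k / fact k) sums exp a"
        using exp_converges[of a] by (simp add: field_simps)
      then have "(\<lambda>k. a ^ k / fact k * (a * exp (- a))) sums (exp a * (a * exp (- a)))"
        by (rule sums_mult2)
      moreover have "a ^ k / fact k * (a * exp (- a)) = w (Suc k) * real (Suc k)" for k
        by (simp add: w_def del: of_nat_Suc)
      moreover have "exp a * (a * exp (- a)) = a" by (simp add: exp_minus)
      ultimately have "(\<lambda>k. w (Suc k) * real (Suc k)) sums a" by simp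
      then show "(\<lambda>k. w k * real k) sums a"
        by (subst (asm) sums_Suc_iff) simp
    qed (use w0 in auto)
    finally show ?thesis by (simp add: \<mu>a)
  qed
  have lower: "ennreal (exp (- a)) * (indicator B (null_measure borel) + emeasure \<mu> {x. return borel x \<in> B})
      \<le> emeasure Q B" if B: "B \<in> sets config_space" for B
  proof -
    have B1: "{x. return borel x \<in> B} \<in> sets borel"
      using measurable_sets[OF measurable_return_config B] by (simp add: vimage_def)
    let ?f = "\<lambda>k. ennreal (w k) * (\<integral>\<^sup>+x. indicator B (config_of_tuple k x) \<partial>T k)"
    have "emeasure Q B = (\<integral>\<^sup>+\<phi>. indicator B \<phi> \<partial>Q)" using B sQ by simp
    also have "\<dots> = (\<Sum>k. ?f k)" using B by (intro int) auto
    finally have QB: "emeasure Q B = (\<Sum>k. ?f k)" .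
    have "?f 0 = ennreal (exp (- a)) * indicator B (null_measure borel)"
      by (simp add: config_of_tuple_0 w_def prob_space.emeasure_space_1[OF prT])
    moreover have "?f 1 = ennreal (exp (- a)) * emeasure \<mu> {x. return borel x \<in> B}"
    proof -
      have 0: "{..<Suc 0} = {0::nat}" by auto
      have "(\<integral>\<^sup>+x. indicator B (config_of_tuple 1 x) \<partial>T 1)
        = (\<integral>\<^sup>+x. indicator {x. return borel x \<in> B} (x 0) \<partial>Pi\<^sub>M {0::nat} (\<lambda>_. \<nu>))"
        unfolding T_def One_nat_def 0 config_of_tuple_1
        by (intro nn_integral_cong) (simp add: indicator_def)
      also have "\<dots> = (\<integral>\<^sup>+x. indicator {x. return borel x \<in> B} x \<partial>\<nu>)"
        by (rule product_nn_integral_singleton) (use B1 s\<nu> in auto)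
      also have "\<dots> = ennreal (1 / a) * emeasure \<mu> {x. return borel x \<in> B}"
        using B1 s\<nu> by (simp add: \<nu>)
      finally have "?f 1 = (ennreal (w 1) * ennreal (1 / a)) * emeasure \<mu> {x. return borel x \<in> B}"
        by (simp add: mult.assoc)
      also have "ennreal (w 1) * ennreal (1 / a) = ennreal (exp (- a))"
        using a w0[of 1] by (simp add: w_def flip: ennreal_mult')
      finally show ?thesis .
    qed
    moreover have "(\<Sum>k\<in>{0, 1}. ?f k) \<le> (\<Sum>k. ?f k)"
      by (intro sum_le_suminf) auto
    ultimately show ?thesis by (simp add: QB distrib_left)
  qed
  show ?thesis
    using prQ sQ gf mass lower unfolding a_def by blast
qed

end

section \<open>Coupling a repulsive process with a Poisson process\<close>

text \<open>\<open>superpose\<close> lives on the Borel sets of the underlying space; this is the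
  analogue for laws on \<open>config_space\<close> and its powers.\<close>

definition plus_measure :: "'a measure \<Rightarrow> 'a measure \<Rightarrow> 'a measure" where
  "plus_measure M N = measure_of (space M) (sets M) (\<lambda>A. emeasure M A + emeasure N A)"

lemma sets_plus_measure [simp, measurable_cong]: "sets (plus_measure M N) = sets M"
  and space_plus_measure [simp]: "space (plus_measure M N) = space M"
  by (simp_all add: plus_measure_def)

lemma emeasure_plus_measure:
  assumes "sets N = sets M"
  shows "emeasure (plus_measure M N) A = emeasure M A + emeasure N A"
proof (cases "A \<in> sets M")
  case True
  then show ?thesis unfolding plus_measure_def
  proof (rule emeasure_measure_of_sigma[rotated -1])
    show "countably_additive (sets M) (\<lambda>A. emeasure M A + emeasure N A)"
    proof (rule countably_additiveI)
      fix B :: "nat \<Rightarrow> _" assume "range B \<subseteq> sets M" "disjoint_family B"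
      then show "(\<Sum>i. emeasure M (B i) + emeasure N (B i)) = emeasure M (\<Union>i. B i) + emeasure N (\<Union>i. B i)"
        using assms by (simp add: suminf_add[symmetric] suminf_emeasure)
    qed
  qed (auto simp: positive_def sets.sigma_algebra_axioms)
next
  case False
  then show ?thesis
    using assms emeasure_notin_sets[of A "plus_measure M N"] by (simp add: emeasure_notin_sets)
qed

lemma nn_integral_plus_measure:
  assumes N: "sets N = sets M" and f: "f \<in> borel_measurable M"
  shows "(\<integral>\<^sup>+x. f x \<partial>plus_measure M N) = (\<integral>\<^sup>+x. f x \<partial>M) + (\<integral>\<^sup>+x. f x \<partial>N)"
  using f
proof (induction rule: borel_measurable_induct)
  case (cong f g)
  have "space N = space M" using N by (rule sets_eq_imp_space_eq)
  with cong show ?case by (simp cong: nn_integral_cong_simp)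
next
  case (set A)
  then show ?case using N by (simp add: emeasure_plus_measure)
next
  case (mult u c)
  have "u \<in> borel_measurable N" "u \<in> borel_measurable (plus_measure M N)"
    using mult N by (auto cong: measurable_cong_sets)
  then show ?case using mult by (simp add: nn_integral_cmult distrib_left)
next
  case (add u v)
  have "u \<in> borel_measurable N" "u \<in> borel_measurable (plus_measure M N)"
    "v \<in> borel_measurable N" "v \<in> borel_measurable (plus_measure M N)"
    using add N by (auto cong: measurable_cong_sets)
  then show ?case using add by (simp add: nn_integral_add ac_simps)
next
  case (seq U)
  have m: "U i \<in> borel_measurable N" "U i \<in> borel_measurable (plus_measure M N)" for i
    using seq(1)[of i] N by (auto cong: measurable_cong_sets)
  have inc: "incseq (\<lambda>i. integral\<^sup>N R (U i))" for R
    using \<open>incseq U\<close> by (auto simp: incseq_def le_fun_def intro!: nn_integral_mono)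
  have sup: "integral\<^sup>N R (SUP i. U i) = (SUP i. integral\<^sup>N R (U i))" if "\<And>i. U i \<in> borel_measurable R" for R
  proof -
    have "(SUP i. U i) = (\<lambda>x. SUP i. U i x)" by (simp add: fun_eq_iff image_comp)
    then show ?thesis using nn_integral_monotone_convergence_SUP[OF \<open>incseq U\<close>, of R] that by simp
  qed
  have "(SUP i. integral\<^sup>N (plus_measure M N) (U i)) = (SUP i. integral\<^sup>N M (U i) + integral\<^sup>N N (U i))"
    using seq.IH by simp
  also have "\<dots> = (SUP i. integral\<^sup>N M (U i)) + (SUP i. integral\<^sup>N N (U i))"
    by (rule ennreal_SUP_add[OF inc inc])
  finally show ?case
    unfolding \<open>f = (SUP i. U i)\<close> sup[OF m(2)] sup[OF m(1)] sup[OF seq(1)] .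
qed

text \<open>The two-term superposition, indexed by \<open>bool\<close> so that the facts about
  finite superpositions apply.\<close>

definition add_config :: "'a::metric_space measure \<Rightarrow> 'a measure \<Rightarrow> 'a measure" where
  "add_config \<phi> \<psi> = superpose UNIV (\<lambda>b. if b then \<phi> else \<psi>)"

lemma sets_add_config [simp]: "sets (add_config \<phi> \<psi>) = sets borel"
  by (simp add: add_config_def)

lemma emeasure_add_config:
  assumes "\<phi> \<in> configs" "\<psi> \<in> configs"
  shows "emeasure (add_config \<phi> \<psi>) A = emeasure \<phi> A + emeasure \<psi> A"
  unfolding add_config_def using assms
  by (subst emeasure_superpose) (auto simp: sets_config UNIV_bool ac_simps)

lemma add_config_config: "\<phi> \<in> configs \<Longrightarrow> \<psi> \<in> configs \<Longrightarrow> add_config \<phi> \<psi> \<in> configs"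
  unfolding add_config_def by (intro superpose_config) auto

lemma add_config_null:
  assumes "\<phi> \<in> configs"
  shows "add_config \<phi> (null_measure borel) = \<phi>" "add_config (null_measure borel) \<phi> = \<phi>"
  using assms by (auto intro!: measure_eqI simp: emeasure_add_config sets_config)

lemma measurable_add_config [measurable (raw)]:
  assumes "f \<in> measurable M config_space" "g \<in> measurable M config_space"
  shows "(\<lambda>x. add_config (f x) (g x)) \<in> measurable M config_space"
proof -
  have "(\<lambda>x. superpose UNIV (\<lambda>b. (if b then f else g) x)) \<in> measurable M config_space"
    using assms by (intro measurable_superpose) auto
  also have "(\<lambda>x. superpose UNIV (\<lambda>b. (if b then f else g) x)) = (\<lambda>x. add_config (f x) (g x))"
    by (auto simp: add_config_def fun_eq_iff intro!: superpose_cong)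
  finally show ?thesis .
qed

lemma gen_prod_add_config:
  assumes "\<phi> \<in> configs" "\<psi> \<in> configs" "\<B> \<subseteq> rc_borel"
  shows "gen_prod s \<B> (add_config \<phi> \<psi>) = gen_prod s \<B> \<phi> * gen_prod s \<B> \<psi>"
  unfolding add_config_def using assms
  by (subst gen_prod_superpose) (auto simp: UNIV_bool mult.commute)

context sigma_compact_space
begin

text \<open>The common part \<open>\<kappa>\<close> of two laws \<open>P\<close> and \<open>Q\<close> is carried by the first component of a triple
  \<open>(\<theta>, a, b)\<close>, the remainders by the other two; then \<open>\<theta> + a\<close> has law \<open>P\<close>, \<open>\<theta> + b\<close> has law \<open>Q\<close>, and
  \<open>a\<close> and \<open>b\<close> bound the distance of the two in a measurable way.\<close>

lemma common_part_coupling: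
  fixes P Q \<kappa> :: "'a measure measure"
  assumes P: "prob_space P" "sets P = sets config_space"
    and Q: "prob_space Q" "sets Q = sets config_space"
    and \<kappa>: "sets \<kappa> = sets config_space"
      "\<And>B. B \<in> sets config_space \<Longrightarrow> emeasure \<kappa> B \<le> emeasure P B"
      "\<And>B. B \<in> sets config_space \<Longrightarrow> emeasure \<kappa> B \<le> emeasure Q B"
  shows "\<exists>T. prob_space T \<and> sets T = sets (config_space \<Otimes>\<^sub>M config_space \<Otimes>\<^sub>M config_space) \<and>
    distr T config_space (\<lambda>z. add_config (fst z) (fst (snd z))) = P \<and>
    distr T config_space (\<lambda>z. add_config (fst z) (snd (snd z))) = Q \<and>
    (\<integral>\<^sup>+z. emeasure (fst (snd z)) UNIV + emeasure (snd (snd z)) UNIV \<partial>T) + 2 * (\<integral>\<^sup>+\<theta>. emeasure \<theta> UNIV \<partial>\<kappa>)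
      = (\<integral>\<^sup>+\<phi>. emeasure \<phi> UNIV \<partial>P) + (\<integral>\<^sup>+\<phi>. emeasure \<phi> UNIV \<partial>Q)"
proof -
  let ?C = "config_space :: 'a measure measure"
  let ?N = "?C \<Otimes>\<^sub>M ?C \<Otimes>\<^sub>M ?C"
  let ?m = "\<lambda>\<phi> :: 'a measure. emeasure \<phi> UNIV"
  interpret P: prob_space P by fact
  interpret Q: prob_space Q by fact
  have sp: "space P = configs" "space Q = configs" "space \<kappa> = configs"
    using sets_eq_imp_space_eq[OF P(2)] sets_eq_imp_space_eq[OF Q(2)] sets_eq_imp_space_eq[OF \<kappa>(1)] by auto
  define t where "t = emeasure \<kappa> configs"
  have t1: "t \<le> 1" using \<kappa>(2)[of configs] P.emeasure_space_1 sets.top[of ?C] by (simp add: t_def sp)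
  have fin\<kappa>: "finite_measure \<kappa>"
    using t1 by (intro finite_measureI) (auto simp: sp t_def[symmetric] top_unique)
  define R1 where "R1 = diff_measure P \<kappa>"
  define R2 where "R2 = diff_measure Q \<kappa>"
  have R1: "emeasure R1 B = emeasure P B - emeasure \<kappa> B" if "B \<in> sets config_space" for B
    unfolding R1_def using that P \<kappa> fin\<kappa> P.finite_measure_axioms by (intro emeasure_diff_measure) auto
  have R2: "emeasure R2 B = emeasure Q B - emeasure \<kappa> B" if "B \<in> sets config_space" for B
    unfolding R2_def using that Q \<kappa> fin\<kappa> Q.finite_measure_axioms by (intro emeasure_diff_measure) auto
  have sR: "sets R1 = sets config_space" "sets R2 = sets config_space"
    using P Q by (auto simp: R1_def R2_def)
  have spR: "space R1 = configs" "space R2 = configs"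
    using sR[THEN sets_eq_imp_space_eq] by auto
  have totP: "emeasure P configs = 1" and totQ: "emeasure Q configs = 1"
    using P.emeasure_space_1 Q.emeasure_space_1 sp by auto
  have tot: "emeasure R1 configs = 1 - t" "emeasure R2 configs = 1 - t"
    using R1[of configs] R2[of configs] sets.top[of ?C] by (auto simp: totP totQ t_def)
  have P_eq: "plus_measure \<kappa> R1 = P"
  proof (rule measure_eqI)
    fix B assume "B \<in> sets (plus_measure \<kappa> R1)"
    then have B: "B \<in> sets config_space" using \<kappa> by simp
    then show "emeasure (plus_measure \<kappa> R1) B = emeasure P B"
      using \<kappa> sR by (simp add: emeasure_plus_measure R1 add_diff_inverse_ennreal)
  qed (use \<kappa> P in simp)
  have Q_eq: "plus_measure \<kappa> R2 = Q"
  proof (rule measure_eqI)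
    fix B assume "B \<in> sets (plus_measure \<kappa> R2)"
    then have B: "B \<in> sets config_space" using \<kappa> by simp
    then show "emeasure (plus_measure \<kappa> R2) B = emeasure Q B"
      using \<kappa> sR by (simp add: emeasure_plus_measure R2 add_diff_inverse_ennreal)
  qed (use \<kappa> Q in simp)
  \<comment> \<open>Both remainders have mass \<open>1 - t\<close>, so their product has the square
    of that mass and must be divided by \<open>1 - t\<close> to have them as marginals. For
    \<open>t = 1\<close> the constant is infinite, but then the remainders are null and every
    product with it below is 0.\<close>
  define c where "c = inverse (1 - t)"
  have c: "c * (1 - t) = 1 \<or> t = 1"
  proof (cases "t = 1")
    case False
    then have "1 - t \<noteq> 0" using t1 by (auto simp: diff_eq_0_iff_ennreal)
    moreover have "1 - t < top" using le_less_trans[OF diff_le_self_ennreal[of 1 t]] by simp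
    ultimately have "(1 - t) / (1 - t) = 1" by (intro ennreal_divide_self) auto
    then show ?thesis by (simp add: c_def divide_ennreal_def mult.commute)
  qed simp
  have cR: "c * ((1 - t) * (\<integral>\<^sup>+x. h x \<partial>R)) = (\<integral>\<^sup>+x. h x \<partial>R)"
    if R: "space R = configs" "emeasure R configs = 1 - t" for R and h :: "'a measure \<Rightarrow> ennreal"
  proof (cases "t = 1")
    case True
    then have "space R \<in> null_sets R" by (intro null_setsI sets.top) (simp add: R)
    then have "AE x in R. h x = 0" by (intro AE_I'[of "space R"]) auto
    then have "(\<integral>\<^sup>+x. h x \<partial>R) = (\<integral>\<^sup>+x. 0 \<partial>R)" by (rule nn_integral_cong_AE)
    then show ?thesis by simp
  next
    case False
    then show ?thesis using c by (simp add: mult.assoc[symmetric])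
  qed
  interpret R2: finite_measure R2
    using tot by (intro finite_measureI) (simp add: spR ennreal_minus_eq_top)
  let ?o = "null_measure borel :: 'a measure"
  have d1 [measurable]: "(\<lambda>\<theta>. (\<theta>, ?o, ?o)) \<in> measurable \<kappa> ?N"
    by (subst measurable_cong_sets[OF \<kappa>(1) refl]) (intro measurable_Pair measurable_ident measurable_const; simp)
  have d2 [measurable]: "(\<lambda>x. (?o, fst x, snd x)) \<in> measurable (R1 \<Otimes>\<^sub>M R2) ?N"
    by (subst measurable_cong_sets[OF sets_pair_measure_cong[OF sR] refl])
      (intro measurable_Pair measurable_fst measurable_snd measurable_const; simp)
  \<comment> \<open>On a part of mass \<open>t\<close> the two configurations coincide; on the rest
    nothing is shared and the normalised remainders are drawn independently.\<close>
  define T where "T = plus_measure (distr \<kappa> ?N (\<lambda>\<theta>. (\<theta>, ?o, ?o)))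
    (scale_measure c (distr (R1 \<Otimes>\<^sub>M R2) ?N (\<lambda>x. (?o, fst x, snd x))))"
  have sT: "sets T = sets ?N" by (simp add: T_def)
  have int: "(\<integral>\<^sup>+z. h z \<partial>T) = (\<integral>\<^sup>+\<theta>. h (\<theta>, ?o, ?o) \<partial>\<kappa>) + c * (\<integral>\<^sup>+a. (\<integral>\<^sup>+b. h (?o, a, b) \<partial>R2) \<partial>R1)"
    if h [measurable]: "h \<in> borel_measurable ?N" for h
  proof -
    have "(\<lambda>x. h (?o, fst x, snd x)) \<in> borel_measurable (R1 \<Otimes>\<^sub>M R2)"
      by (rule measurable_compose[OF d2 h])
    from R2.nn_integral_fst[OF this]
    have "(\<integral>\<^sup>+x. h (?o, fst x, snd x) \<partial>(R1 \<Otimes>\<^sub>M R2)) = (\<integral>\<^sup>+a. (\<integral>\<^sup>+b. h (?o, a, b) \<partial>R2) \<partial>R1)"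
      by simp
    then have 2: "(\<integral>\<^sup>+z. h z \<partial>scale_measure c (distr (R1 \<Otimes>\<^sub>M R2) ?N (\<lambda>x. (?o, fst x, snd x))))
      = c * (\<integral>\<^sup>+a. (\<integral>\<^sup>+b. h (?o, a, b) \<partial>R2) \<partial>R1)"
      using nn_integral_scale_measure[of h "distr (R1 \<Otimes>\<^sub>M R2) ?N (\<lambda>x. (?o, fst x, snd x))" c]
        nn_integral_distr[OF d2, of h] h by simp
    have 1: "(\<integral>\<^sup>+z. h z \<partial>distr \<kappa> ?N (\<lambda>\<theta>. (\<theta>, ?o, ?o))) = (\<integral>\<^sup>+\<theta>. h (\<theta>, ?o, ?o) \<partial>\<kappa>)"
      by (rule nn_integral_distr[OF d1]) (use h in simp)
    show ?thesis
      unfolding T_def 1[symmetric] 2[symmetric] by (rule nn_integral_plus_measure) (use h in simp_all)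
  qed
  have addm: "(\<lambda>z. add_config (fst z) (fst (snd z))) \<in> measurable ?N ?C"
    "(\<lambda>z. add_config (fst z) (snd (snd z))) \<in> measurable ?N ?C"
    by measurable
  have addmT: "(\<lambda>z. add_config (fst z) (fst (snd z))) \<in> measurable T ?C"
    "(\<lambda>z. add_config (fst z) (snd (snd z))) \<in> measurable T ?C"
    unfolding measurable_cong_sets[OF sT refl] by (fact addm)+
  have int1: "(\<integral>\<^sup>+z. h (add_config (fst z) (fst (snd z))) \<partial>T) = (\<integral>\<^sup>+\<phi>. h \<phi> \<partial>P)"
    if h: "h \<in> borel_measurable ?C" for h
  proof -
    have hR: "h \<in> borel_measurable R1" "h \<in> borel_measurable \<kappa>"
      using h sR \<kappa>(1) by (auto cong: measurable_cong_sets)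
    have "(\<integral>\<^sup>+z. h (add_config (fst z) (fst (snd z))) \<partial>T)
      = (\<integral>\<^sup>+\<theta>. h (add_config \<theta> ?o) \<partial>\<kappa>) + c * (\<integral>\<^sup>+a. (\<integral>\<^sup>+b. h (add_config ?o a) \<partial>R2) \<partial>R1)"
      by (subst int) (use measurable_compose[OF addm(1) h] in auto)
    also have "(\<integral>\<^sup>+\<theta>. h (add_config \<theta> ?o) \<partial>\<kappa>) = (\<integral>\<^sup>+\<theta>. h \<theta> \<partial>\<kappa>)"
      by (intro nn_integral_cong) (simp add: add_config_null sp spR)
    also have "(\<integral>\<^sup>+a. (\<integral>\<^sup>+b. h (add_config ?o a) \<partial>R2) \<partial>R1) = (\<integral>\<^sup>+a. (1 - t) * h a \<partial>R1)"
      by (intro nn_integral_cong) (simp add: add_config_null spR tot mult.commute)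
    also have "\<dots> = (1 - t) * (\<integral>\<^sup>+a. h a \<partial>R1)" by (rule nn_integral_cmult[OF hR(1)])
    also have "c * \<dots> = (\<integral>\<^sup>+a. h a \<partial>R1)" by (rule cR[OF spR(1) tot(1)])
    also have "(\<integral>\<^sup>+\<theta>. h \<theta> \<partial>\<kappa>) + (\<integral>\<^sup>+a. h a \<partial>R1) = (\<integral>\<^sup>+\<phi>. h \<phi> \<partial>P)"
      unfolding P_eq[symmetric] using sR \<kappa> hR by (subst nn_integral_plus_measure) auto
    finally show ?thesis .
  qed
  have int2: "(\<integral>\<^sup>+z. h (add_config (fst z) (snd (snd z))) \<partial>T) = (\<integral>\<^sup>+\<phi>. h \<phi> \<partial>Q)"
    if h: "h \<in> borel_measurable ?C" for h
  proof -
    have hR: "h \<in> borel_measurable R2" "h \<in> borel_measurable \<kappa>"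
      using h sR \<kappa>(1) by (auto cong: measurable_cong_sets)
    have "(\<integral>\<^sup>+z. h (add_config (fst z) (snd (snd z))) \<partial>T)
      = (\<integral>\<^sup>+\<theta>. h (add_config \<theta> ?o) \<partial>\<kappa>) + c * (\<integral>\<^sup>+a. (\<integral>\<^sup>+b. h (add_config ?o b) \<partial>R2) \<partial>R1)"
      by (subst int) (use measurable_compose[OF addm(2) h] in auto)
    also have "(\<integral>\<^sup>+\<theta>. h (add_config \<theta> ?o) \<partial>\<kappa>) = (\<integral>\<^sup>+\<theta>. h \<theta> \<partial>\<kappa>)"
      by (intro nn_integral_cong) (simp add: add_config_null sp spR)
    also have "(\<integral>\<^sup>+b. h (add_config ?o b) \<partial>R2) = (\<integral>\<^sup>+b. h b \<partial>R2)"
      by (intro nn_integral_cong) (simp add: add_config_null sp spR)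
    also have "c * (\<integral>\<^sup>+a. (\<integral>\<^sup>+b. h b \<partial>R2) \<partial>R1) = (\<integral>\<^sup>+b. h b \<partial>R2)"
      using cR[OF spR(2) tot(2), of h] by (simp add: spR tot mult.commute[of _ "1 - t"])
    also have "(\<integral>\<^sup>+\<theta>. h \<theta> \<partial>\<kappa>) + (\<integral>\<^sup>+b. h b \<partial>R2) = (\<integral>\<^sup>+\<phi>. h \<phi> \<partial>Q)"
      unfolding Q_eq[symmetric] using sR \<kappa> hR by (subst nn_integral_plus_measure) auto
    finally show ?thesis .
  qed
  have eq: "distr T ?C f = R" if R: "sets R = sets ?C" and f: "f \<in> measurable T ?C"
    and i: "\<And>h. h \<in> borel_measurable ?C \<Longrightarrow> (\<integral>\<^sup>+z. h (f z) \<partial>T) = (\<integral>\<^sup>+\<phi>. h \<phi> \<partial>R)" for f R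
  proof (rule measure_eqI)
    fix B assume "B \<in> sets (distr T ?C f)"
    then have B: "B \<in> sets ?C" by simp
    have "emeasure (distr T ?C f) B = (\<integral>\<^sup>+\<phi>. indicator B \<phi> \<partial>distr T ?C f)" using B by simp
    also have "\<dots> = (\<integral>\<^sup>+z. indicator B (f z) \<partial>T)" by (rule nn_integral_distr[OF f]) (use B in simp)
    also have "\<dots> = (\<integral>\<^sup>+\<phi>. indicator B \<phi> \<partial>R)" by (rule i) (use B in simp)
    also have "\<dots> = emeasure R B" using B R by (intro nn_integral_indicator) simp
    finally show "emeasure (distr T ?C f) B = emeasure R B" .
  qed (use R in simp)
  have D1: "distr T ?C (\<lambda>z. add_config (fst z) (fst (snd z))) = P"
    by (rule eq[OF P(2) addmT(1) int1])
  have D2: "distr T ?C (\<lambda>z. add_config (fst z) (snd (snd z))) = Q"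
    by (rule eq[OF Q(2) addmT(2) int2])
  have prT: "prob_space T"
    by (rule prob_space_distrD[OF addmT(1)]) (simp only: D1 P(1))
  have m [measurable]: "?m \<in> borel_measurable ?C" by (rule measurable_emeasure_config) simp
  have mR: "?m \<in> borel_measurable R1" "?m \<in> borel_measurable R2" "?m \<in> borel_measurable \<kappa>"
    using m sR \<kappa>(1) by (auto cong: measurable_cong_sets)
  have "(\<integral>\<^sup>+z. ?m (fst (snd z)) + ?m (snd (snd z)) \<partial>T)
    = c * (\<integral>\<^sup>+a. (\<integral>\<^sup>+b. ?m a + ?m b \<partial>R2) \<partial>R1)"
    by (subst int) auto
  also have "(\<integral>\<^sup>+a. (\<integral>\<^sup>+b. ?m a + ?m b \<partial>R2) \<partial>R1)
    = (\<integral>\<^sup>+a. (1 - t) * ?m a + (\<integral>\<^sup>+b. ?m b \<partial>R2) \<partial>R1)"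
  proof (rule nn_integral_cong)
    fix a
    have "(\<integral>\<^sup>+b. ?m a + ?m b \<partial>R2) = (\<integral>\<^sup>+b. ?m a \<partial>R2) + (\<integral>\<^sup>+b. ?m b \<partial>R2)"
      by (rule nn_integral_add[OF borel_measurable_const mR(2)])
    also have "(\<integral>\<^sup>+b. ?m a \<partial>R2) = (1 - t) * ?m a"
      by (simp only: nn_integral_const spR tot mult.commute)
    finally show "(\<integral>\<^sup>+b. ?m a + ?m b \<partial>R2) = (1 - t) * ?m a + (\<integral>\<^sup>+b. ?m b \<partial>R2)" .
  qed
  also have "\<dots> = (\<integral>\<^sup>+a. (1 - t) * ?m a \<partial>R1) + (\<integral>\<^sup>+a. (\<integral>\<^sup>+b. ?m b \<partial>R2) \<partial>R1)"
    by (rule nn_integral_add[OF borel_measurable_times_ennreal[OF borel_measurable_const mR(1)] borel_measurable_const])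
  also have "(\<integral>\<^sup>+a. (1 - t) * ?m a \<partial>R1) = (1 - t) * (\<integral>\<^sup>+a. ?m a \<partial>R1)"
    by (rule nn_integral_cmult[OF mR(1)])
  also have "(\<integral>\<^sup>+a. (\<integral>\<^sup>+b. ?m b \<partial>R2) \<partial>R1) = (1 - t) * (\<integral>\<^sup>+b. ?m b \<partial>R2)"
    by (simp only: nn_integral_const spR tot mult.commute)
  also have "c * ((1 - t) * (\<integral>\<^sup>+a. ?m a \<partial>R1) + (1 - t) * (\<integral>\<^sup>+b. ?m b \<partial>R2))
      = (\<integral>\<^sup>+a. ?m a \<partial>R1) + (\<integral>\<^sup>+b. ?m b \<partial>R2)"
    unfolding distrib_left cR[OF spR(1) tot(1)] cR[OF spR(2) tot(2)] ..
  finally have cost: "(\<integral>\<^sup>+z. ?m (fst (snd z)) + ?m (snd (snd z)) \<partial>T) = (\<integral>\<^sup>+a. ?m a \<partial>R1) + (\<integral>\<^sup>+b. ?m b \<partial>R2)" .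
  have "(\<integral>\<^sup>+\<phi>. ?m \<phi> \<partial>P) = (\<integral>\<^sup>+\<theta>. ?m \<theta> \<partial>\<kappa>) + (\<integral>\<^sup>+a. ?m a \<partial>R1)"
    "(\<integral>\<^sup>+\<phi>. ?m \<phi> \<partial>Q) = (\<integral>\<^sup>+\<theta>. ?m \<theta> \<partial>\<kappa>) + (\<integral>\<^sup>+b. ?m b \<partial>R2)"
    unfolding P_eq[symmetric] Q_eq[symmetric]
    using nn_integral_plus_measure[OF _ mR(3), of R1] nn_integral_plus_measure[OF _ mR(3), of R2] sR \<kappa>(1)
    by (simp_all only: simp_thms)
  \<comment> \<open>The relation is stated by addition: the means may be infinite here, and a
    difference in \<open>ennreal\<close> would then lose information.\<close>
  then have "(\<integral>\<^sup>+z. ?m (fst (snd z)) + ?m (snd (snd z)) \<partial>T) + 2 * (\<integral>\<^sup>+\<theta>. ?m \<theta> \<partial>\<kappa>)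
      = (\<integral>\<^sup>+\<phi>. ?m \<phi> \<partial>P) + (\<integral>\<^sup>+\<phi>. ?m \<phi> \<partial>Q)"
    unfolding cost by (simp add: mult_2 ac_simps)
  then show ?thesis using prT sT D1 D2 by blast
qed

text \<open>The hypothesis \<open>one\<close> is what weak repulsion yields, weakened from the
  intensity of the process to the smaller measure \<open>\<mu>\<close>. In the conclusion the mass
  of \<open>\<mu>\<close> stands on the left, so that the bounds for several processes can be added
  up before anything is cancelled.\<close>

lemma repulsive_poisson_coupling:
  fixes P :: "'a measure measure" and \<mu> :: "'a measure"
  assumes P: "prob_space P" "sets P = sets config_space"
    and \<mu>: "finite_measure \<mu>" "sets \<mu> = sets borel"
    and one: "\<And>A. A \<in> sets borel \<Longrightarrow> emeasure P {\<phi> \<in> configs. emeasure \<phi> UNIV = 0} * emeasure \<mu> A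
      \<le> (\<integral>\<^sup>+\<phi>. (if emeasure \<phi> UNIV = 1 then emeasure \<phi> A else 0) \<partial>P)"
    and le: "emeasure \<mu> UNIV \<le> (\<integral>\<^sup>+\<phi>. emeasure \<phi> UNIV \<partial>P)"
    and fin: "(\<integral>\<^sup>+\<phi>. emeasure \<phi> UNIV \<partial>P) < top"
  shows "\<exists>T. prob_space T \<and> sets T = sets (config_space \<Otimes>\<^sub>M config_space \<Otimes>\<^sub>M config_space) \<and>
    distr T config_space (\<lambda>z. add_config (fst z) (fst (snd z))) = P \<and>
    poisson_gf \<mu> (distr T config_space (\<lambda>z. add_config (fst z) (snd (snd z)))) \<and>
    (\<integral>\<^sup>+z. emeasure (fst (snd z)) UNIV + emeasure (snd (snd z)) UNIV \<partial>T) + emeasure \<mu> UNIV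
      \<le> (\<integral>\<^sup>+\<phi>. emeasure \<phi> UNIV \<partial>P) + 2 * (\<integral>\<^sup>+\<phi>. emeasure \<phi> UNIV \<partial>P)\<^sup>2"
proof -
  interpret P: prob_space P by fact
  interpret \<mu>: finite_measure \<mu> by fact
  let ?C = "config_space :: 'a measure measure"
  let ?o = "null_measure borel :: 'a measure"
  let ?m = "\<lambda>\<phi> :: 'a measure. emeasure \<phi> UNIV"
  have spP: "space P = configs" using sets_eq_imp_space_eq[OF P(2)] by simp
  have sp\<mu>: "space \<mu> = UNIV" using sets_eq_imp_space_eq[OF \<mu>(2)] by simp
  obtain Q where Q: "prob_space Q" "sets Q = sets config_space" "poisson_gf \<mu> Q"
    "(\<integral>\<^sup>+\<phi>. ?m \<phi> \<partial>Q) = emeasure \<mu> UNIV"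
    "\<And>B. B \<in> sets ?C \<Longrightarrow> ennreal (exp (- measure \<mu> UNIV)) *
        (indicator B ?o + emeasure \<mu> {x. return borel x \<in> B}) \<le> emeasure Q B"
    using poisson_exists[OF \<mu>] by blast
  have m: "?m \<in> borel_measurable ?C" by (rule measurable_emeasure_config) simp
  define Z where "Z = {\<phi> \<in> configs. ?m \<phi> = 0}"
  define O1 where "O1 = {\<phi> \<in> configs. ?m \<phi> = 1}"
  have "{\<phi> \<in> space ?C. ?m \<phi> = 0} \<in> sets ?C" "{\<phi> \<in> space ?C. ?m \<phi> = 1} \<in> sets ?C"
    using m by measurable
  then have Zs: "Z \<in> sets ?C" "O1 \<in> sets ?C" by (simp_all add: Z_def O1_def)
  have Z_eq: "Z = {?o}" by (auto simp: Z_def config_mass_0)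
  obtain I where I: "(\<integral>\<^sup>+\<phi>. ?m \<phi> \<partial>P) = ennreal I" "0 \<le> I"
    using fin by (cases "\<integral>\<^sup>+\<phi>. ?m \<phi> \<partial>P") auto
  define M where "M = measure \<mu> UNIV"
  have M: "emeasure \<mu> UNIV = ennreal M" "0 \<le> M" by (simp_all add: M_def \<mu>.emeasure_eq_measure)
  have MI: "M \<le> I" using le I M by simp
  define p where "p = measure P Z"
  have p: "emeasure P Z = ennreal p" "0 \<le> p" by (simp_all add: p_def P.emeasure_eq_measure)
  \<comment> \<open>\<open>p\<close> is the factor that the hypothesis \<open>one\<close> grants
    under \<open>P\<close>, and \<open>exp (- M)\<close> the one that the Poisson law grants; the
    common part can carry the smaller of the two.\<close>
  define q where "q = min p (exp (- M))"
  have q0: "0 \<le> q" using p by (simp add: q_def)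
  \<comment> \<open>Markov's inequality: a nonempty configuration has at least one point, so its
    probability is at most \<open>I\<close>.\<close>
  have "1 - I \<le> p"
  proof -
    have "1 = emeasure P (Z \<union> (configs - Z))"
      using P.emeasure_space_1 by (simp add: spP Z_def Un_Diff_cancel Un_absorb1)
    also have "\<dots> = emeasure P Z + emeasure P (configs - Z)"
      using Zs P(2) sets.top[of P] by (intro plus_emeasure[symmetric]) (auto simp: spP)
    also have "emeasure P (configs - Z) = (\<integral>\<^sup>+\<phi>. indicator (configs - Z) \<phi> \<partial>P)"
      using Zs P(2) sets.top[of P] by (intro nn_integral_indicator[symmetric]) (auto simp: spP)
    also have "\<dots> \<le> (\<integral>\<^sup>+\<phi>. ?m \<phi> \<partial>P)"
      by (intro nn_integral_mono) (auto simp: indicator_def Z_def config_ge_1)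
    finally have "ennreal 1 \<le> ennreal (p + I)" using p I by (simp add: add_left_mono)
    then show ?thesis using p I by (subst (asm) ennreal_le_iff) auto
  qed
  moreover have "1 - I \<le> exp (- M)" using exp_ge_add_one_self[of "- M"] MI by linarith
  ultimately have qI: "1 - q \<le> I" by (simp add: q_def min_def)
  define \<kappa> where "\<kappa> = scale_measure (ennreal q) (plus_measure (return ?C ?o) (distr \<mu> ?C (return borel)))"
  have s\<kappa>: "sets \<kappa> = sets ?C" by (simp add: \<kappa>_def)
  have retm: "return borel \<in> measurable \<mu> ?C"
    unfolding measurable_cong_sets[OF \<mu>(2) refl] by (rule measurable_return_config)
  have \<kappa>: "emeasure \<kappa> B = ennreal q * (indicator B ?o + emeasure \<mu> {x. return borel x \<in> B})"
    if "B \<in> sets ?C" for B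
    using that by (simp add: \<kappa>_def emeasure_plus_measure emeasure_distr[OF retm] sp\<mu> vimage_def)
  have \<kappa>Q: "emeasure \<kappa> B \<le> emeasure Q B" if B: "B \<in> sets ?C" for B
    using B by (auto simp: \<kappa> q_def M_def intro!: order_trans[OF mult_right_mono Q(5)] ennreal_leI)
  have \<kappa>P: "emeasure \<kappa> B \<le> emeasure P B" if B: "B \<in> sets ?C" for B
  proof -
    define A where "A = {x :: 'a. return borel x \<in> B}"
    have A: "A \<in> sets borel"
      using measurable_sets[OF measurable_return_config B] by (simp add: A_def vimage_def)
    have qp: "ennreal q \<le> emeasure P Z" using p by (simp add: q_def)
    \<comment> \<open>The two parts of \<open>\<kappa>\<close> are carried by the disjoint events
      \<open>Z\<close> and \<open>O1\<close>, so each is compared with \<open>P\<close> on its own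
      event. On \<open>O1\<close> configurations are identified with points, which makes the
      hypothesis \<open>one\<close> applicable.\<close>
    have "ennreal q * indicator B ?o \<le> emeasure P (B \<inter> Z)"
      using qp by (cases "?o \<in> B") (auto simp: Z_eq)
    moreover have "ennreal q * emeasure \<mu> A \<le> emeasure P (B \<inter> O1)"
    proof -
      have "ennreal q * emeasure \<mu> A \<le> emeasure P Z * emeasure \<mu> A"
        using qp by (rule mult_right_mono) simp
      also have "\<dots> \<le> (\<integral>\<^sup>+\<phi>. (if ?m \<phi> = 1 then emeasure \<phi> A else 0) \<partial>P)"
        unfolding Z_def by (rule one[OF A])
      also have "\<dots> = (\<integral>\<^sup>+\<phi>. indicator (B \<inter> O1) \<phi> \<partial>P)"
      proof (rule nn_integral_cong)
        fix \<phi> assume "\<phi> \<in> space P"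
        then have c: "\<phi> \<in> configs" by (simp add: spP)
        show "(if ?m \<phi> = 1 then emeasure \<phi> A else 0) = indicator (B \<inter> O1) \<phi>"
        proof (cases "?m \<phi> = 1")
          case True
          then obtain x where "\<phi> = return borel x" using config_mass_1[OF c] by blast
          then show ?thesis using True c A by (auto simp: A_def O1_def indicator_def)
        qed (auto simp: O1_def)
      qed
      also have "\<dots> = emeasure P (B \<inter> O1)"
        using B Zs P(2) by (intro nn_integral_indicator) auto
      finally show ?thesis .
    qed
    ultimately have "emeasure \<kappa> B \<le> emeasure P (B \<inter> Z) + emeasure P (B \<inter> O1)"
      unfolding \<kappa>[OF B] A_def[symmetric] distrib_left by (rule add_mono)
    also have "\<dots> = emeasure P ((B \<inter> Z) \<union> (B \<inter> O1))"
      using B Zs P(2) by (intro plus_emeasure) (auto simp: Z_def O1_def)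
    also have "\<dots> \<le> emeasure P B" using B P(2) by (intro emeasure_mono) auto
    finally show ?thesis .
  qed
  have \<kappa>m: "(\<integral>\<^sup>+\<theta>. ?m \<theta> \<partial>\<kappa>) = ennreal (q * M)"
  proof -
    have "(\<integral>\<^sup>+\<theta>. ?m \<theta> \<partial>plus_measure (return ?C ?o) (distr \<mu> ?C (return borel)))
      = (\<integral>\<^sup>+\<theta>. ?m \<theta> \<partial>return ?C ?o) + (\<integral>\<^sup>+\<theta>. ?m \<theta> \<partial>distr \<mu> ?C (return borel))"
      by (rule nn_integral_plus_measure) (use m in simp_all)
    also have "(\<integral>\<^sup>+\<theta>. ?m \<theta> \<partial>return ?C ?o) = 0" using nn_integral_return[of ?o ?C ?m] m by simp
    also have "(\<integral>\<^sup>+\<theta>. ?m \<theta> \<partial>distr \<mu> ?C (return borel)) = (\<integral>\<^sup>+x. ?m (return borel x) \<partial>\<mu>)"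
      by (rule nn_integral_distr[OF retm]) (use m in simp)
    also have "\<dots> = ennreal M" by (simp add: sp\<mu> M)
    finally have *: "(\<integral>\<^sup>+\<theta>. ?m \<theta> \<partial>plus_measure (return ?C ?o) (distr \<mu> ?C (return borel))) = ennreal M"
      by simp
    have "?m \<in> borel_measurable (plus_measure (return ?C ?o) (distr \<mu> ?C (return borel)))"
      using m by (subst measurable_cong_sets[OF _ refl, of _ ?C]) simp_all
    from nn_integral_scale_measure[OF this] show ?thesis
      unfolding \<kappa>_def using q0 M(2) by (simp add: * ennreal_mult)
  qed
  obtain T where T: "prob_space T" "sets T = sets (?C \<Otimes>\<^sub>M ?C \<Otimes>\<^sub>M ?C)"
    "distr T ?C (\<lambda>z. add_config (fst z) (fst (snd z))) = P"
    "distr T ?C (\<lambda>z. add_config (fst z) (snd (snd z))) = Q"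
    "(\<integral>\<^sup>+z. ?m (fst (snd z)) + ?m (snd (snd z)) \<partial>T) + 2 * (\<integral>\<^sup>+\<theta>. ?m \<theta> \<partial>\<kappa>)
      = (\<integral>\<^sup>+\<phi>. ?m \<phi> \<partial>P) + (\<integral>\<^sup>+\<phi>. ?m \<phi> \<partial>Q)"
    using common_part_coupling[OF P Q(1,2) s\<kappa> \<kappa>P \<kappa>Q] by blast
  define c where "c = (\<integral>\<^sup>+z. ?m (fst (snd z)) + ?m (snd (snd z)) \<partial>T)"
  have eq: "c + ennreal (2 * (q * M)) = ennreal (I + M)"
    using T(5) q0 M I Q(4) by (simp add: c_def \<kappa>m ennreal_mult)
  then obtain r where r: "c = ennreal r" "0 \<le> r" by (cases c) auto
  have "r + 2 * (q * M) = I + M"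
    using eq r q0 M I by (simp flip: ennreal_plus)
  moreover have "M * (1 - q) \<le> I * I"
  proof -
    have "M * (1 - q) \<le> M * I" using M qI by (intro mult_left_mono) auto
    also have "\<dots> \<le> I * I" using MI I by (intro mult_right_mono) auto
    finally show ?thesis .
  qed
  ultimately have "r + M \<le> I + 2 * I\<^sup>2" by (simp add: power2_eq_square algebra_simps)
  then have "ennreal (r + M) \<le> ennreal (I + 2 * I\<^sup>2)" by (rule ennreal_leI)
  then have "c + emeasure \<mu> UNIV \<le> (\<integral>\<^sup>+\<phi>. ?m \<phi> \<partial>P) + 2 * (\<integral>\<^sup>+\<phi>. ?m \<phi> \<partial>P)\<^sup>2"
    using r M I by (simp add: ennreal_mult ennreal_power)
  then show ?thesis using T Q(3) unfolding c_def by blast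
qed

end

section \<open>Superpositions\<close>

text \<open>The integral is a supremum over simple functions below \<open>f\<close>, and each of
  these pulls back to a function below the composition. As \<open>f\<close> is arbitrary, only this
  inequality is claimed; it is applied to \<open>Delta_TV\<close>.\<close>

lemma nn_integral_distr_le:
  assumes T: "T \<in> measurable M N"
  shows "(\<integral>\<^sup>+y. f y \<partial>distr M N T) \<le> (\<integral>\<^sup>+x. f (T x) \<partial>M)"
  unfolding nn_integral_def[of "distr M N T" f]
proof (rule SUP_least)
  fix g assume g: "g \<in> {g. simple_function (distr M N T) g \<and> g \<le> f}"
  then have m: "g \<in> borel_measurable (distr M N T)" by (intro borel_measurable_simple_function) auto
  have "integral\<^sup>S (distr M N T) g = (\<integral>\<^sup>+y. g y \<partial>distr M N T)"
    using g by (intro nn_integral_eq_simple_integral[symmetric]) auto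
  also have "\<dots> = (\<integral>\<^sup>+x. g (T x) \<partial>M)" by (rule nn_integral_distr[OF T m])
  also have "\<dots> \<le> (\<integral>\<^sup>+x. f (T x) \<partial>M)" using g by (intro nn_integral_mono) (auto simp: le_fun_def)
  finally show "integral\<^sup>S (distr M N T) g \<le> (\<integral>\<^sup>+x. f (T x) \<partial>M)" .
qed

text \<open>The common summand \<open>\<sigma>\<close> cancels in the difference. That it is finite
  comes from the definition of \<open>Delta_TV\<close>, which admits only sets of finite
  mass.\<close>

lemma Delta_TV_le:
  assumes 1: "\<And>A. A \<in> sets borel \<Longrightarrow> emeasure \<nu>1 A = \<sigma> A + \<alpha> A"
    and 2: "\<And>A. A \<in> sets borel \<Longrightarrow> emeasure \<nu>2 A = \<sigma> A + \<beta> A"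
    and le: "\<And>A. A \<in> sets borel \<Longrightarrow> \<alpha> A + \<beta> A \<le> c"
  shows "Delta_TV \<nu>1 \<nu>2 \<le> c"
  unfolding Delta_TV_def
proof (rule SUP_least, clarsimp)
  fix A :: "'a set" assume A: "A \<in> sets borel" and fin: "emeasure \<nu>1 A < top" "emeasure \<nu>2 A < top"
  have "\<sigma> A < top" "\<alpha> A < top" "\<beta> A < top" using fin 1[OF A] 2[OF A] by auto
  then obtain x y z where *: "\<sigma> A = ennreal x" "\<alpha> A = ennreal y" "\<beta> A = ennreal z" "0 \<le> x" "0 \<le> y" "0 \<le> z"
    by (metis enn2real_nonneg ennreal_enn2real)
  then have "measure \<nu>1 A = x + y" "measure \<nu>2 A = x + z"
    using 1[OF A] 2[OF A] by (simp_all add: measure_def flip: ennreal_plus)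
  then have "ennreal \<bar>measure \<nu>1 A - measure \<nu>2 A\<bar> \<le> ennreal (y + z)"
    using * by (intro ennreal_leI) auto
  also have "\<dots> = \<alpha> A + \<beta> A" using * by simp
  also have "\<dots> \<le> c" by (rule le[OF A])
  finally show "ennreal \<bar>measure \<nu>1 A - measure \<nu>2 A\<bar> \<le> c" .
qed

context sigma_compact_space
begin

text \<open>The triples are drawn independently over \<open>I\<close>, together with an independent
  configuration from \<open>Q\<close>. On the left, the independence of the \<open>\<Phi> i\<close>
  identifies the marginal; on the right, generating functions multiply and intensities add up to
  \<open>M\<close>, so \<open>poisson_gf_unique\<close> applies. Both sums contain all first
  components, and only the other points count for the distance.\<close>

lemma superposition_coupling:
  fixes \<Phi> :: "'i \<Rightarrow> 'w \<Rightarrow> 'a measure"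
    and T :: "'i \<Rightarrow> ('a measure \<times> 'a measure \<times> 'a measure) measure"
  assumes I: "finite I" "I \<noteq> {}"
    and \<Omega>: "prob_space \<Omega>" "prob_space.indep_vars \<Omega> (\<lambda>_. config_space) \<Phi> I"
    and T: "\<And>i. prob_space (T i)"
      "\<And>i. i \<in> I \<Longrightarrow> sets (T i) = sets (config_space \<Otimes>\<^sub>M config_space \<Otimes>\<^sub>M config_space)"
      "\<And>i. i \<in> I \<Longrightarrow> distr (T i) config_space (\<lambda>z. add_config (fst z) (fst (snd z))) = distr \<Omega> config_space (\<Phi> i)"
      "\<And>i. i \<in> I \<Longrightarrow> poisson_gf (\<mu> i) (distr (T i) config_space (\<lambda>z. add_config (fst z) (snd (snd z))))"
    and Q: "prob_space Q" "sets Q = sets config_space" "poisson_gf \<mu>' Q"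
    and M: "\<And>B. B \<in> rc_borel \<Longrightarrow> measure M B = (\<Sum>i\<in>I. measure (\<mu> i) B) + measure \<mu>' B"
    and P: "prob_space P" "sets P = sets config_space" "poisson_gf M P"
  shows "Delta_TV_star (distr \<Omega> config_space (\<lambda>\<omega>. superpose I (\<lambda>i. \<Phi> i \<omega>))) P
    \<le> (\<Sum>i\<in>I. \<integral>\<^sup>+z. emeasure (fst (snd z)) UNIV + emeasure (snd (snd z)) UNIV \<partial>T i)
      + (\<integral>\<^sup>+\<phi>. emeasure \<phi> UNIV \<partial>Q)"
proof -
  let ?C = "config_space :: 'a measure measure"
  let ?m = "\<lambda>\<phi> :: 'a measure. emeasure \<phi> UNIV"
  interpret \<Omega>: prob_space \<Omega> by fact
  interpret Q: prob_space Q by fact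
  interpret TT: product_prob_space T by (intro product_prob_spaceI T)
  define f where "f z = add_config (fst z) (fst (snd z))" for z :: "'a measure \<times> 'a measure \<times> 'a measure"
  define g where "g z = add_config (fst z) (snd (snd z))" for z :: "'a measure \<times> 'a measure \<times> 'a measure"
  have spQ: "space Q = configs" using sets_eq_imp_space_eq[OF Q(2)] by simp
  have spT: "space (T i) = configs \<times> configs \<times> configs" if "i \<in> I" for i
    using sets_eq_imp_space_eq[OF T(2)[OF that]] by (simp add: space_pair_measure)
  have fm: "f \<in> measurable (T i) ?C" and gm: "g \<in> measurable (T i) ?C" if "i \<in> I" for i
    unfolding f_def[abs_def] g_def[abs_def] measurable_cong_sets[OF T(2)[OF that] refl] by measurable
  have m [measurable]: "?m \<in> borel_measurable ?C" by (rule measurable_emeasure_config) simp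
  define h where "h z = ?m (fst (snd z)) + ?m (snd (snd z))" for z :: "'a measure \<times> 'a measure \<times> 'a measure"
  have hm: "h \<in> borel_measurable (T i)" if "i \<in> I" for i
    unfolding h_def[abs_def] measurable_cong_sets[OF T(2)[OF that] refl] by measurable
  define W where "W = PiM I T"
  have prW: "prob_space W" unfolding W_def by (intro prob_space_PiM T)
  have comp: "(\<lambda>\<omega>. \<omega> i) \<in> measurable W (T i)" if "i \<in> I" for i
    unfolding W_def using that by (rule measurable_component_singleton)
  have Wsp: "\<omega> i \<in> configs \<times> configs \<times> configs" if "\<omega> \<in> space W" "i \<in> I" for \<omega> i
    using measurable_space[OF comp[OF that(2)] that(1)] spT[OF that(2)] by simp
  define F where "F z = superpose I (\<lambda>i. f (fst z i))"
    for z :: "('i \<Rightarrow> 'a measure \<times> 'a measure \<times> 'a measure) \<times> 'a measure"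
  define G where "G z = add_config (superpose I (\<lambda>i. g (fst z i))) (snd z)"
    for z :: "('i \<Rightarrow> 'a measure \<times> 'a measure \<times> 'a measure) \<times> 'a measure"
  define O' where "O' = W \<Otimes>\<^sub>M Q"
  have sndm: "snd \<in> measurable O' ?C"
    using measurable_snd[of W Q] unfolding O'_def measurable_cong_sets[OF refl Q(2)] .
  have fstm: "fst \<in> measurable O' W" unfolding O'_def by (rule measurable_fst)
  have compO: "(\<lambda>z. fst z i) \<in> measurable O' (T i)" if "i \<in> I" for i
    by (rule measurable_compose[OF fstm comp[OF that]])
  have SFm: "(\<lambda>\<omega>. superpose I (\<lambda>i. f (\<omega> i))) \<in> measurable W ?C"
    by (intro measurable_superpose I(1) measurable_compose[OF comp fm])
  have SGm: "(\<lambda>\<omega>. superpose I (\<lambda>i. g (\<omega> i))) \<in> measurable W ?C"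
    by (intro measurable_superpose I(1) measurable_compose[OF comp gm])
  have Fm: "F \<in> measurable O' ?C"
    unfolding F_def[abs_def] by (rule measurable_compose[OF fstm SFm])
  have Gm: "G \<in> measurable O' ?C"
    unfolding G_def[abs_def] by (intro measurable_add_config measurable_compose[OF fstm SGm] sndm)
  have prO: "prob_space O'"
  proof -
    interpret W: prob_space W by fact
    interpret pair_prob_space W Q ..
    show ?thesis unfolding O'_def by (rule prob_space_axioms)
  qed
  have intO: "(\<integral>\<^sup>+z. k z \<partial>O') = (\<integral>\<^sup>+\<omega>. (\<integral>\<^sup>+\<phi>. k (\<omega>, \<phi>) \<partial>Q) \<partial>W)"
    if "k \<in> borel_measurable O'" for k
    using Q.nn_integral_fst[of k W] that by (simp add: O'_def)
  have marg1: "distr O' ?C F = distr \<Omega> ?C (\<lambda>\<omega>. superpose I (\<lambda>i. \<Phi> i \<omega>))"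
  proof -
    \<comment> \<open>\<open>R i\<close> is the law of \<open>\<Phi> i\<close> obtained as an image
      of \<open>T i\<close>. Both superpositions are then the same function \<open>S\<close> of a
      family with law \<open>PiM I R\<close>.\<close>
    define R where "R i = distr (T i) ?C f" for i
    have sR: "sets (R i) = sets ?C" for i by (simp add: R_def)
    have R\<Phi>: "R i = distr \<Omega> ?C (\<Phi> i)" if "i \<in> I" for i
      using T(3)[OF that] by (simp add: R_def f_def[abs_def])
    have prR: "prob_space (R i)" if "i \<in> I" for i
      unfolding R_def by (intro prob_space.prob_space_distr T fm that)
    have \<Phi>m: "\<Phi> i \<in> measurable \<Omega> ?C" if "i \<in> I" for i
      using \<Omega>(2) that by (auto simp: \<Omega>.indep_vars_def)
    have fmR: "f \<in> measurable (T i) (R i)" if "i \<in> I" for i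
      using fm[OF that] measurable_cong_sets[OF refl sR] by blast
    have 1: "distr W (PiM I R) (compose I f) = PiM I R"
    proof -
      have "distr W (PiM I R) (compose I f) = PiM I (\<lambda>i. distr (T i) (R i) f)"
        unfolding W_def by (rule distr_PiM_finite_prob_space'[OF I(1) T(1) prR fmR])
      also have "\<dots> = PiM I R"
        by (intro PiM_cong refl) (auto simp: R_def intro!: distr_cong)
      finally show ?thesis .
    qed
    have 2: "distr \<Omega> (PiM I R) (\<lambda>\<omega>. \<lambda>i\<in>I. \<Phi> i \<omega>) = PiM I R"
    proof -
      have "distr \<Omega> (PiM I (\<lambda>_. ?C)) (\<lambda>\<omega>. \<lambda>i\<in>I. \<Phi> i \<omega>) = PiM I (\<lambda>i. distr \<Omega> ?C (\<Phi> i))"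
        using \<Omega>.indep_vars_iff_distr_eq_PiM'[OF I(2), where M'="\<lambda>_. ?C" and X=\<Phi>] \<Omega>(2) \<Phi>m by blast
      also have "\<dots> = PiM I R" by (intro PiM_cong refl) (simp add: R\<Phi>)
      finally have "distr \<Omega> (PiM I (\<lambda>_. ?C)) (\<lambda>\<omega>. \<lambda>i\<in>I. \<Phi> i \<omega>) = PiM I R" .
      moreover have "distr \<Omega> (PiM I R) (\<lambda>\<omega>. \<lambda>i\<in>I. \<Phi> i \<omega>) = distr \<Omega> (PiM I (\<lambda>_. ?C)) (\<lambda>\<omega>. \<lambda>i\<in>I. \<Phi> i \<omega>)"
        by (intro distr_cong refl sets_PiM_cong sR)
      ultimately show ?thesis by simp
    qed
    define S where "S x = superpose I x" for x :: "'i \<Rightarrow> 'a measure"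
    have "(\<lambda>x. x i) \<in> measurable (PiM I R) ?C" if "i \<in> I" for i
      using measurable_component_singleton[OF that, of R] measurable_cong_sets[OF refl sR] by blast
    then have Sm: "S \<in> measurable (PiM I R) ?C"
      unfolding S_def[abs_def] by (intro measurable_superpose I(1))
    have cm: "compose I f \<in> measurable W (PiM I R)"
      unfolding compose_def[abs_def] by (intro measurable_restrict measurable_compose[OF comp fmR])
    have rm: "(\<lambda>\<omega>. \<lambda>i\<in>I. \<Phi> i \<omega>) \<in> measurable \<Omega> (PiM I R)"
      using \<Phi>m measurable_cong_sets[OF refl sR] by (intro measurable_restrict) blast
    have "distr O' ?C F = distr (distr O' W fst) ?C (\<lambda>\<omega>. superpose I (\<lambda>i. f (\<omega> i)))"
      by (subst distr_distr[OF SFm fstm]) (simp add: F_def[abs_def] comp_def)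
    also have "distr O' W fst = W" unfolding O'_def by (rule Q.distr_pair_fst)
    also have "distr W ?C (\<lambda>\<omega>. superpose I (\<lambda>i. f (\<omega> i))) = distr (distr W (PiM I R) (compose I f)) ?C S"
      by (subst distr_distr[OF Sm cm]) (auto simp: S_def compose_def intro!: distr_cong superpose_cong)
    also have "\<dots> = distr (distr \<Omega> (PiM I R) (\<lambda>\<omega>. \<lambda>i\<in>I. \<Phi> i \<omega>)) ?C S" unfolding 1 2 ..
    also have "\<dots> = distr \<Omega> ?C (\<lambda>\<omega>. superpose I (\<lambda>i. \<Phi> i \<omega>))"
      by (subst distr_distr[OF Sm rm]) (auto simp: S_def intro!: distr_cong superpose_cong)
    finally show ?thesis .
  qed
  have gf: "poisson_gf M (distr O' ?C G)"
    unfolding poisson_gf_def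
  proof (intro allI impI)
    fix \<B> :: "'a set set" and s :: "'a set \<Rightarrow> real"
    assume \<B>: "finite \<B>" "\<B> \<subseteq> rc_borel" "disjoint \<B>" and s: "\<forall>B. s B \<in> {0..1}"
    let ?g = "\<lambda>\<phi>. ennreal (gen_prod s \<B> \<phi>)"
    have gpm: "?g \<in> borel_measurable ?C"
      using measurable_gen_prod[OF \<B>(2), of s] by simp
    have gp0: "0 \<le> gen_prod s \<B> \<phi>" for \<phi> using gen_prod_bounds(1) s by blast
    have iT: "(\<integral>\<^sup>+z. ?g (g z) \<partial>T i) = ennreal (exp (- (\<Sum>B\<in>\<B>. (1 - s B) * measure (\<mu> i) B)))" if "i \<in> I" for i
    proof -
      have "(\<integral>\<^sup>+z. ?g (g z) \<partial>T i) = (\<integral>\<^sup>+\<phi>. ?g \<phi> \<partial>distr (T i) ?C g)"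
        using gpm by (intro nn_integral_distr[symmetric] gm that) simp
      then show ?thesis
        using T(4)[OF that, folded g_def] \<B> s unfolding poisson_gf_def by simp
    qed
    have iQ: "(\<integral>\<^sup>+\<phi>. ?g \<phi> \<partial>Q) = ennreal (exp (- (\<Sum>B\<in>\<B>. (1 - s B) * measure \<mu>' B)))"
      using Q(3) \<B> s unfolding poisson_gf_def by simp
    have gpQ: "?g \<in> borel_measurable Q"
      using gpm measurable_cong_sets[OF Q(2) refl] by blast
    have mi: "(\<lambda>\<omega>. ?g (g (\<omega> i))) \<in> borel_measurable W" if "i \<in> I" for i
      by (rule measurable_compose[OF comp[OF that] measurable_compose[OF gm[OF that] gpm]])
    have "(\<integral>\<^sup>+\<phi>. ?g \<phi> \<partial>distr O' ?C G) = (\<integral>\<^sup>+z. ?g (G z) \<partial>O')"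
      using gpm by (intro nn_integral_distr Gm) simp
    also have "\<dots> = (\<integral>\<^sup>+\<omega>. (\<integral>\<^sup>+\<phi>. ?g (G (\<omega>, \<phi>)) \<partial>Q) \<partial>W)"
      by (rule intO) (rule measurable_compose[OF Gm gpm])
    also have "\<dots> = (\<integral>\<^sup>+\<omega>. (\<integral>\<^sup>+\<phi>. (\<Prod>i\<in>I. ?g (g (\<omega> i))) * ?g \<phi> \<partial>Q) \<partial>W)"
    proof (intro nn_integral_cong)
      fix \<omega> \<phi> assume \<omega>: "\<omega> \<in> space W" and \<phi>: "\<phi> \<in> space Q"
      have "g (\<omega> i) \<in> configs" if "i \<in> I" for i
        using Wsp[OF \<omega> that] by (auto simp: g_def intro!: add_config_config)
      then have "gen_prod s \<B> (G (\<omega>, \<phi>)) = (\<Prod>i\<in>I. gen_prod s \<B> (g (\<omega> i))) * gen_prod s \<B> \<phi>"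
        using \<phi> \<B>(2) I(1)
        by (simp add: G_def gen_prod_add_config superpose_config spQ gen_prod_superpose)
      then show "?g (G (\<omega>, \<phi>)) = (\<Prod>i\<in>I. ?g (g (\<omega> i))) * ?g \<phi>"
        using gp0 by (simp add: ennreal_mult prod_nonneg prod_ennreal)
    qed
    also have "\<dots> = (\<integral>\<^sup>+\<omega>. (\<Prod>i\<in>I. ?g (g (\<omega> i))) * (\<integral>\<^sup>+\<phi>. ?g \<phi> \<partial>Q) \<partial>W)"
      by (intro nn_integral_cong nn_integral_cmult gpQ)
    also have "\<dots> = (\<integral>\<^sup>+\<omega>. (\<Prod>i\<in>I. ?g (g (\<omega> i))) \<partial>W) * (\<integral>\<^sup>+\<phi>. ?g \<phi> \<partial>Q)"
      by (intro nn_integral_multc borel_measurable_prod_ennreal mi)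
    also have "(\<integral>\<^sup>+\<omega>. (\<Prod>i\<in>I. ?g (g (\<omega> i))) \<partial>W) = (\<Prod>i\<in>I. \<integral>\<^sup>+z. ?g (g z) \<partial>T i)"
      unfolding W_def
      by (rule TT.product_nn_integral_prod[OF I(1), of "\<lambda>i z. ?g (g z)"]) (rule measurable_compose[OF gm gpm])
    also have "\<dots> * (\<integral>\<^sup>+\<phi>. ?g \<phi> \<partial>Q) = ennreal ((\<Prod>i\<in>I. exp (- (\<Sum>B\<in>\<B>. (1 - s B) * measure (\<mu> i) B)))
        * exp (- (\<Sum>B\<in>\<B>. (1 - s B) * measure \<mu>' B)))"
      by (simp add: iT iQ prod_ennreal ennreal_mult prod_nonneg)
    also have "(\<Prod>i\<in>I. exp (- (\<Sum>B\<in>\<B>. (1 - s B) * measure (\<mu> i) B))) * exp (- (\<Sum>B\<in>\<B>. (1 - s B) * measure \<mu>' B))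
      = exp (- (\<Sum>B\<in>\<B>. (1 - s B) * measure M B))"
    proof -
      have "(\<Sum>B\<in>\<B>. (1 - s B) * measure M B)
        = (\<Sum>B\<in>\<B>. \<Sum>i\<in>I. (1 - s B) * measure (\<mu> i) B) + (\<Sum>B\<in>\<B>. (1 - s B) * measure \<mu>' B)"
        unfolding sum.distrib[symmetric] using \<B>(2)
        by (intro sum.cong) (auto simp: M subset_iff distrib_left sum_distrib_left)
      also have "(\<Sum>B\<in>\<B>. \<Sum>i\<in>I. (1 - s B) * measure (\<mu> i) B) = (\<Sum>i\<in>I. \<Sum>B\<in>\<B>. (1 - s B) * measure (\<mu> i) B)"
        by (rule sum.swap)
      finally show ?thesis using I(1) by (simp add: exp_sum[symmetric] sum_negf exp_add[symmetric])
    qed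
    finally show "(\<integral>\<^sup>+\<phi>. ?g \<phi> \<partial>distr O' ?C G) = ennreal (exp (- (\<Sum>B\<in>\<B>. (1 - s B) * measure M B)))" .
  qed
  have marg2: "distr O' ?C G = P"
    by (rule poisson_gf_unique[OF _ _ gf P]) (auto intro: prob_space.prob_space_distr[OF prO Gm])
  define C where "C = distr O' (?C \<Otimes>\<^sub>M ?C) (\<lambda>z. (F z, G z))"
  have FGm: "(\<lambda>z. (F z, G z)) \<in> measurable O' (?C \<Otimes>\<^sub>M ?C)"
    by (intro measurable_Pair Fm Gm)
  have "C \<in> couplings (distr \<Omega> ?C (\<lambda>\<omega>. superpose I (\<lambda>i. \<Phi> i \<omega>))) P"
  proof -
    have "distr C ?C fst = distr O' ?C F" "distr C ?C snd = distr O' ?C G"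
      unfolding C_def by (subst distr_distr[OF _ FGm]; simp add: comp_def)+
    then show ?thesis using marg1 marg2 by (simp add: couplings_def C_def)
  qed
  then have "Delta_TV_star (distr \<Omega> ?C (\<lambda>\<omega>. superpose I (\<lambda>i. \<Phi> i \<omega>))) P \<le> (\<integral>\<^sup>+z. Delta_TV (fst z) (snd z) \<partial>C)"
    unfolding Delta_TV_star_def by (rule INF_lower)
  also have "\<dots> \<le> (\<integral>\<^sup>+z. Delta_TV (F z) (G z) \<partial>O')"
    unfolding C_def using nn_integral_distr_le[OF FGm, of "\<lambda>z. Delta_TV (fst z) (snd z)"] by simp
  also have "\<dots> \<le> (\<integral>\<^sup>+z. (\<Sum>i\<in>I. h (fst z i)) + ?m (snd z) \<partial>O')"
  proof (rule nn_integral_mono)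
    fix z assume "z \<in> space O'"
    then have z: "fst z \<in> space W" "snd z \<in> configs" by (auto simp: O'_def space_pair_measure spQ)
    note zi = Wsp[OF z(1)]
    have zi': "fst (fst z i) \<in> configs" "fst (snd (fst z i)) \<in> configs" "snd (snd (fst z i)) \<in> configs"
      if "i \<in> I" for i using zi[OF that] by auto
    have fg: "f (fst z i) \<in> configs" "g (fst z i) \<in> configs" if "i \<in> I" for i
      unfolding f_def g_def using zi'[OF that] by (auto intro!: add_config_config)
    \<comment> \<open>\<open>?\<sigma>\<close> collects the shared points; \<open>?\<alpha>\<close>
      and \<open>?\<beta>\<close> are what each sum has beyond them, the additional Poisson process
      appearing on one side only.\<close>
    let ?\<sigma> = "\<lambda>A. \<Sum>i\<in>I. emeasure (fst (fst z i)) A"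
    let ?\<alpha> = "\<lambda>A. \<Sum>i\<in>I. emeasure (fst (snd (fst z i))) A"
    let ?\<beta> = "\<lambda>A. (\<Sum>i\<in>I. emeasure (snd (snd (fst z i))) A) + emeasure (snd z) A"
    show "Delta_TV (F z) (G z) \<le> (\<Sum>i\<in>I. h (fst z i)) + ?m (snd z)"
    proof (rule Delta_TV_le[where \<sigma>="?\<sigma>" and \<alpha>="?\<alpha>" and \<beta>="?\<beta>"])
      fix A :: "'a set"
      have "emeasure (F z) A = (\<Sum>i\<in>I. emeasure (f (fst z i)) A)"
        unfolding F_def using fg by (intro emeasure_superpose) (auto simp: sets_config)
      also have "\<dots> = (\<Sum>i\<in>I. emeasure (fst (fst z i)) A + emeasure (fst (snd (fst z i))) A)"
        unfolding f_def using zi' by (intro sum.cong refl emeasure_add_config) auto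
      finally show "emeasure (F z) A = ?\<sigma> A + ?\<alpha> A" by (simp add: sum.distrib)
      have "emeasure (G z) A = emeasure (superpose I (\<lambda>i. g (fst z i))) A + emeasure (snd z) A"
        unfolding G_def using fg z I(1) by (intro emeasure_add_config superpose_config) auto
      also have "emeasure (superpose I (\<lambda>i. g (fst z i))) A = (\<Sum>i\<in>I. emeasure (g (fst z i)) A)"
        using fg by (intro emeasure_superpose) (auto simp: sets_config)
      also have "\<dots> = (\<Sum>i\<in>I. emeasure (fst (fst z i)) A + emeasure (snd (snd (fst z i))) A)"
        unfolding g_def using zi' by (intro sum.cong refl emeasure_add_config) auto
      finally show "emeasure (G z) A = ?\<sigma> A + ?\<beta> A" by (simp add: sum.distrib ac_simps)
      have le: "emeasure \<phi> A \<le> ?m \<phi>" if "\<phi> \<in> configs" for \<phi>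
        using emeasure_space[of \<phi> A] space_config[OF that] by simp
      have "?\<alpha> A + ?\<beta> A \<le> (\<Sum>i\<in>I. ?m (fst (snd (fst z i)))) + ((\<Sum>i\<in>I. ?m (snd (snd (fst z i)))) + ?m (snd z))"
        using zi' z(2) by (intro add_mono sum_mono le) auto
      also have "\<dots> = (\<Sum>i\<in>I. h (fst z i)) + ?m (snd z)" by (simp add: h_def sum.distrib ac_simps)
      finally show "?\<alpha> A + ?\<beta> A \<le> (\<Sum>i\<in>I. h (fst z i)) + ?m (snd z)" .
    qed
  qed
  also have "\<dots> = (\<Sum>i\<in>I. \<integral>\<^sup>+z. h (fst z i) \<partial>O') + (\<integral>\<^sup>+z. ?m (snd z) \<partial>O')"
  proof -
    have 1: "(\<lambda>z. h (fst z i)) \<in> borel_measurable O'" if "i \<in> I" for i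
      by (rule measurable_compose[OF compO[OF that] hm[OF that]])
    have 2: "(\<lambda>z. ?m (snd z)) \<in> borel_measurable O'"
      by (rule measurable_compose[OF sndm m])
    have "(\<integral>\<^sup>+z. (\<Sum>i\<in>I. h (fst z i)) + ?m (snd z) \<partial>O')
      = (\<integral>\<^sup>+z. (\<Sum>i\<in>I. h (fst z i)) \<partial>O') + (\<integral>\<^sup>+z. ?m (snd z) \<partial>O')"
      by (intro nn_integral_add borel_measurable_sum 1 2)
    also have "(\<integral>\<^sup>+z. (\<Sum>i\<in>I. h (fst z i)) \<partial>O') = (\<Sum>i\<in>I. \<integral>\<^sup>+z. h (fst z i) \<partial>O')"
      by (intro nn_integral_sum 1)
    finally show ?thesis .
  qed
  also have "(\<integral>\<^sup>+z. ?m (snd z) \<partial>O') = (\<integral>\<^sup>+\<phi>. ?m \<phi> \<partial>Q)"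
    by (subst intO) (auto simp: prob_space.emeasure_space_1[OF prW] intro: measurable_compose[OF sndm m])
  also have "(\<Sum>i\<in>I. \<integral>\<^sup>+z. h (fst z i) \<partial>O') = (\<Sum>i\<in>I. \<integral>\<^sup>+z. h z \<partial>T i)"
  proof (rule sum.cong[OF refl])
    fix i assume i: "i \<in> I"
    have "distr O' (T i) (\<lambda>z. fst z i) = distr (distr O' W fst) (T i) (\<lambda>\<omega>. \<omega> i)"
      by (subst distr_distr[OF comp[OF i] fstm]) (simp add: comp_def)
    also have "distr O' W fst = W" unfolding O'_def by (rule Q.distr_pair_fst)
    also have "distr W (T i) (\<lambda>\<omega>. \<omega> i) = T i" unfolding W_def by (rule distr_PiM_component[OF T(1) i])
    finally show "(\<integral>\<^sup>+z. h (fst z i) \<partial>O') = (\<integral>\<^sup>+z. h z \<partial>T i)"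
      using nn_integral_distr[OF compO[OF i], of h] hm[OF i] by simp
  qed
  finally show ?thesis unfolding h_def .
qed

end

section \<open>Splitting the Poisson intensity and summing the costs\<close>

theorem theorem5p7:
  fixes l :: "'a::metric_space measure"
    and \<Omega> :: "'w measure" and \<Omega>' :: "'v measure"
    and n :: nat
    and \<Phi> :: "nat \<Rightarrow> 'w \<Rightarrow> 'a measure"
    and \<rho> :: "nat \<Rightarrow> 'a measure \<Rightarrow> real"
    and \<zeta> :: "'v \<Rightarrow> 'a measure"
    and m :: "'a \<Rightarrow> real"
  assumes "locally_compact_space (euclidean :: 'a topology)"
    and "radon_measure l"
    and "n \<ge> 1"
    and "prob_space \<Omega>"
    and "prob_space.indep_vars \<Omega> (\<lambda>_. config_space) \<Phi> {1..n}"
    and "\<And>i. i \<in> {1..n} \<Longrightarrow> finite_process (distr \<Omega> config_space (\<Phi> i))"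
    and "\<And>i. i \<in> {1..n} \<Longrightarrow> weakly_repulsive l (distr \<Omega> config_space (\<Phi> i))"
    and "\<And>i. i \<in> {1..n} \<Longrightarrow> correlation_function l (distr \<Omega> config_space (\<Phi> i)) (\<rho> i)"
    and "m \<in> borel_measurable borel" and "\<And>x. 0 \<le> m x"
    and "prob_space \<Omega>'"
    and "\<zeta> \<in> measurable \<Omega>' config_space"
    and "poisson_process (density l (\<lambda>x. ennreal (m x))) (distr \<Omega>' config_space \<zeta>)"
  shows "Delta_TV_star (distr \<Omega> config_space (\<lambda>\<omega>. superpose {1..n} (\<lambda>i. \<Phi> i \<omega>)))
                       (distr \<Omega>' config_space \<zeta>)
    \<le> (\<integral>\<^sup>+x. ennreal \<bar>(\<Sum>i\<in>{1..n}. \<rho> i (return borel x)) - m x\<bar> \<partial>l)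
       + 2 * of_nat n * (MAX i\<in>{1..n}. \<integral>\<^sup>+x. ennreal (\<rho> i (return borel x)) \<partial>l)\<^sup>2"
proof -
  let ?C = "config_space :: 'a measure measure"
  let ?m = "\<lambda>\<phi> :: 'a measure. emeasure \<phi> UNIV"
  define I where "I = {1..n}"
  have I: "finite I" "I \<noteq> {}" "1 \<in> I" using assms(3) by (auto simp: I_def)
  interpret \<Omega>: prob_space \<Omega> by fact
  have sl: "sets l = sets borel" using assms(2) by (simp add: radon_measure_def)
  have lm: "borel_measurable l = (borel_measurable borel :: ('a \<Rightarrow> ennreal) set)"
    by (rule measurable_cong_sets[OF sl refl])
  define P where "P i = distr \<Omega> ?C (\<Phi> i)" for i
  have sP: "sets (P i) = sets ?C" for i by (simp add: P_def)
  have prP: "prob_space (P i)" if "i \<in> I" for i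
    using assms(5) that by (auto simp: P_def I_def \<Omega>.indep_vars_def intro!: \<Omega>.prob_space_distr)
  have fpP: "finite_process (P i)" if "i \<in> I" for i using assms(6) that by (simp add: P_def I_def)
  have wrP: "weakly_repulsive l (P i)" if "i \<in> I" for i using assms(7) that by (simp add: P_def I_def)
  have cfP: "correlation_function l (P i) (\<rho> i)" if "i \<in> I" for i
    using assms(8) that by (simp add: P_def I_def)
  \<comment> \<open>The sigma-compactness is read off from the process with index 1, which exists
    because \<open>n \<ge> 1\<close>.\<close>
  obtain K :: "nat \<Rightarrow> 'a set" where K: "\<forall>n. compact (K n)" "(\<Union>n. K n) = UNIV"
    using finite_process_sigma_compact[OF assms(1) prP[OF I(3)] sP fpP[OF I(3)]] by blast
  interpret sigma_compact_space K using K by unfold_locales auto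
  define r where "r i x = \<rho> i (return borel x)" for i x
  define L where "L i = (\<integral>\<^sup>+x. ennreal (r i x) \<partial>l)" for i
  note cfi = correlation_function_intensity[OF fpP assms(2) cfP]
  have rm [measurable]: "r i \<in> borel_measurable borel" if "i \<in> I" for i
    unfolding r_def[abs_def] by (rule cfi(1)[OF that that, of UNIV]) simp
  have r0: "0 \<le> r i x" if "i \<in> I" for i x
    unfolding r_def by (rule cfi(2)[OF that that, of UNIV]) simp
  have intens: "(\<integral>\<^sup>+\<phi>. emeasure \<phi> A \<partial>P i) = (\<integral>\<^sup>+x. ennreal (r i x) * indicator A x \<partial>l)"
    if "i \<in> I" "A \<in> sets borel" for i A
    unfolding r_def by (rule cfi(3)[OF that(1,1,2)])
  have L: "(\<integral>\<^sup>+\<phi>. ?m \<phi> \<partial>P i) = L i" if "i \<in> I" for i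
    using intens[OF that, of UNIV] by (simp add: L_def)
  note [measurable] = assms(9)
  define rr where "rr x = (\<Sum>i\<in>I. r i x)" for x
  have rrm [measurable]: "rr \<in> borel_measurable borel" unfolding rr_def[abs_def] by measurable
  have rr0: "0 \<le> rr x" for x unfolding rr_def by (intro sum_nonneg r0)
  define R where "R = (\<integral>\<^sup>+x. ennreal \<bar>rr x - m x\<bar> \<partial>l)"
  define L' where "L' = Max (L ` I)"
  have goal: "Delta_TV_star (distr \<Omega> ?C (\<lambda>\<omega>. superpose I (\<lambda>i. \<Phi> i \<omega>))) (distr \<Omega>' ?C \<zeta>) \<le> R + 2 * of_nat n * L'\<^sup>2"
  \<comment> \<open>An infinite bound is trivial, where \<open>n \<ge> 1\<close> keeps
    \<open>2 * of_nat n * L'\<^sup>2\<close> infinite along with \<open>L'\<close>. Otherwise all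
    the measures below are finite, as the constructions and the final cancellation demand.\<close>
  proof (cases "R = top \<or> L' = top")
    case True
    then have top: "R + 2 * of_nat n * L'\<^sup>2 = top"
      using assms(3) by (auto simp: ennreal_mult_eq_top_iff power2_eq_square)
    show ?thesis unfolding top by (rule top_greatest)
  next
    case False
    have LL': "L i \<le> L'" if "i \<in> I" for i unfolding L'_def using I that by (intro Max_ge) auto
    have Lfin: "L i < top" if "i \<in> I" for i
      using LL'[OF that] False by (metis le_less_trans less_top)
    define mm where "mm x = min (rr x) (m x)" for x
    have mmm [measurable]: "mm \<in> borel_measurable borel" unfolding mm_def[abs_def] by measurable
    have mm0: "0 \<le> mm x" for x using rr0 assms(10) by (simp add: mm_def)
    \<comment> \<open>Where \<open>rr x = 0\<close> the quotient is 0 by convention; since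
      \<open>m\<close> is nonnegative, \<open>mm x\<close> vanishes there too, and the
      \<open>w i\<close> add up to \<open>mm\<close> everywhere.\<close>
    define w where "w i x = r i x * (mm x / rr x)" for i x
    have wm [measurable]: "w i \<in> borel_measurable borel" if "i \<in> I" for i
      using that unfolding w_def[abs_def] by measurable
    have w0: "0 \<le> w i x" if "i \<in> I" for i x
      unfolding w_def by (intro mult_nonneg_nonneg divide_nonneg_nonneg r0 that mm0 rr0)
    have wr: "w i x \<le> r i x" if "i \<in> I" for i x
    proof -
      have "mm x / rr x \<le> 1" using rr0[of x] by (cases "rr x = 0") (auto simp: mm_def)
      then show ?thesis unfolding w_def using r0[OF that] by (intro mult_left_le) auto
    qed
    have ws: "(\<Sum>i\<in>I. w i x) = mm x" for x
    proof -
      have "(\<Sum>i\<in>I. w i x) = rr x * (mm x / rr x)"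
        unfolding w_def rr_def by (rule sum_distrib_right[symmetric])
      then show ?thesis using assms(10)[of x] by (cases "rr x = 0") (auto simp: mm_def)
    qed
    define \<mu> where "\<mu> i = density l (\<lambda>x. ennreal (w i x))" for i
    define \<mu>' where "\<mu>' = density l (\<lambda>x. ennreal (m x - mm x))"
    define M where "M = density l (\<lambda>x. ennreal (m x))"
    have mmle: "mm x \<le> m x" for x by (simp add: mm_def)
    have s\<mu>: "sets (\<mu> i) = sets borel" "sets \<mu>' = sets borel" "sets M = sets borel" for i
      using sl by (auto simp: \<mu>_def \<mu>'_def M_def)
    have e\<mu>: "emeasure (\<mu> i) A = (\<integral>\<^sup>+x. ennreal (w i x) * indicator A x \<partial>l)"
      if "i \<in> I" "A \<in> sets borel" for i A
      unfolding \<mu>_def using that by (intro emeasure_density) (auto simp: lm sl)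
    have e\<mu>': "emeasure \<mu>' A = (\<integral>\<^sup>+x. ennreal (m x - mm x) * indicator A x \<partial>l)" if "A \<in> sets borel" for A
      unfolding \<mu>'_def using that by (intro emeasure_density) (auto simp: lm sl)
    have eM: "emeasure M A = (\<integral>\<^sup>+x. ennreal (m x) * indicator A x \<partial>l)" if "A \<in> sets borel" for A
      unfolding M_def using that by (intro emeasure_density) (auto simp: lm sl)
    have \<mu>le: "emeasure (\<mu> i) A \<le> (\<integral>\<^sup>+\<phi>. emeasure \<phi> A \<partial>P i)" if "i \<in> I" "A \<in> sets borel" for i A
      unfolding e\<mu>[OF that] intens[OF that]
      by (intro nn_integral_mono mult_right_mono ennreal_leI wr that) simp
    have \<mu>fin: "emeasure (\<mu> i) UNIV < top" if "i \<in> I" for i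
      using \<mu>le[OF that, of UNIV] Lfin[OF that] L[OF that] by (auto intro: le_less_trans)
    have fm\<mu>: "finite_measure (\<mu> i)" if "i \<in> I" for i
      using \<mu>fin[OF that] sets_eq_imp_space_eq[OF s\<mu>(1)] by (intro finite_measureI) (auto simp: less_top)
    have Meq: "emeasure M A = (\<Sum>i\<in>I. emeasure (\<mu> i) A) + emeasure \<mu>' A" if A: "A \<in> sets borel" for A
    proof -
      have "emeasure M A = (\<integral>\<^sup>+x. (\<Sum>i\<in>I. ennreal (w i x) * indicator A x) + ennreal (m x - mm x) * indicator A x \<partial>l)"
        unfolding eM[OF A]
      proof (rule nn_integral_cong)
        fix x
        have "ennreal (m x) = ennreal (mm x) + ennreal (m x - mm x)"
          using mm0[of x] mmle[of x] by (simp flip: ennreal_plus)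
        also have "ennreal (mm x) = (\<Sum>i\<in>I. ennreal (w i x))"
          using w0 by (subst sum_ennreal) (auto simp: ws)
        finally show "ennreal (m x) * indicator A x
          = (\<Sum>i\<in>I. ennreal (w i x) * indicator A x) + ennreal (m x - mm x) * indicator A x"
          by (simp add: distrib_right sum_distrib_right)
      qed
      also have "\<dots> = (\<Sum>i\<in>I. emeasure (\<mu> i) A) + emeasure \<mu>' A"
        using A by (subst nn_integral_add) (auto simp: nn_integral_sum lm e\<mu> e\<mu>')
      finally show ?thesis .
    qed
    define S where "S = (\<Sum>i\<in>I. emeasure (\<mu> i) UNIV)"
    have Sfin: "S < top" unfolding S_def using I \<mu>fin by simp
    have S_eq: "S = (\<integral>\<^sup>+x. ennreal (mm x) \<partial>l)"
    proof -
      have "S = (\<integral>\<^sup>+x. (\<Sum>i\<in>I. ennreal (w i x)) \<partial>l)"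
        unfolding S_def by (subst nn_integral_sum) (auto simp: lm e\<mu>)
      then show ?thesis using w0 by (simp add: sum_ennreal ws)
    qed
    \<comment> \<open>Pointwise, \<open>rr + (m - mm)\<close> equals
      \<open>\<bar>rr - m\<bar> + mm\<close>. With \<open>S\<close> on the right, the unmatched mass
      of both sides is expressed without subtraction.\<close>
    have bal: "(\<Sum>i\<in>I. L i) + emeasure \<mu>' UNIV = R + S"
    proof -
      have "(\<Sum>i\<in>I. L i) + emeasure \<mu>' UNIV = (\<integral>\<^sup>+x. ennreal (rr x) \<partial>l) + (\<integral>\<^sup>+x. ennreal (m x - mm x) \<partial>l)"
        unfolding L_def rr_def using r0
        by (subst nn_integral_sum[symmetric]) (auto simp: lm e\<mu>' sum_ennreal)
      also have "\<dots> = (\<integral>\<^sup>+x. ennreal (rr x) + ennreal (m x - mm x) \<partial>l)"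
        by (rule nn_integral_add[symmetric]) (auto simp: lm)
      also have "\<dots> = (\<integral>\<^sup>+x. ennreal \<bar>rr x - m x\<bar> + ennreal (mm x) \<partial>l)"
        using rr0 mm0 mmle
        by (intro nn_integral_cong) (auto simp: mm_def min_def simp flip: ennreal_plus)
      also have "\<dots> = R + S"
        unfolding R_def S_eq by (rule nn_integral_add) (auto simp: lm)
      finally show ?thesis .
    qed
    then have "emeasure \<mu>' UNIV \<le> R + S" by (metis add.commute le_iff_add)
    then have \<mu>'fin: "emeasure \<mu>' UNIV < top"
      using Sfin False by (auto simp: less_top intro: le_less_trans)
    then have fm\<mu>': "finite_measure \<mu>'"
      using sets_eq_imp_space_eq[OF s\<mu>(2)] by (intro finite_measureI) (auto simp: less_top)
    define good where "good i T \<longleftrightarrow> prob_space T \<and> sets T = sets (?C \<Otimes>\<^sub>M ?C \<Otimes>\<^sub>M ?C) \<and>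
      distr T ?C (\<lambda>z. add_config (fst z) (fst (snd z))) = P i \<and>
      poisson_gf (\<mu> i) (distr T ?C (\<lambda>z. add_config (fst z) (snd (snd z)))) \<and>
      (\<integral>\<^sup>+z. ?m (fst (snd z)) + ?m (snd (snd z)) \<partial>T) + emeasure (\<mu> i) UNIV \<le> L i + 2 * (L i)\<^sup>2" for i T
    have "\<exists>T. good i T" if i: "i \<in> I" for i
      unfolding good_def L[OF i, symmetric]
    proof (rule repulsive_poisson_coupling[OF prP[OF i] sP fm\<mu>[OF i] s\<mu>(1)])
      fix A :: "'a set" assume A: "A \<in> sets borel"
      have "emeasure (P i) {\<phi> \<in> configs. ?m \<phi> = 0} * emeasure (\<mu> i) A
        \<le> emeasure (P i) {\<phi> \<in> configs. ?m \<phi> = 0} * (\<integral>\<^sup>+\<phi>. emeasure \<phi> A \<partial>P i)"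
        by (intro mult_left_mono \<mu>le i A) simp
      also have "\<dots> \<le> (\<integral>\<^sup>+\<phi>. (if ?m \<phi> = 1 then emeasure \<phi> A else 0) \<partial>P i)"
        by (rule weakly_repulsive_one_point[OF prP[OF i] sP fpP[OF i] sl wrP[OF i] A])
      finally show "emeasure (P i) {\<phi> \<in> configs. ?m \<phi> = 0} * emeasure (\<mu> i) A
        \<le> (\<integral>\<^sup>+\<phi>. (if ?m \<phi> = 1 then emeasure \<phi> A else 0) \<partial>P i)" .
    next
      show "emeasure (\<mu> i) UNIV \<le> (\<integral>\<^sup>+\<phi>. ?m \<phi> \<partial>P i)" by (rule \<mu>le[OF i]) simp
      show "(\<integral>\<^sup>+\<phi>. ?m \<phi> \<partial>P i) < top" using Lfin[OF i] L[OF i] by simp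
    qed
    then have "\<forall>i\<in>I. \<exists>T. good i T" by (rule ballI)
    from bchoice[OF this] obtain T0 where "\<forall>i\<in>I. good i (T0 i)" ..
    note T0 = this[THEN bspec, unfolded good_def]
    \<comment> \<open>The product of the couplings is formed from a family of probability spaces
      given at every index, hence the default outside \<open>I\<close>.\<close>
    define T where "T i = (if i \<in> I then T0 i else T0 1)" for i
    have T_in: "T i = T0 i" if "i \<in> I" for i using that by (simp add: T_def)
    obtain Q where Q: "prob_space Q" "sets Q = sets ?C" "poisson_gf \<mu>' Q" "(\<integral>\<^sup>+\<phi>. ?m \<phi> \<partial>Q) = emeasure \<mu>' UNIV"
      using poisson_exists[OF fm\<mu>' s\<mu>(2)] by blast
    define c where "c i = (\<integral>\<^sup>+z. ?m (fst (snd z)) + ?m (snd (snd z)) \<partial>T i)" for i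
    have "Delta_TV_star (distr \<Omega> ?C (\<lambda>\<omega>. superpose I (\<lambda>i. \<Phi> i \<omega>))) (distr \<Omega>' ?C \<zeta>)
      \<le> (\<Sum>i\<in>I. c i) + (\<integral>\<^sup>+\<phi>. ?m \<phi> \<partial>Q)"
      unfolding c_def
    proof (rule superposition_coupling[where \<mu>=\<mu> and \<mu>'=\<mu>' and M=M])
      show "prob_space.indep_vars \<Omega> (\<lambda>_. ?C) \<Phi> I" using assms(5) by (simp add: I_def)
      show "prob_space (T i)" for i using T0 I(3) by (simp add: T_def)
      show "prob_space (distr \<Omega>' ?C \<zeta>)" by (rule prob_space.prob_space_distr[OF assms(11,12)])
      show "poisson_gf M (distr \<Omega>' ?C \<zeta>)"
        unfolding M_def by (rule poisson_process_gf[OF assms(13)])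
      fix B :: "'a set" assume "B \<in> rc_borel"
      then have B: "B \<in> sets borel" by (rule rc_borel_sets)
      interpret \<mu>': finite_measure \<mu>' by (rule fm\<mu>')
      have "emeasure (\<mu> i) B = ennreal (measure (\<mu> i) B)" if "i \<in> I" for i
        by (rule finite_measure.emeasure_eq_measure[OF fm\<mu>[OF that]])
      then have *: "emeasure M B = ennreal ((\<Sum>i\<in>I. measure (\<mu> i) B) + measure \<mu>' B)"
        unfolding Meq[OF B] by (simp add: \<mu>'.emeasure_eq_measure sum_nonneg)
      show "measure M B = (\<Sum>i\<in>I. measure (\<mu> i) B) + measure \<mu>' B"
        unfolding measure_def[of M B] * by (intro enn2real_ennreal add_nonneg_nonneg sum_nonneg) auto
    qed (use I Q T0 assms(4) in \<open>auto simp: T_in P_def\<close>)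
    also have "\<dots> \<le> R + 2 * of_nat n * L'\<^sup>2"
    proof -
      \<comment> \<open>\<open>S\<close> is added to the total cost because each coupling bounds its
        cost only together with the mass of \<open>\<mu> i\<close>. After \<open>bal\<close> the
        same \<open>S\<close> appears on the right, and being finite it cancels.\<close>
      have "((\<Sum>i\<in>I. c i) + emeasure \<mu>' UNIV) + S = (\<Sum>i\<in>I. c i + emeasure (\<mu> i) UNIV) + emeasure \<mu>' UNIV"
        by (simp add: S_def sum.distrib ac_simps)
      also have "\<dots> \<le> (\<Sum>i\<in>I. L i + 2 * (L i)\<^sup>2) + emeasure \<mu>' UNIV"
        using T0 by (intro add_right_mono sum_mono) (simp add: c_def T_in)
      also have "\<dots> = ((\<Sum>i\<in>I. L i) + emeasure \<mu>' UNIV) + (\<Sum>i\<in>I. 2 * (L i)\<^sup>2)"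
        by (simp add: sum.distrib ac_simps)
      also have "\<dots> = (R + (\<Sum>i\<in>I. 2 * (L i)\<^sup>2)) + S"
        unfolding bal by (simp add: ac_simps)
      finally have "S + ((\<Sum>i\<in>I. c i) + emeasure \<mu>' UNIV) \<le> S + (R + (\<Sum>i\<in>I. 2 * (L i)\<^sup>2))"
        by (simp only: add.commute[of _ S])
      then have "(\<Sum>i\<in>I. c i) + emeasure \<mu>' UNIV \<le> R + (\<Sum>i\<in>I. 2 * (L i)\<^sup>2)"
        unfolding ennreal_add_left_cancel_le using Sfin by auto
      also have "(\<Sum>i\<in>I. 2 * (L i)\<^sup>2) \<le> (\<Sum>i\<in>I. 2 * L'\<^sup>2)"
        using LL' by (intro sum_mono mult_left_mono power_mono) auto
      also have "(\<Sum>i\<in>I. 2 * L'\<^sup>2) = 2 * of_nat n * L'\<^sup>2"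
        by (simp add: I_def ac_simps)
      finally show ?thesis by (simp add: Q(4) add_left_mono)
    qed
    finally show ?thesis .
  qed
  then show ?thesis
    unfolding I_def R_def rr_def L'_def L_def r_def .
qed

end
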